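(* Assume the following. (1) (i) For some $\bar\theta\in\Theta$ the expectation $\mathbb{E}_{P_*}[l(X,\bar\theta)^2]$ is finite; (ii) there is a measurable function $\psi:\mathcal{S}\to\mathbb{R}_+$ with $\mathbb{E}_{P_*}[\psi(X)^2]<\infty$ such that $|l(X,\theta)-l(X,\theta')|\le\psi(X)\|\theta-\theta'\|$ for all $\theta,\theta'\in\Theta$ and $P_*$-a.e. $X\in\mathcal{S}$. (2) There are a constant $\gamma>0$, random fields $R_n(\theta)$, $\theta\in\Theta$, and a continuous deterministic function $\varrho:\Theta\to\mathbb{R}$ such that $$\mathcal{F}_n(\theta,\delta_n)=f_n(\theta)+\delta_n^{\gamma}R_n(\theta)+\delta_n^{\gamma}\epsilon_n(\theta),\qquad R_n(\theta)=\varrho(\theta)+\epsilon_n'(\theta),\qquad \theta\in\Theta,$$ where $\epsilon_n,\epsilon_n'$ are random fields with $\sup_{\theta\in\Theta}|\epsilon_n(\theta)|=o_p(1)$ and $\sup_{\theta\in\Theta}|\epsilon_n'(\theta)|=o_p(1)$. Then, as $n\to\infty$: (a) If $\delta_n^{\gamma}=o(n^{-1/2})$, then $\bar\vartheta_n=\vartheta_n+o_p(n^{-1/2})$, and hence $$n^{1/2}(\bar\vartheta_n-\vartheta)\rightsquigarrow\inf_{\theta\in\Theta^*}\mathfrak{g}(\theta).$$ (b) If $\delta_n^{\gamma}=n^{-1/2}$, then $$n^{1/2}(\bar\vartheta_n-\vartheta)\rightsquigarrow\inf_{\theta\in\Theta^*}\{\mathfrak{g}(\theta)+\varrho(\theta)\}.$$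 (c) If $n^{-1/2}=o(\delta_n^{\gamma})$, then $$\delta_n^{-\gamma}(\bar\vartheta_n-\vartheta)\rightsquigarrow\inf_{\theta\in\Theta^*}\varrho(\theta).$$
   Context: $\mathcal{S}\subset\mathbb{R}^d$ is a nonempty closed set, $\mathfrak{P}(\mathcal{S})$ is the set of Borel probability measures on $\mathcal{S}$, and $X,X_1,X_2,\dots$ are i.i.d. with distribution $P_*\in\mathfrak{P}(\mathcal{S})$. $P_n=n^{-1}\sum_{i=1}^n\delta_{X_i}$ is the empirical measure ($\delta_x$ being the Dirac measure at $x$). $\Theta\subset\mathbb{R}^m$ is a compact set, and $l:\mathbb{R}^d\times\Theta\to\mathbb{R}$ is a loss function that is continuous on $\mathcal{S}\times\Theta$. $f(\theta):=\mathbb{E}_{P_*}[l(X,\theta)]$, $f_n(\theta):=\mathbb{E}_{P_n}[l(X,\theta)]=n^{-1}\sum_{i=1}^n l(X_i,\theta)$, $\vartheta:=\inf_{\theta\in\Theta}f(\theta)$, $\Theta^*:=\arg\min_{\theta\in\Theta}f(\theta)$, $\vartheta_n:=\inf_{\theta\in\Theta}f_n(\theta)$. $D(\cdot,\cdot)\ge 0$ is a divergence on $\mathfrak{P}(\mathcal{S})$ (with $D(P,P)=0$), and the ambiguity sets are $\mathfrak{M}_\delta(P_n):=\{P\in\mathfrak{P}(\mathcal{S}):D(P,P_n)\le\delta\}$, $\delta\ge0$. $(\delta_n)$ is a monotonically decreasing sequence of positive numbers tending to $0$. $\mathcal{F}_n(\theta,\delta_n):=\sup_{P\in\mathfrak{M}_{\delta_n}(P_n)}\mathbb{E}_P[l(X,\theta)]$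 and $\bar\vartheta_n:=\inf_{\theta\in\Theta}\mathcal{F}_n(\theta,\delta_n)$. $\mathfrak{g}(\theta)$, $\theta\in\Theta$, is a mean zero Gaussian random field with continuous sample paths and covariance function $\mathrm{Cov}(\mathfrak{g}(\theta),\mathfrak{g}(\theta'))=\mathrm{Cov}_{P_*}(l(X,\theta),l(X,\theta'))$. The symbol $\rightsquigarrow$ denotes convergence in distribution; $Y_n=o_p(n^{-a})$ means $n^{a}Y_n\to0$ in probability. *)

theory Defs
  imports "HOL-Probability.Probability"
begin

abbreviation borel_on :: "'a::topological_space set \<Rightarrow> 'a measure" where
  "borel_on S \<equiv> restrict_space borel S"

definition prob_measures_on :: "'a::topological_space set \<Rightarrow> 'a measure set" where
  "prob_measures_on S = space (prob_algebra (borel_on S))"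

definition empirical_measure ::
    "'a::topological_space set \<Rightarrow> (nat \<Rightarrow> 'w \<Rightarrow> 'a) \<Rightarrow> nat \<Rightarrow> 'w \<Rightarrow> 'a measure" where
  "empirical_measure S X n \<omega> =
     measure_of S (sets (borel_on S))
       (\<lambda>A. (\<Sum>i=1..n. emeasure (return (borel_on S) (X i \<omega>)) A) / of_nat n)"

definition risk :: "('a \<Rightarrow> 'b \<Rightarrow> real) \<Rightarrow> 'a measure \<Rightarrow> 'b \<Rightarrow> real" where
  "risk l P \<theta> = (\<integral>x. l x \<theta> \<partial>P)"

definition optimal_value :: "'b set \<Rightarrow> ('b \<Rightarrow> real) \<Rightarrow> real" where
  "optimal_value \<Theta> f = (INF \<theta>\<in>\<Theta>. f \<theta>)"

definition optimal_set :: "'b set \<Rightarrow> ('b \<Rightarrow> real) \<Rightarrow> 'b set" where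
  "optimal_set \<Theta> f = {\<theta>. is_arg_min f (\<lambda>\<theta>. \<theta> \<in> \<Theta>) \<theta>}"

text \<open>
  The ambiguity set may contain measures under which the loss is not integrable, and the
  worst-case expectation may be infinite, so expectations over it are extended real valued.
  As usual in minimization, \<open>\<infinity> - \<infinity>\<close> is \<open>\<infinity>\<close>: the worst-case expectation is
  below \<open>\<infinity>\<close> only if the positive part of the loss is integrable under every measure in the set.
\<close>

definition extended_expectation :: "'a measure \<Rightarrow> ('a \<Rightarrow> real) \<Rightarrow> ereal" where
  "extended_expectation P h =
     enn2ereal (\<integral>\<^sup>+x. ennreal (h x) \<partial>P) - enn2ereal (\<integral>\<^sup>+x. ennreal (- h x) \<partial>P)"

definition ambiguity_set ::
    "'a::topological_space set \<Rightarrow> ('a measure \<Rightarrow> 'a measure \<Rightarrow> ereal) \<Rightarrow> 'a measure \<Rightarrow> real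
      \<Rightarrow> 'a measure set" where
  "ambiguity_set S D Q \<delta> = {P \<in> prob_measures_on S. D P Q \<le> ereal \<delta>}"

definition worst_case_risk ::
    "'a::topological_space set \<Rightarrow> ('a measure \<Rightarrow> 'a measure \<Rightarrow> ereal) \<Rightarrow> ('a \<Rightarrow> 'b \<Rightarrow> real)
      \<Rightarrow> 'a measure \<Rightarrow> real \<Rightarrow> 'b \<Rightarrow> ereal" where
  "worst_case_risk S D l Q \<delta> \<theta> =
     (SUP P\<in>ambiguity_set S D Q \<delta>. extended_expectation P (\<lambda>x. l x \<theta>))"

definition robust_value ::
    "'a::topological_space set \<Rightarrow> ('a measure \<Rightarrow> 'a measure \<Rightarrow> ereal) \<Rightarrow> ('a \<Rightarrow> 'b \<Rightarrow> real)
      \<Rightarrow> 'b set \<Rightarrow> 'a measure \<Rightarrow> real \<Rightarrow> ereal" where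
  "robust_value S D l \<Theta> Q \<delta> = (INF \<theta>\<in>\<Theta>. worst_case_risk S D l Q \<delta> \<theta>)"

text \<open>
  Convergence in probability to zero, for extended real random variables because a
  supremum of \<open>\<bar>\<epsilon>\<^sub>n(\<theta>)\<bar>\<close> over \<open>\<theta>\<close> need not be finite on every sample point. The
  measurability clauses here and in convergence in distribution matter: for a
  non-measurable \<open>Y\<close>, the terms \<open>measure M\<close> and \<open>distr\<close> below would be meaningless.
\<close>

definition tends_to_zero_in_prob :: "'w measure \<Rightarrow> (nat \<Rightarrow> 'w \<Rightarrow> ereal) \<Rightarrow> bool" where
  "tends_to_zero_in_prob M Y \<longleftrightarrow>
     (\<forall>\<^sub>F n in sequentially. Y n \<in> borel_measurable M) \<and>
     (\<forall>e::real>0. (\<lambda>n. measure M {\<omega>\<in>space M. \<bar>Y n \<omega>\<bar> > ereal e}) \<longlonglongrightarrow> 0)"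

text \<open>\<open>small_o_p M Y a\<close> is \<open>Y\<^sub>n = o\<^sub>p(n powr (-a))\<close>.\<close>

definition small_o_p :: "'w measure \<Rightarrow> (nat \<Rightarrow> 'w \<Rightarrow> ereal) \<Rightarrow> real \<Rightarrow> bool" where
  "small_o_p M Y a \<longleftrightarrow> tends_to_zero_in_prob M (\<lambda>n \<omega>. ereal (real n powr a) * Y n \<omega>)"

definition converges_in_distribution ::
    "'w measure \<Rightarrow> (nat \<Rightarrow> 'w \<Rightarrow> real) \<Rightarrow> 'v measure \<Rightarrow> ('v \<Rightarrow> real) \<Rightarrow> bool" where
  "converges_in_distribution M Y N Z \<longleftrightarrow>
     (\<forall>\<^sub>F n in sequentially. Y n \<in> borel_measurable M) \<and> Z \<in> borel_measurable N \<and>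
     weak_conv_m (\<lambda>n. distr M borel (Y n)) (distr N borel Z)"

definition covariance :: "'w measure \<Rightarrow> ('w \<Rightarrow> real) \<Rightarrow> ('w \<Rightarrow> real) \<Rightarrow> real" where
  "covariance M Y Z =
     (\<integral>\<omega>. (Y \<omega> - (\<integral>\<omega>'. Y \<omega>' \<partial>M)) * (Z \<omega> - (\<integral>\<omega>'. Z \<omega>' \<partial>M)) \<partial>M)"

definition random_field :: "'w measure \<Rightarrow> 'b set \<Rightarrow> ('b \<Rightarrow> 'w \<Rightarrow> real) \<Rightarrow> bool" where
  "random_field M \<Theta> g \<longleftrightarrow> (\<forall>\<theta>\<in>\<Theta>. g \<theta> \<in> borel_measurable M)"

text \<open>Normal random variables include the degenerate (constant) ones.\<close>

definition gaussian_variable :: "'w measure \<Rightarrow> ('w \<Rightarrow> real) \<Rightarrow> bool" where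
  "gaussian_variable M Y \<longleftrightarrow> Y \<in> borel_measurable M \<and>
     (\<exists>\<mu> \<sigma>. (\<sigma> > 0 \<and> distributed M lborel Y (normal_density \<mu> \<sigma>)) \<or>
            distr M borel Y = return borel \<mu>)"

text \<open>
  The finite-dimensional distributions are multivariate normal, that is, every linear
  combination of finitely many coordinates is normal.
\<close>

definition gaussian_field :: "'w measure \<Rightarrow> 'b set \<Rightarrow> ('b \<Rightarrow> 'w \<Rightarrow> real) \<Rightarrow> bool" where
  "gaussian_field M \<Theta> g \<longleftrightarrow> random_field M \<Theta> g \<and>
     (\<forall>F c. finite F \<longrightarrow> F \<subseteq> \<Theta> \<longrightarrow> gaussian_variable M (\<lambda>\<omega>. \<Sum>\<theta>\<in>F. c \<theta> * g \<theta> \<omega>))"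

lemma emeasure_empirical_measure:
  assumes "n \<ge> 1" and "A \<in> sets (borel_on S)"
  shows "emeasure (empirical_measure S X n \<omega>) A =
    (\<Sum>i=1..n. emeasure (return (borel_on S) (X i \<omega>)) A) / of_nat n"
proof -
  let ?B = "borel_on S"
  let ?\<mu> = "\<lambda>A. (\<Sum>i=1..n. emeasure (return ?B (X i \<omega>)) A) / of_nat n"
  have sp: "space ?B = S" by (simp add: space_restrict_space)
  have ca: "countably_additive (sets ?B) ?\<mu>"
  proof (rule countably_additiveI)
    fix C :: "nat \<Rightarrow> _" assume C: "range C \<subseteq> sets ?B" "disjoint_family C"
    have "(\<Sum>k. ?\<mu> (C k)) = (\<Sum>k. \<Sum>i=1..n. emeasure (return ?B (X i \<omega>)) (C k)) / of_nat n"
      by (simp add: divide_ennreal_def)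
    also have "(\<Sum>k. \<Sum>i=1..n. emeasure (return ?B (X i \<omega>)) (C k)) =
        (\<Sum>i=1..n. \<Sum>k. emeasure (return ?B (X i \<omega>)) (C k))"
      by (rule suminf_sum) simp
    also have "\<dots> = (\<Sum>i=1..n. emeasure (return ?B (X i \<omega>)) (\<Union>k. C k))"
      by (intro sum.cong refl suminf_emeasure) (use C in auto)
    finally show "(\<Sum>k. ?\<mu> (C k)) = ?\<mu> (\<Union>k. C k)" .
  qed
  have sa: "sigma_algebra S (sets ?B)"
    using sets.sigma_algebra_axioms[of ?B] sp by simp
  show ?thesis
    unfolding empirical_measure_def
    by (rule emeasure_measure_of_sigma[OF sa _ ca assms(2)])
       (simp add: positive_def)
qed

lemma empirical_measure_in_prob_measures_on:
  assumes "n \<ge> 1" and "\<And>i. 1 \<le> i \<Longrightarrow> i \<le> n \<Longrightarrow> X i \<omega> \<in> S"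
  shows "empirical_measure S X n \<omega> \<in> prob_measures_on S"
proof -
  have sp: "space (borel_on S) = S" by (simp add: space_restrict_space)
  have sa: "sigma_algebra S (sets (borel_on S))"
    using sets.sigma_algebra_axioms[of "borel_on S"] sp by simp
  have st: "sets (empirical_measure S X n \<omega>) = sets (borel_on S)"
    unfolding empirical_measure_def using sigma_algebra.sets_measure_of_eq[OF sa] by simp
  have spe: "space (empirical_measure S X n \<omega>) = S"
    using sets_eq_imp_space_eq[OF st] sp by simp
  have S_in: "S \<in> sets (borel_on S)"
    using sets.top[of "borel_on S"] sp by simp
  have "emeasure (empirical_measure S X n \<omega>) S =
      (\<Sum>i=1..n. emeasure (return (borel_on S) (X i \<omega>)) S) / of_nat n"
    by (rule emeasure_empirical_measure[OF assms(1) S_in])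
  also have "(\<Sum>i=1..n. emeasure (return (borel_on S) (X i \<omega>)) S) = (\<Sum>i=1..n. 1)"
    by (intro sum.cong refl) (use assms(2) S_in in auto)
  also have "(\<Sum>i=1..n. 1) / of_nat n = (1::ennreal)"
    using assms(1) by (simp add: ennreal_divide_self ennreal_of_nat_eq_real_of_nat)
  finally have "prob_space (empirical_measure S X n \<omega>)"
    by (intro prob_spaceI) (simp add: spe)
  then show ?thesis
    using st by (simp add: prob_measures_on_def space_prob_algebra)
qed

lemma risk_empirical_measure:
  fixes l :: "'a::topological_space \<Rightarrow> 'b \<Rightarrow> real"
  assumes "n \<ge> 1" and X: "\<And>i. 1 \<le> i \<Longrightarrow> i \<le> n \<Longrightarrow> X i \<omega> \<in> S"
    and l: "(\<lambda>x. l x \<theta>) \<in> borel_measurable (borel_on S)"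
  shows "risk l (empirical_measure S X n \<omega>) \<theta> = (\<Sum>i=1..n. l (X i \<omega>) \<theta>) / real n"
proof -
  let ?B = "borel_on S" and ?U = "uniform_count_measure {1..n}"
  have sp: "space ?B = S" by (simp add: space_restrict_space)
  have st: "sets (empirical_measure S X n \<omega>) = sets ?B"
    using empirical_measure_in_prob_measures_on[of n X \<omega> S] assms(1) X
    by (simp add: prob_measures_on_def space_prob_algebra)
  have m: "(\<lambda>i. X i \<omega>) \<in> measurable ?U ?B"
    using X by (auto simp: measurable_def sp space_uniform_count_measure sets_uniform_count_measure)
  have "empirical_measure S X n \<omega> = distr ?U ?B (\<lambda>i. X i \<omega>)"
  proof (rule measure_eqI)
    fix A assume "A \<in> sets (empirical_measure S X n \<omega>)"
    then have A: "A \<in> sets ?B" using st by simp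
    let ?J = "(\<lambda>i. X i \<omega>) -` A \<inter> {1..n}"
    have "emeasure (empirical_measure S X n \<omega>) A =
        (\<Sum>i=1..n. indicator ?J i) / of_nat n"
      unfolding emeasure_empirical_measure[OF assms(1) A]
      by (intro arg_cong2[where f = "(/)"] sum.cong refl)
         (use A in \<open>auto simp: indicator_def\<close>)
    also have "(\<Sum>i=1..n. indicator ?J i) = (of_nat (card ?J) :: ennreal)"
      by (simp add: sum.If_cases indicator_def Int_commute Int_def)
    also have "of_nat (card ?J) / of_nat n = ennreal (card ?J / card {1..n})"
      using assms(1) by (simp add: ennreal_of_nat_eq_real_of_nat divide_ennreal)
    also have "\<dots> = emeasure ?U ?J"
      by (subst emeasure_uniform_count_measure) auto
    also have "\<dots> = emeasure (distr ?U ?B (\<lambda>i. X i \<omega>)) A"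
      using A m by (simp add: emeasure_distr space_uniform_count_measure)
    finally show "emeasure (empirical_measure S X n \<omega>) A =
      emeasure (distr ?U ?B (\<lambda>i. X i \<omega>)) A" .
  qed (simp add: st)
  then have "risk l (empirical_measure S X n \<omega>) \<theta> = (\<integral>i. l (X i \<omega>) \<theta> \<partial>?U)"
    unfolding risk_def using integral_distr[OF m l] by simp
  then show ?thesis by (simp add: integral_uniform_count_measure)
qed

end

theory Submission
  imports Defs
begin

text \<open>
  Write \<open>G\<^sub>n = sqrt n (f\<^sub>n - f)\<close>. For scales \<open>a\<^sub>n \<rightarrow> \<infinity>\<close> with \<open>a\<^sub>n / sqrt n \<rightarrow> \<alpha>\<close> and
  \<open>a\<^sub>n \<delta>\<^sub>n powr \<gamma> \<rightarrow> \<beta>\<close>, the scaled value \<open>a\<^sub>n (inf F\<^sub>n - inf f)\<close> is up to \<open>o\<^sub>p(1)\<close> the infimum of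
  \<open>a\<^sub>n (f - inf f) + \<alpha> G\<^sub>n + \<beta> \<rho>\<close>, in which the first term forces \<open>\<theta>\<close> towards the optimal set. Cases (a),
  (b), (c) are \<open>(\<alpha>, \<beta>) = (1, 0), (1, 1), (0, 1)\<close>. Replacing the infimum over the optimal set by the one
  over a finite net needs asymptotic equicontinuity of \<open>G\<^sub>n\<close>: truncating the Lipschitz constant at
  \<open>sqrt n\<close> gives exponential tails for the increments, uniformly in \<open>n\<close>, and chaining over dyadic nets of
  \<open>\<Theta>\<close> applies. On a finite net, the central limit theorem for linear combinations yields joint convergence
  through trigonometric polynomials.
\<close>

section \<open>Multivariate convergence from characteristic functions\<close>

text \<open>The usual route is weak convergence of \<open>G n\<close> in the space of continuous
  functions on \<open>\<Theta>\<close> and a delta method for the infimum. Here no law on a function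
  space is formed. The infimum moves by at most the uniform distance of its arguments, so errors are
  estimated uniformly in \<open>\<theta>\<close> outside an event of small probability, until a
  function of finitely many coordinates is left.

  The obstacle is that \<open>\<psi>\<close> has a second moment only, whereas the nets grow
  geometrically and a union bound over them asks for exponential tails. The level
  \<open>sqrt n\<close> meets both needs: summands of that size, divided by \<open>sqrt n\<close>,
  have exponential moments whose product stays bounded in \<open>n\<close>, and square integrability
  of \<open>\<psi>\<close> makes it unlikely that any of \<open>n\<close> samples is cut off. Tails
  \<open>exp (- a / d)\<close> suffice, since on level \<open>k\<close> a threshold of order
  \<open>k / 2 ^ k\<close> beats the number of pairs, and these thresholds are summable.

  On a finite net, uniform second moments replace tightness in passing from characteristic functions
  to bounded continuous functions.\<close>

inductive_set trig :: "nat \<Rightarrow> ((nat \<Rightarrow> real) \<Rightarrow> complex) set" for k where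
  monom: "(\<lambda>y. c * cis (\<Sum>j<k. t j * y j)) \<in> trig k"
| add: "p \<in> trig k \<Longrightarrow> q \<in> trig k \<Longrightarrow> (\<lambda>y. p y + q y) \<in> trig k"

lemma trig_mult_monom:
  assumes "p \<in> trig k"
  shows "(\<lambda>y. c * cis (\<Sum>j<k. t j * y j) * p y) \<in> trig k"
  using assms
proof induction
  case (monom d u)
  have "(\<lambda>y. c * cis (\<Sum>j<k. t j * y j) * (d * cis (\<Sum>j<k. u j * y j))) =
      (\<lambda>y. (c * d) * cis (\<Sum>j<k. (t j + u j) * y j))"
    by (auto simp: cis_mult[symmetric] distrib_right sum.distrib)
  then show ?case using trig.monom[of "c * d" "\<lambda>j. t j + u j" k] by simp
next
  case (add p q)
  then show ?case using trig.add[OF add.IH] by (simp add: distrib_left)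
qed

text \<open>Frequencies add under multiplication; with the constants this gives the algebra required
  by Stone-Weierstrass.\<close>

lemma trig_mult:
  assumes "p \<in> trig k" "q \<in> trig k"
  shows "(\<lambda>y. p y * q y) \<in> trig k"
  using assms(1)
proof induction
  case (monom c t)
  show ?case by (rule trig_mult_monom[OF assms(2)])
next
  case (add p p')
  then show ?case using trig.add[OF add.IH] by (simp add: distrib_right)
qed

lemma trig_const: "(\<lambda>_. c) \<in> trig k"
  using trig.monom[of c "\<lambda>_. 0" k] by simp

text \<open>The sine combines exponentials with frequencies \<open>a\<close> and \<open>- a\<close>
  in the direction of coordinate \<open>j\<close>. The cast places a real function in a
  complex-valued algebra.\<close>

lemma trig_sin:
  assumes "j < k"
  shows "(\<lambda>y. complex_of_real (sin (a * y j))) \<in> trig k"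
proof -
  have eq: "(\<Sum>i<k. (if i = j then b else 0) * y i) = b * y j" for b and y :: "nat \<Rightarrow> real"
    using assms by (simp add: if_distrib[of "\<lambda>x. x * _"] cong: if_cong)
  have "(\<lambda>y. complex_of_real (sin (a * y j))) =
      (\<lambda>y. (- \<i> / 2) * cis (\<Sum>i<k. (if i = j then a else 0) * y i) +
           (\<i> / 2) * cis (\<Sum>i<k. (if i = j then - a else 0) * y i))"
    by (simp only: eq) (auto simp: complex_eq_iff)
  then show ?thesis by (simp only: trig.add[OF trig.monom trig.monom])
qed

text \<open>A point of \<open>k\<close>-dimensional space is encoded as a sequence that vanishes
  from \<open>k\<close> on. Compactness is Tychonoff's theorem; as the remaining coordinates are
  pinned to 0, distinct points differ in one of the first \<open>k\<close>.\<close>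

lemma compact_coordinate_box:
  "compact {s :: nat \<Rightarrow> real. \<forall>j. s j \<in> (if j < k then {-1..1} else {0})}"
proof -
  have "compactin (product_topology (\<lambda>_. euclidean) UNIV)
      (\<Pi>\<^sub>E j\<in>UNIV. (if j < k then {-1..1} else {0::real}))"
    by (subst compactin_PiE) auto
  then show ?thesis
    by (simp add: euclidean_product_topology PiE_UNIV_domain Pi_def)
qed

text \<open>
  Approximation by trigonometric polynomials whose period is so large that the quadratic
  weight absorbs the error made outside one half-period. Stone--Weierstrass applies in the
  coordinates \<open>sin (a * y j)\<close>, which lie in a compact box and determine \<open>y\<close> on that
  half-period; hence the approximant is globally bounded.
\<close>

lemma trig_approx:
  fixes h :: "(nat \<Rightarrow> real) \<Rightarrow> real"
  assumes h: "continuous_on UNIV h" and B: "\<And>y. \<bar>h y\<bar> \<le> B" and e: "e > 0"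
  shows "\<exists>f. (\<lambda>y. complex_of_real (f y)) \<in> trig k \<and>
    (\<forall>y. (\<forall>j\<ge>k. y j = 0) \<longrightarrow> \<bar>h y - f y\<bar> \<le> e * (1 + (\<Sum>j<k. (y j)\<^sup>2)))"
proof -
  have B0: "B \<ge> 0" using B[of undefined] by simp
  \<comment> \<open>Beyond \<open>K\<close> the weight must pay for the crude error
    \<open>2 * B + e\<close>: \<open>h\<close> is bounded by \<open>B\<close> and the approximant by
    \<open>B + e\<close>.\<close>
  define K where "K = sqrt ((2 * B + e) / e)"
  have K: "K > 0" "e * K\<^sup>2 = 2 * B + e" using B0 e by (auto simp: K_def)
  \<comment> \<open>Now \<open>\<bar>x\<bar> \<le> K\<close> amounts to
    \<open>\<bar>a * x\<bar> \<le> pi / 2\<close>, the range on which \<open>arcsin\<close> undoes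
    \<open>sin\<close>.\<close>
  define a where "a = pi / (2 * K)"
  have a: "a > 0" using K by (simp add: a_def)
  define C where "C = {s :: nat \<Rightarrow> real. \<forall>j. s j \<in> (if j < k then {-1..1} else {0})}"
  define \<sigma> where "\<sigma> y = (\<lambda>j. if j < k then sin (a * y j) else 0)" for y :: "nat \<Rightarrow> real"
  define R where "R = {f. continuous_on C f \<and> (\<lambda>y. complex_of_real (f (\<sigma> y))) \<in> trig k}"
  interpret function_ring_on R C
  proof
    show "compact C" unfolding C_def by (rule compact_coordinate_box)
    fix x y assume xy: "x \<in> C" "y \<in> C" "x \<noteq> y"
    then obtain j where j: "x j \<noteq> y j" by auto
    have jk: "j < k"
    proof (rule ccontr)
      assume "\<not> j < k"
      with xy have "x j = 0" "y j = 0" by (auto simp: C_def dest: spec[of _ j])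
      with j show False by simp
    qed
    have "(\<lambda>s. s j) \<in> R"
      using trig_sin[OF jk, of a] jk
      by (auto simp: R_def \<sigma>_def intro: continuous_on_subset[OF continuous_on_product_coordinates])
    then show "\<exists>f\<in>R. f x \<noteq> f y" using j by (intro bexI[of _ "\<lambda>s. s j"])
  qed (auto simp: R_def intro!: continuous_intros trig_const intro: trig.add trig_mult)
  \<comment> \<open>\<open>h\<close> read in the sine coordinates. Outside the cube of half-width
    \<open>K\<close>, \<open>H (\<sigma> y)\<close> is the value of \<open>h\<close> at another
    point, and therefore still bounded by \<open>B\<close>.\<close>
  define H where "H s = h (\<lambda>j. arcsin (s j) / a)" for s
  have "continuous_on C (\<lambda>s j. arcsin (s j) / a)"
    using a by (intro continuous_on_coordinatewise_then_product continuous_intros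
        continuous_on_subset[OF continuous_on_product_coordinates])
      (auto simp: C_def split: if_splits, (smt (verit))+)
  then have "continuous_on C H"
    unfolding H_def by (rule continuous_on_compose2[OF h]) auto
  from Stone_Weierstrass_basic[OF this e] obtain g
    where g: "g \<in> R" "\<And>s. s \<in> C \<Longrightarrow> \<bar>H s - g s\<bar> < e" by blast
  have \<sigma>: "\<sigma> y \<in> C" for y by (auto simp: C_def \<sigma>_def)
  show ?thesis
  proof (intro exI conjI allI impI)
    show "(\<lambda>y. complex_of_real (g (\<sigma> y))) \<in> trig k" using g by (simp add: R_def)
    fix y :: "nat \<Rightarrow> real" assume y: "\<forall>j\<ge>k. y j = 0"
    show "\<bar>h y - g (\<sigma> y)\<bar> \<le> e * (1 + (\<Sum>j<k. (y j)\<^sup>2))"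
    proof (cases "\<forall>j<k. \<bar>y j\<bar> \<le> K")
      case True
      have "arcsin (\<sigma> y j) / a = y j" for j
      proof (cases "j < k")
        case j: True
        then have "\<bar>y j\<bar> \<le> K" using True by blast
        then have "a * \<bar>y j\<bar> \<le> a * K" using a by (intro mult_left_mono) auto
        also have "a * K = pi / 2" using K by (simp add: a_def)
        finally have "\<bar>a * y j\<bar> \<le> pi / 2" using a by (simp add: abs_mult)
        then have "arcsin (sin (a * y j)) = a * y j" by (intro arcsin_sin) auto
        then show ?thesis using j a by (simp add: \<sigma>_def)
      qed (use y in \<open>simp add: \<sigma>_def\<close>)
      then have "H (\<sigma> y) = h y" by (simp add: H_def)
      with g(2)[OF \<sigma>, of y] have "\<bar>h y - g (\<sigma> y)\<bar> \<le> e * 1" by simp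
      also have "\<dots> \<le> e * (1 + (\<Sum>j<k. (y j)\<^sup>2))"
        using e by (intro mult_left_mono) (auto intro: sum_nonneg)
      finally show ?thesis .
    next
      case False
      then obtain j where j: "j < k" "\<bar>y j\<bar> > K" by auto
      then have "K\<^sup>2 \<le> (y j)\<^sup>2" using K by (intro abs_le_square_iff[THEN iffD1]) auto
      also have "\<dots> \<le> (\<Sum>j<k. (y j)\<^sup>2)" using j by (intro member_le_sum) auto
      finally have "e * K\<^sup>2 \<le> e * (\<Sum>j<k. (y j)\<^sup>2)" using e by (intro mult_left_mono) auto
      moreover have "\<bar>h y - g (\<sigma> y)\<bar> \<le> 2 * B + e"
        using B[of y] g(2)[OF \<sigma>, of y] B[of "\<lambda>j. arcsin (\<sigma> y j) / a"] unfolding H_def by linarith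
      ultimately have "\<bar>h y - g (\<sigma> y)\<bar> \<le> e * (\<Sum>j<k. (y j)\<^sup>2)" using K by linarith
      also have "\<dots> \<le> e * (1 + (\<Sum>j<k. (y j)\<^sup>2))" using e by (intro mult_left_mono) auto
      finally show ?thesis .
    qed
  qed
qed

lemma trig_integral:
  assumes "prob_space M" and Y: "\<And>j. j < k \<Longrightarrow> Y j \<in> borel_measurable M" and p: "p \<in> trig k"
  shows "integrable M (\<lambda>\<omega>. p (\<lambda>j. Y j \<omega>))"
  using p
proof induction
  case (monom c t)
  interpret prob_space M by fact
  have [measurable]: "(\<lambda>\<omega>. \<Sum>j<k. t j * Y j \<omega>) \<in> borel_measurable M"
    using Y by (intro borel_measurable_sum) auto
  have [measurable]: "(\<lambda>\<omega>. cis (\<Sum>j<k. t j * Y j \<omega>)) \<in> borel_measurable M"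
    unfolding cis_conv_exp by measurable
  show ?case
    by (rule integrable_const_bound[of _ "norm c"]) (auto simp: norm_mult)
qed auto

lemma trig_integral_tendsto:
  assumes M: "prob_space M" and N: "prob_space N"
    and Y: "\<And>n j. j < k \<Longrightarrow> Y n j \<in> borel_measurable M"
    and Z: "\<And>j. j < k \<Longrightarrow> Z j \<in> borel_measurable N"
    and lim: "\<And>t :: nat \<Rightarrow> real. (\<lambda>n. \<integral>\<omega>. cis (\<Sum>j<k. t j * Y n j \<omega>) \<partial>M) \<longlonglongrightarrow>
        (\<integral>v. cis (\<Sum>j<k. t j * Z j v) \<partial>N)"
    and p: "p \<in> trig k"
  shows "(\<lambda>n. \<integral>\<omega>. p (\<lambda>j. Y n j \<omega>) \<partial>M) \<longlonglongrightarrow> (\<integral>v. p (\<lambda>j. Z j v) \<partial>N)"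
  using p
proof induction
  case (monom c t)
  then show ?case using tendsto_mult_left[OF lim[of t], of c] by simp
next
  case (add p q)
  then show ?case
    using tendsto_add[OF add.IH]
      trig_integral[where Y = "Y _", OF M Y] trig_integral[where Y = Z, OF N Z]
    by simp
qed

text \<open>The weight has expectation at most \<open>1 + k * V\<close>, so exchanging
  \<open>h\<close> for a trigonometric polynomial costs the same small amount under every law with
  second moments below \<open>V\<close>; this does the work of tightness. The \<open>if\<close>
  zeroes the coordinates from \<open>k\<close> on, as the approximation demands.\<close>

lemma quadratic_weight_integral:
  fixes h f :: "(nat \<Rightarrow> real) \<Rightarrow> real"
  assumes Q: "prob_space Q" and U: "\<And>j. j < k \<Longrightarrow> U j \<in> borel_measurable Q"
    and U2: "\<And>j. j < k \<Longrightarrow> integrable Q (\<lambda>\<omega>. (U j \<omega>)\<^sup>2) \<and> (\<integral>\<omega>. (U j \<omega>)\<^sup>2 \<partial>Q) \<le> V"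
    and hU: "(\<lambda>\<omega>. h (\<lambda>j. if j < k then U j \<omega> else 0)) \<in> borel_measurable Q"
    and B: "\<And>y. \<bar>h y\<bar> \<le> B" and e: "e \<ge> 0"
    and f: "(\<lambda>y. complex_of_real (f y)) \<in> trig k"
      "\<And>y. (\<forall>j\<ge>k. y j = 0) \<Longrightarrow> \<bar>h y - f y\<bar> \<le> e * (1 + (\<Sum>j<k. (y j)\<^sup>2))"
  shows "\<bar>(\<integral>\<omega>. h (\<lambda>j. if j < k then U j \<omega> else 0) \<partial>Q) - (\<integral>\<omega>. f (\<lambda>j. if j < k then U j \<omega> else 0) \<partial>Q)\<bar>
    \<le> e * (1 + real k * V)"
proof -
  interpret prob_space Q by (rule Q)
  let ?h = "\<lambda>\<omega>. h (\<lambda>j. if j < k then U j \<omega> else 0)"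
  let ?f = "\<lambda>\<omega>. f (\<lambda>j. if j < k then U j \<omega> else 0)"
  have "integrable Q (\<lambda>\<omega>. complex_of_real (?f \<omega>))"
    using trig_integral[OF Q _ f(1), of "\<lambda>j \<omega>. if j < k then U j \<omega> else 0"] U by simp
  from integrable_Re[OF this] have fi: "integrable Q ?f" by simp
  have hi: "integrable Q ?h"
    by (rule integrable_const_bound[of _ B]) (use B hU in auto)
  have bi: "integrable Q (\<lambda>\<omega>. e * (1 + (\<Sum>j<k. (U j \<omega>)\<^sup>2)))"
    using U2 by (intro integrable_mult_right Bochner_Integration.integrable_add integrable_const
        Bochner_Integration.integrable_sum) auto
  have "\<bar>(\<integral>\<omega>. ?h \<omega> \<partial>Q) - (\<integral>\<omega>. ?f \<omega> \<partial>Q)\<bar> = \<bar>\<integral>\<omega>. ?h \<omega> - ?f \<omega> \<partial>Q\<bar>"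
    using fi hi by simp
  also have "\<dots> \<le> (\<integral>\<omega>. \<bar>?h \<omega> - ?f \<omega>\<bar> \<partial>Q)" by (rule integral_abs_bound)
  also have "\<dots> \<le> (\<integral>\<omega>. e * (1 + (\<Sum>j<k. (U j \<omega>)\<^sup>2)) \<partial>Q)"
  proof (intro integral_mono bi integrable_abs Bochner_Integration.integrable_diff hi fi)
    fix \<omega> show "\<bar>?h \<omega> - ?f \<omega>\<bar> \<le> e * (1 + (\<Sum>j<k. (U j \<omega>)\<^sup>2))"
      using f(2)[of "\<lambda>j. if j < k then U j \<omega> else 0"] by simp
  qed
  also have "\<dots> = e * (1 + (\<Sum>j<k. \<integral>\<omega>. (U j \<omega>)\<^sup>2 \<partial>Q))"
  proof -
    have "integrable Q (\<lambda>\<omega>. \<Sum>j<k. (U j \<omega>)\<^sup>2)"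
      using U2 by (intro Bochner_Integration.integrable_sum) auto
    moreover have "(\<integral>\<omega>. (\<Sum>j<k. (U j \<omega>)\<^sup>2) \<partial>Q) = (\<Sum>j<k. \<integral>\<omega>. (U j \<omega>)\<^sup>2 \<partial>Q)"
      using U2 by (intro Bochner_Integration.integral_sum) auto
    ultimately show ?thesis by (simp add: prob_space)
  qed
  also have "\<dots> \<le> e * (1 + real k * V)"
    using e U2 sum_mono[of "{..<k}" "\<lambda>j. \<integral>\<omega>. (U j \<omega>)\<^sup>2 \<partial>Q" "\<lambda>_. V"]
    by (intro mult_left_mono) auto
  finally show ?thesis .
qed

text \<open>A form of the Cramer-Wold principle: \<open>lim\<close> is convergence of the joint
  characteristic functions, which extends by linearity to trigonometric polynomials. The common
  bound \<open>V\<close> makes the approximation error uniform in \<open>n\<close>.\<close>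

lemma multivariate_convergence:
  fixes h :: "(nat \<Rightarrow> real) \<Rightarrow> real"
  assumes M: "prob_space M" and N: "prob_space N"
    and Y: "\<And>n j. j < k \<Longrightarrow> Y n j \<in> borel_measurable M"
    and Z: "\<And>j. j < k \<Longrightarrow> Z j \<in> borel_measurable N"
    and lim: "\<And>t :: nat \<Rightarrow> real. (\<lambda>n. \<integral>\<omega>. cis (\<Sum>j<k. t j * Y n j \<omega>) \<partial>M) \<longlonglongrightarrow>
        (\<integral>v. cis (\<Sum>j<k. t j * Z j v) \<partial>N)"
    and Y2: "\<And>n j. j < k \<Longrightarrow> integrable M (\<lambda>\<omega>. (Y n j \<omega>)\<^sup>2) \<and> (\<integral>\<omega>. (Y n j \<omega>)\<^sup>2 \<partial>M) \<le> V"
    and Z2: "\<And>j. j < k \<Longrightarrow> integrable N (\<lambda>v. (Z j v)\<^sup>2) \<and> (\<integral>v. (Z j v)\<^sup>2 \<partial>N) \<le> V"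
    and h: "continuous_on UNIV h" and B: "\<And>y. \<bar>h y\<bar> \<le> B"
    and hY: "\<And>n. (\<lambda>\<omega>. h (\<lambda>j. if j < k then Y n j \<omega> else 0)) \<in> borel_measurable M"
    and hZ: "(\<lambda>v. h (\<lambda>j. if j < k then Z j v else 0)) \<in> borel_measurable N"
  shows "(\<lambda>n. \<integral>\<omega>. h (\<lambda>j. if j < k then Y n j \<omega> else 0) \<partial>M) \<longlonglongrightarrow>
     (\<integral>v. h (\<lambda>j. if j < k then Z j v else 0) \<partial>N)"
proof (rule LIMSEQ_I)
  fix r :: real assume r: "r > 0"
  define W where "W = 1 + real k * V"
  \<comment> \<open>For \<open>k = 0\<close> the hypotheses say nothing about \<open>V\<close>, and
    \<open>W\<close> is 1.\<close>
  have V0: "V \<ge> 0" if "k > 0" 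
  proof -
    have "0 \<le> (\<integral>v. (Z 0 v)\<^sup>2 \<partial>N)" by (intro Bochner_Integration.integral_nonneg) simp
    then show ?thesis using Z2[OF that] by linarith
  qed
  have W: "W > 0" using V0 unfolding W_def by (cases "k > 0") (auto intro: add_pos_nonneg)
  \<comment> \<open>Two approximation errors and one limit error, each at most \<open>r / 4\<close>,
    stay below \<open>r\<close>.\<close>
  define e where "e = r / (4 * W)"
  have e: "e > 0" "e * W = r / 4" using r W by (auto simp: e_def)
  obtain f where f: "(\<lambda>y. complex_of_real (f y)) \<in> trig k"
    "\<And>y. (\<forall>j\<ge>k. y j = 0) \<Longrightarrow> \<bar>h y - f y\<bar> \<le> e * (1 + (\<Sum>j<k. (y j)\<^sup>2))"
    using trig_approx[OF h B e(1), of k] by blast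
  let ?f = "\<lambda>U \<omega>. f (\<lambda>j. if j < k then U j \<omega> else 0)"
  have restr: "(\<lambda>n. \<integral>\<omega>. complex_of_real (?f (Y n) \<omega>) \<partial>M) \<longlonglongrightarrow>
      (\<integral>v. complex_of_real (?f Z v) \<partial>N)"
    by (rule trig_integral_tendsto[OF M N _ _ _ f(1),
          of "\<lambda>n j \<omega>. if j < k then Y n j \<omega> else 0" "\<lambda>j v. if j < k then Z j v else 0"])
       (use Y Z lim in auto)
  then have "(\<lambda>n. \<integral>\<omega>. ?f (Y n) \<omega> \<partial>M) \<longlonglongrightarrow> (\<integral>v. ?f Z v \<partial>N)"
    by (simp only: integral_complex_of_real tendsto_of_real_iff)
  from LIMSEQ_D[OF this, of "r / 4"] r obtain n0 where
    n0: "\<And>n. n \<ge> n0 \<Longrightarrow> \<bar>(\<integral>\<omega>. ?f (Y n) \<omega> \<partial>M) - (\<integral>v. ?f Z v \<partial>N)\<bar> < r / 4" by auto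
  show "\<exists>n0. \<forall>n\<ge>n0. norm ((\<integral>\<omega>. h (\<lambda>j. if j < k then Y n j \<omega> else 0) \<partial>M) -
     (\<integral>v. h (\<lambda>j. if j < k then Z j v else 0) \<partial>N)) < r"
  proof (intro exI allI impI)
    fix n assume "n \<ge> n0"
    have gm: "\<bar>(\<integral>\<omega>. h (\<lambda>j. if j < k then Y n j \<omega> else 0) \<partial>M) - (\<integral>\<omega>. ?f (Y n) \<omega> \<partial>M)\<bar> \<le> r / 4"
      using quadratic_weight_integral[where U = "Y n", OF M Y Y2 hY B less_imp_le[OF e(1)] f]
      by (simp only: W_def[symmetric] e(2))
    have gn: "\<bar>(\<integral>\<omega>. h (\<lambda>j. if j < k then Z j \<omega> else 0) \<partial>N) - (\<integral>\<omega>. ?f Z \<omega> \<partial>N)\<bar> \<le> r / 4"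
      using quadratic_weight_integral[where U = "Z", OF N Z Z2 hZ B less_imp_le[OF e(1)] f]
      by (simp only: W_def[symmetric] e(2))
    show "norm ((\<integral>\<omega>. h (\<lambda>j. if j < k then Y n j \<omega> else 0) \<partial>M) -
       (\<integral>v. h (\<lambda>j. if j < k then Z j v else 0) \<partial>N)) < r"
      using gm gn n0[OF \<open>n \<ge> n0\<close>] r unfolding real_norm_def by linarith
  qed
qed

section \<open>Chaining\<close>

text \<open>
  Events such as a bound on an uncountable supremum need not be measurable, so ``probability at
  least \<open>1 - \<tau>\<close>'' is expressed through a measurable exceptional set.
\<close>

definition likely :: "'w measure \<Rightarrow> real \<Rightarrow> ('w \<Rightarrow> bool) \<Rightarrow> bool" where
  "likely M \<tau> Q \<longleftrightarrow> (\<exists>B\<in>sets M. measure M B \<le> \<tau> \<and> (\<forall>\<omega>\<in>space M - B. Q \<omega>))"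

lemma likely_mono:
  assumes "likely M \<tau> Q" "\<tau> \<le> \<tau>'" "\<And>\<omega>. \<omega> \<in> space M \<Longrightarrow> Q \<omega> \<Longrightarrow> Q' \<omega>"
  shows "likely M \<tau>' Q'"
  using assms unfolding likely_def by (meson DiffD1 order_trans)

lemma likely_conj:
  assumes "likely M \<tau> Q" "likely M \<tau>' Q'"
  shows "likely M (\<tau> + \<tau>') (\<lambda>\<omega>. Q \<omega> \<and> Q' \<omega>)"
proof -
  obtain B B' where B: "B \<in> sets M" "measure M B \<le> \<tau>" "\<forall>\<omega>\<in>space M - B. Q \<omega>"
    "B' \<in> sets M" "measure M B' \<le> \<tau>'" "\<forall>\<omega>\<in>space M - B'. Q' \<omega>"
    using assms unfolding likely_def by blast
  show ?thesis unfolding likely_def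
    using B measure_Un_le[OF B(1,4)] by (intro bexI[of _ "B \<union> B'"]) auto
qed

lemma likely_AE:
  assumes "AE \<omega> in M. Q \<omega>" "\<tau> \<ge> 0"
  shows "likely M \<tau> Q"
proof -
  from assms(1) obtain B where "{\<omega>\<in>space M. \<not> Q \<omega>} \<subseteq> B" "emeasure M B = 0" "B \<in> sets M"
    by (rule AE_E)
  then show ?thesis
    unfolding likely_def using assms(2) by (intro bexI[of _ B]) (auto simp: measure_def)
qed

text \<open>Space is cut into cubes of side \<open>1 / 2 ^ k\<close>, and one point of
  \<open>\<Theta>\<close> is picked from every cube meeting \<open>\<Theta>\<close>; grid points
  would not do, because the process is controlled on \<open>\<Theta>\<close> only. Boundedness
  leaves a constant times \<open>2 ^ k\<close> cubes per direction, and the distance bound adds up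
  the coordinate errors.\<close>

lemma dyadic_nets:
  fixes \<Theta> :: "(real ^ 'm) set"
  assumes "bounded \<Theta>"
  shows "\<exists>C T. C \<ge> 0 \<and> (\<forall>k. finite (T k) \<and> T k \<subseteq> \<Theta> \<and> real (card (T k)) \<le> C * (2 ^ CARD('m)) ^ k \<and>
    (\<forall>\<theta>\<in>\<Theta>. \<exists>t\<in>T k. dist \<theta> t \<le> real CARD('m) / 2 ^ k))"
proof -
  obtain b where b: "\<And>x. x \<in> \<Theta> \<Longrightarrow> norm x \<le> b" using assms by (auto simp: bounded_iff)
  define n where "n = nat \<lceil>\<bar>b\<bar>\<rceil> + 1"
  have n: "\<bar>x $ i\<bar> \<le> real n" if "x \<in> \<Theta>" for x i
    using component_le_norm_cart[of x i] b[OF that] unfolding n_def by linarith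
  define cell :: "nat \<Rightarrow> real ^ 'm \<Rightarrow> 'm \<Rightarrow> int" where "cell k x i = \<lfloor>x $ i * 2 ^ k\<rfloor>" for k x i
  define T where "T k = inv_into \<Theta> (cell k) ` cell k ` \<Theta>" for k
  have sub: "cell k ` \<Theta> \<subseteq> (UNIV \<rightarrow>\<^sub>E {- int (n * 2 ^ k) .. int (n * 2 ^ k)})" for k
  proof
    fix c assume "c \<in> cell k ` \<Theta>"
    then obtain x where x: "x \<in> \<Theta>" "c = cell k x" by auto
    have "c i \<in> {- int (n * 2 ^ k) .. int (n * 2 ^ k)}" for i
    proof -
      have "\<bar>x $ i * 2 ^ k\<bar> \<le> real n * 2 ^ k" using n[OF x(1), of i] by (simp add: abs_mult)
      then have le: "x $ i * 2 ^ k \<le> of_int (int (n * 2 ^ k))" "of_int (- int (n * 2 ^ k)) \<le> x $ i * 2 ^ k"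
        by (auto simp: abs_le_iff)
      have "c i \<le> int (n * 2 ^ k)" using floor_mono[OF le(1)] unfolding x(2) cell_def floor_of_int .
      moreover have "- int (n * 2 ^ k) \<le> c i" using le(2) x(2) by (simp add: cell_def le_floor_iff)
      ultimately show ?thesis by simp
    qed
    then show "c \<in> (UNIV \<rightarrow>\<^sub>E {- int (n * 2 ^ k) .. int (n * 2 ^ k)})" by auto
  qed
  have fin: "finite (UNIV \<rightarrow>\<^sub>E {- int (n * 2 ^ k) .. int (n * 2 ^ k)} :: ('m \<Rightarrow> int) set)" for k
    by (intro finite_PiE) auto
  have "real (card (T k)) \<le> (3 * real n) ^ CARD('m) * (2 ^ CARD('m)) ^ k" for k
  proof -
    have "card (T k) \<le> card (cell k ` \<Theta>)"
      unfolding T_def by (rule card_image_le) (rule finite_subset[OF sub fin])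
    also have "\<dots> \<le> card (UNIV \<rightarrow>\<^sub>E {- int (n * 2 ^ k) .. int (n * 2 ^ k)} :: ('m \<Rightarrow> int) set)"
      by (rule card_mono[OF fin sub])
    also have "\<dots> = (2 * n * 2 ^ k + 1) ^ CARD('m)" by (simp add: card_PiE nat_add_distrib nat_mult_distrib nat_power_eq mult.assoc)
    also have "\<dots> \<le> (3 * n * 2 ^ k) ^ CARD('m)" 
    proof (intro power_mono)
      have "1 * 1 \<le> n * 2 ^ k" by (intro mult_le_mono) (auto simp: n_def)
      then show "2 * n * 2 ^ k + 1 \<le> 3 * n * 2 ^ k" by simp
    qed simp
    finally have "real (card (T k)) \<le> real ((3 * n * 2 ^ k) ^ CARD('m))" by (simp only: of_nat_le_iff)
    also have "\<dots> = (3 * real n) ^ CARD('m) * (2 ^ CARD('m)) ^ k"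
      by (simp add: power_mult_distrib power_mult[symmetric] mult.commute)
    finally show ?thesis .
  qed
  moreover have "T k \<subseteq> \<Theta>" "finite (T k)" for k
    using finite_subset[OF sub fin] by (auto simp: T_def inv_into_into)
  moreover have "\<exists>t\<in>T k. dist \<theta> t \<le> real CARD('m) / 2 ^ k" if "\<theta> \<in> \<Theta>" for k \<theta>
  proof
    let ?t = "inv_into \<Theta> (cell k) (cell k \<theta>)"
    show "?t \<in> T k" using that by (auto simp: T_def)
    have "cell k ?t = cell k \<theta>" using that by (simp add: f_inv_into_f)
    then have fl: "\<lfloor>?t $ i * 2 ^ k\<rfloor> = \<lfloor>\<theta> $ i * 2 ^ k\<rfloor>" for i unfolding cell_def by metis
    have "\<bar>(\<theta> - ?t) $ i\<bar> \<le> 1 / 2 ^ k" for i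
    proof -
      have "\<bar>\<theta> $ i * 2 ^ k - ?t $ i * 2 ^ k\<bar> \<le> 1" using fl[of i] by linarith
      also have "\<theta> $ i * 2 ^ k - ?t $ i * 2 ^ k = (\<theta> - ?t) $ i * 2 ^ k" by (simp add: left_diff_distrib)
      finally show ?thesis by (simp add: abs_mult pos_le_divide_eq del: vector_minus_component)
    qed
    then have "(\<Sum>i\<in>UNIV. \<bar>(\<theta> - ?t) $ i\<bar>) \<le> (\<Sum>i\<in>(UNIV :: 'm set). 1 / 2 ^ k)" by (intro sum_mono)
    with norm_le_l1_cart[of "\<theta> - ?t"] show "dist \<theta> ?t \<le> real CARD('m) / 2 ^ k"
      by (simp add: dist_norm)
  qed
  ultimately show ?thesis
    by (intro exI[of _ "(3 * real n) ^ CARD('m)"] exI[of _ T]) auto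
qed

text \<open>The scale is any positive \<open>d\<close> above the distance rather than the distance
  itself: \<open>s = t\<close> then causes no division by 0, and one \<open>d\<close> serves all
  pairs on a level of the chain. Path continuity is included because chaining passes from net points
  to limits.\<close>

definition exponential_increments :: "'w measure \<Rightarrow> 'b :: metric_space set \<Rightarrow> real \<Rightarrow> ('b \<Rightarrow> 'w \<Rightarrow> real) \<Rightarrow> bool" where
  "exponential_increments M \<Theta> C Z \<longleftrightarrow> (\<forall>\<theta>\<in>\<Theta>. Z \<theta> \<in> borel_measurable M) \<and>
    (\<forall>\<omega>\<in>space M. continuous_on \<Theta> (\<lambda>\<theta>. Z \<theta> \<omega>)) \<and>
    (\<forall>s\<in>\<Theta>. \<forall>t\<in>\<Theta>. \<forall>a>0. \<forall>d>0. dist s t \<le> d \<longrightarrow>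
       measure M {\<omega>\<in>space M. a \<le> \<bar>Z s \<omega> - Z t \<omega>\<bar>} \<le> C * exp (- a / d))"

text \<open>\<open>\<eta>\<close> is chosen before the measure and the process, so a sequence of
  processes with a common \<open>C\<close> gets a common modulus. Each point is reached from level
  \<open>m\<close> by links between consecutive nets, and a union bound controls all links from
  level \<open>m\<close> on at once.\<close>

lemma chaining:
  fixes \<Theta> :: "(real ^ 'm) set"
  assumes "bounded \<Theta>" and eps: "\<epsilon> > 0" and tau: "\<tau> > 0"
  shows "\<exists>\<eta>>0. \<forall>(M :: 'w measure) Z. prob_space M \<longrightarrow> exponential_increments M \<Theta> C Z \<longrightarrow>
    likely M \<tau> (\<lambda>\<omega>. \<forall>s\<in>\<Theta>. \<forall>t\<in>\<Theta>. dist s t \<le> \<eta> \<longrightarrow> \<bar>Z s \<omega> - Z t \<omega>\<bar> \<le> (\<epsilon>::real))"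
proof -
  define L :: real where "L = 2 ^ CARD('m)"
  define D where "D = real CARD('m)"
  have D: "D > 0" by (simp add: D_def)
  have L: "L \<ge> 1" by (simp add: L_def)
  obtain c T where c: "c \<ge> 0" and T: "\<And>k. finite (T k)" "\<And>k. T k \<subseteq> \<Theta>"
    "\<And>k. real (card (T k)) \<le> c * L ^ k" "\<And>k \<theta>. \<theta> \<in> \<Theta> \<Longrightarrow> \<exists>t\<in>T k. dist \<theta> t \<le> D / 2 ^ k"
    using dyadic_nets[OF assms(1)] unfolding L_def D_def by metis
  \<comment> \<open>Level \<open>k\<close> has at most a constant times
    \<open>(L\<^sup>2) ^ k\<close> pairs. A tail of \<open>exp (- q)\<close> to the power
    \<open>Suc k\<close> beats this number and leaves a factor \<open>(1 / 2) ^ k\<close> for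
    summation.\<close>
  define q where "q = ln (2 * L\<^sup>2)"
  have "2 * 1 \<le> 2 * L\<^sup>2" using L by (intro mult_left_mono) auto
  then have "1 < 2 * L\<^sup>2" by linarith
  then have q: "q > 0" "exp q = 2 * L\<^sup>2" unfolding q_def by (auto intro: ln_gt_zero simp: L_def)
  \<comment> \<open>The 3 covers a link, of length \<open>D / 2 ^ Suc k + D / 2 ^ k\<close>, as well
    as the net points next to two points at distance \<open>D / 2 ^ m\<close>.\<close>
  define d where "d k = 3 * D / 2 ^ k" for k :: nat
  \<comment> \<open>At scale \<open>d k\<close> this threshold has tail
    \<open>exp (- (q * Suc k))\<close>; \<open>Suc k\<close> in place of \<open>k\<close> keeps it
    positive on level 0.\<close>
  define a where "a k = d k * (q * real (Suc k))" for k :: nat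
  have d: "d k > 0" and a: "a k > 0" for k using D q by (auto simp: d_def a_def)
  have "summable (\<lambda>k. real (Suc k) * (1 / 2) ^ k)"
    using geometric_deriv_sums[of "1 / 2 :: real"] by (auto simp: sums_iff)
  from summable_mult[OF this, of "3 * D * q"] have sa: "summable a"
    by (rule summable_cong[THEN iffD1, rotated]) (auto simp: a_def d_def power_divide)
  define C1 where "C1 = \<bar>C\<bar> * c\<^sup>2 * (1 + L)"
  have C1: "C1 \<ge> 0" using L by (simp add: C1_def)
  obtain N1 where N1: "\<And>n. n \<ge> N1 \<Longrightarrow> norm (\<Sum>i. a (i + n)) < \<epsilon> / 3"
    using suminf_exist_split[OF _ sa, of "\<epsilon> / 3"] eps by auto
  have "(\<lambda>k. 2 * C1 * (1 / 2) ^ k) \<longlonglongrightarrow> 2 * C1 * 0"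
    by (intro tendsto_intros LIMSEQ_power_zero) auto
  then have "eventually (\<lambda>k. 2 * C1 * (1 / 2) ^ k < \<tau>) sequentially"
    using tau by (intro order_tendstoD) auto
  then obtain N2 where N2: "\<And>k. k \<ge> N2 \<Longrightarrow> 2 * C1 * (1 / 2) ^ k < \<tau>"
    by (auto simp: eventually_sequentially)
  define m where "m = max N1 N2"
  define r where "r = (\<Sum>i. a (i + m))"
  have sm: "summable (\<lambda>i. a (i + m))" using sa by (simp add: summable_iff_shift)
  have r: "3 * r \<le> \<epsilon>" using N1[of m] unfolding r_def m_def by simp
  \<comment> \<open>Pairs with \<open>s\<close> in the finer net are links of a chain; pairs within
    \<open>T k\<close> compare the starting points of two chains.\<close>
  define P where "P k = {(s, t). s \<in> T k \<union> T (Suc k) \<and> t \<in> T k \<and> dist s t \<le> d k}" for k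
  have finP: "finite (P k)" for k
    by (rule finite_subset[of _ "(T k \<union> T (Suc k)) \<times> T k"]) (use T in \<open>auto simp: P_def\<close>)
  have cardP: "real (card (P k)) \<le> c\<^sup>2 * (1 + L) * (L\<^sup>2) ^ k" for k
  proof -
    have "card (P k) \<le> card ((T k \<union> T (Suc k)) \<times> T k)"
      by (intro card_mono) (use T in \<open>auto simp: P_def\<close>)
    also have "\<dots> \<le> (card (T k) + card (T (Suc k))) * card (T k)"
      by (simp add: card_cartesian_product card_Un_le)
    finally have "real (card (P k)) \<le> (real (card (T k)) + real (card (T (Suc k)))) * real (card (T k))"
      by (metis of_nat_add of_nat_le_iff of_nat_mult)
    also have "\<dots> \<le> (c * L ^ k + c * L ^ Suc k) * (c * L ^ k)"
      using T(3)[of k] T(3)[of "Suc k"] by (intro mult_mono add_mono) (use c L in auto)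
    also have "\<dots> = c\<^sup>2 * (1 + L) * (L\<^sup>2) ^ k"
      by (simp add: power2_eq_square algebra_simps power_mult_distrib)
    finally show ?thesis .
  qed
  show ?thesis
  proof (intro exI[of _ "D / 2 ^ m"] conjI allI impI)
    show "D / 2 ^ m > 0" using D by simp
    fix M :: "'w measure" and Z :: "real ^ 'm \<Rightarrow> 'w \<Rightarrow> real"
    assume M: "prob_space M" and "exponential_increments M \<Theta> C Z"
    then have Z: "\<forall>\<theta>\<in>\<Theta>. Z \<theta> \<in> borel_measurable M"
      and cont: "\<forall>\<omega>\<in>space M. continuous_on \<Theta> (\<lambda>\<theta>. Z \<theta> \<omega>)"
      and tail: "\<forall>s\<in>\<Theta>. \<forall>t\<in>\<Theta>. \<forall>a>0. \<forall>d>0. dist s t \<le> d \<longrightarrow>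
       measure M {\<omega>\<in>space M. a \<le> \<bar>Z s \<omega> - Z t \<omega>\<bar>} \<le> C * exp (- a / d)"
      unfolding exponential_increments_def by blast+
    interpret prob_space M by fact
    define E where "E k s t = {\<omega>\<in>space M. a k \<le> \<bar>Z s \<omega> - Z t \<omega>\<bar>}" for k s t
    have PT: "s \<in> \<Theta> \<and> t \<in> \<Theta> \<and> dist s t \<le> d k" if "(s, t) \<in> P k" for s t k
      using that T(2) by (auto simp: P_def)
    have Em: "E k s t \<in> sets M" if "s \<in> \<Theta>" "t \<in> \<Theta>" for k s t
    proof -
      have [measurable]: "Z s \<in> borel_measurable M" "Z t \<in> borel_measurable M" using Z that by auto
      show ?thesis unfolding E_def by measurable
    qed
    define bad where "bad k = (\<Union>(s, t)\<in>P k. E k s t)" for k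
    have badm: "bad k \<in> sets M" for k
      unfolding bad_def using finP PT Em by (intro sets.finite_UN) auto
    have badP: "measure M (bad k) \<le> C1 * (1 / 2) ^ k" for k
    proof -
      have "measure M (bad k) \<le> (\<Sum>p\<in>P k. measure M (case p of (s, t) \<Rightarrow> E k s t))"
        unfolding bad_def using finP PT Em by (intro measure_UNION_le) auto
      also have "\<dots> \<le> (\<Sum>p\<in>P k. \<bar>C\<bar> * exp (- (q * real (Suc k))))"
      proof (intro sum_mono, clarify)
        fix s t assume "(s, t) \<in> P k"
        from PT[OF this] have "measure M (E k s t) \<le> C * exp (- a k / d k)"
          unfolding E_def using tail a[of k] d[of k] by blast
        also have "\<dots> \<le> \<bar>C\<bar> * exp (- a k / d k)" by (intro mult_right_mono) auto
        also have "- a k / d k = - (q * real (Suc k))" using d[of k] by (simp add: a_def)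
        finally show "measure M (E k s t) \<le> \<bar>C\<bar> * exp (- (q * real (Suc k)))" .
      qed
      also have "\<dots> = real (card (P k)) * (\<bar>C\<bar> * exp (- (q * real (Suc k))))" by simp
      also have "exp (- (q * real (Suc k))) = 1 / (2 * L\<^sup>2) ^ Suc k"
        using q(2) by (simp add: exp_minus exp_of_nat2_mult inverse_eq_divide del: of_nat_Suc power_Suc)
      also have "real (card (P k)) * (\<bar>C\<bar> * (1 / (2 * L\<^sup>2) ^ Suc k)) \<le>
          (c\<^sup>2 * (1 + L) * (L\<^sup>2) ^ k) * (\<bar>C\<bar> * (1 / (2 * L\<^sup>2) ^ k))"
      proof (intro mult_mono cardP mult_left_mono)
        show "1 / (2 * L\<^sup>2) ^ Suc k \<le> 1 / (2 * L\<^sup>2) ^ k"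
          using L less_imp_le[OF \<open>1 < 2 * L\<^sup>2\<close>]
          by (intro divide_left_mono power_increasing mult_pos_pos zero_less_power) auto
      qed (use L in auto)
      also have "\<dots> = C1 * (1 / 2) ^ k"
        using L by (simp add: C1_def power_mult_distrib field_simps)
      finally show ?thesis .
    qed
    define B where "B = (\<Union>i. bad (i + m))"
    have Bm: "B \<in> sets M" unfolding B_def using badm by auto
    have gs: "(\<lambda>i. C1 * (1 / 2) ^ (i + m)) sums (2 * C1 * (1 / 2) ^ m)"
      using sums_mult[OF geometric_sums[of "1/2::real"], of "C1 * (1/2) ^ m"]
      by (simp add: power_add ac_simps)
    have "measure M B \<le> (\<Sum>i. measure M (bad (i + m)))"
      unfolding B_def
      by (intro finite_measure_subadditive_countably)
         (use badm badP in \<open>auto intro!: summable_comparison_test'[OF sums_summable[OF gs]]\<close>)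
    also have "\<dots> \<le> (\<Sum>i. C1 * (1 / 2) ^ (i + m))"
      by (intro suminf_le badP sums_summable[OF gs] summable_comparison_test'[OF sums_summable[OF gs]])
         (use badP in auto)
    also have "\<dots> = 2 * C1 * (1 / 2) ^ m" using gs by (simp add: sums_iff)
    also have "\<dots> \<le> \<tau>" using N2[of m] by (simp add: m_def)
    finally have PB: "measure M B \<le> \<tau>" .
    have good: "\<bar>Z s \<omega> - Z t \<omega>\<bar> \<le> a k" if "\<omega> \<in> space M - B" "(s, t) \<in> P k" "k \<ge> m" for \<omega> s t k
    proof (rule ccontr)
      assume "\<not> ?thesis"
      then have "\<omega> \<in> E k s t" using that by (auto simp: E_def)
      then have "\<omega> \<in> bad ((k - m) + m)" using that by (auto simp: bad_def)
      then show False using that unfolding B_def by blast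
    qed
    \<comment> \<open>Telescoping along the links gives the tail sum \<open>r\<close> as a bound at
      net points, and path continuity carries it to their limit \<open>\<theta>\<close>.\<close>
    have approx: "\<exists>t\<in>T m. dist \<theta> t \<le> D / 2 ^ m \<and> \<bar>Z \<theta> \<omega> - Z t \<omega>\<bar> \<le> r"
      if \<omega>: "\<omega> \<in> space M - B" and \<theta>: "\<theta> \<in> \<Theta>" for \<theta> \<omega>
    proof -
      obtain t where t: "\<And>k. t k \<in> T k" "\<And>k. dist \<theta> (t k) \<le> D / 2 ^ k" using T(4)[OF \<theta>] by metis
      have step: "(t (Suc k), t k) \<in> P k" for k
      proof -
        have "dist (t (Suc k)) (t k) \<le> dist \<theta> (t (Suc k)) + dist \<theta> (t k)"
          by (metis dist_commute dist_triangle)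
        also have "\<dots> \<le> D / 2 ^ Suc k + D / 2 ^ k" by (intro add_mono t)
        also have "\<dots> \<le> d k" using D by (simp add: d_def field_simps)
        finally show ?thesis using t by (auto simp: P_def)
      qed
      have part: "\<bar>Z (t (j + m)) \<omega> - Z (t m) \<omega>\<bar> \<le> (\<Sum>i<j. a (i + m))" for j
      proof (induction j)
        case (Suc j)
        have "\<bar>Z (t (Suc (j + m))) \<omega> - Z (t (j + m)) \<omega>\<bar> \<le> a (j + m)"
          by (rule good[OF \<omega> step]) simp
        with Suc show ?case by simp
      qed simp
      have "(\<Sum>i<j. a (i + m)) \<le> r" for j
        unfolding r_def by (intro sum_le_suminf sm) (use a in \<open>auto intro: less_imp_le\<close>)
      with part have part: "\<bar>Z (t (j + m)) \<omega> - Z (t m) \<omega>\<bar> \<le> r" for j using order_trans by blast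
      have "(\<lambda>j. dist \<theta> (t (j + m))) \<longlonglongrightarrow> 0"
      proof (rule tendsto_sandwich[where f = "\<lambda>_. 0"])
        show "(\<lambda>j. D / 2 ^ m * (1 / 2) ^ j) \<longlonglongrightarrow> 0"
          by (intro tendsto_mult_right_zero LIMSEQ_power_zero) simp
        show "\<forall>\<^sub>F j in sequentially. dist \<theta> (t (j + m)) \<le> D / 2 ^ m * (1 / 2) ^ j"
        proof (intro always_eventually allI)
          fix j
          have "D / 2 ^ m * (1 / 2) ^ j = D / 2 ^ (j + m)"
            by (simp add: power_add power_divide mult.commute)
          then show "dist \<theta> (t (j + m)) \<le> D / 2 ^ m * (1 / 2) ^ j" using t(2)[of "j + m"] by simp
        qed
      qed auto
      then have "(\<lambda>j. t (j + m)) \<longlonglongrightarrow> \<theta>" by (subst tendsto_dist_iff) (simp only: dist_commute)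
      then have "(\<lambda>j. Z (t (j + m)) \<omega>) \<longlonglongrightarrow> Z \<theta> \<omega>"
        by (rule continuous_on_tendsto_compose[where s = \<Theta> and f = "\<lambda>\<theta>. Z \<theta> \<omega>", rotated])
           (use cont \<omega> \<theta> subsetD[OF T(2) t(1)] in auto)
      then have "(\<lambda>j. \<bar>Z (t (j + m)) \<omega> - Z (t m) \<omega>\<bar>) \<longlonglongrightarrow> \<bar>Z \<theta> \<omega> - Z (t m) \<omega>\<bar>"
        by (intro tendsto_intros)
      then have "\<bar>Z \<theta> \<omega> - Z (t m) \<omega>\<bar> \<le> r"
        by (rule LIMSEQ_le_const2) (use part in auto)
      then show ?thesis using t by blast
    qed
    show "likely M \<tau> (\<lambda>\<omega>. \<forall>s\<in>\<Theta>. \<forall>t\<in>\<Theta>. dist s t \<le> D / 2 ^ m \<longrightarrow> \<bar>Z s \<omega> - Z t \<omega>\<bar> \<le> \<epsilon>)"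
      unfolding likely_def
    proof (intro bexI[of _ B] conjI PB Bm ballI impI)
      fix \<omega> s t assume \<omega>: "\<omega> \<in> space M - B" and st: "s \<in> \<Theta>" "t \<in> \<Theta>" "dist s t \<le> D / 2 ^ m"
      obtain s' where s': "s' \<in> T m" "dist s s' \<le> D / 2 ^ m" "\<bar>Z s \<omega> - Z s' \<omega>\<bar> \<le> r"
        using approx[OF \<omega> st(1)] by blast
      obtain t' where t': "t' \<in> T m" "dist t t' \<le> D / 2 ^ m" "\<bar>Z t \<omega> - Z t' \<omega>\<bar> \<le> r"
        using approx[OF \<omega> st(2)] by blast
      have "dist s' t' \<le> dist s s' + dist s t + dist t t'"
        by (smt (verit) dist_commute dist_triangle)
      also have "\<dots> \<le> d m" using s' t' st(3) by (simp add: d_def)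
      finally have "(s', t') \<in> P m" using s' t' by (auto simp: P_def)
      then have "\<bar>Z s' \<omega> - Z t' \<omega>\<bar> \<le> a m" by (rule good[OF \<omega>]) simp
      \<comment> \<open>The middle threshold is the leading term of the tail sum, so the three parts
        add up to \<open>3 * r \<le> \<epsilon>\<close>.\<close>
      also have "a m \<le> r"
        using sum_le_suminf[OF sm, of "{0}"] a unfolding r_def by (auto intro: less_imp_le)
      finally show "\<bar>Z s \<omega> - Z t \<omega>\<bar> \<le> \<epsilon>" using s' t' r by linarith
    qed
  qed
qed

section \<open>Sums of independent variables and Gaussian variables\<close>

text \<open>Samples are numbered from 1, whereas the central limit theorem sums over
  \<open>i < n\<close>.\<close>

lemma (in prob_space) indep_vars_Suc:
  assumes "indep_vars (\<lambda>_. N) X {1..}"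
  shows "indep_vars (\<lambda>_. N) (\<lambda>i. X (Suc i)) UNIV"
  unfolding indep_vars_def2
proof (intro conjI ballI)
  show "random_variable N (X (Suc i))" for i using assms by (auto simp: indep_vars_def2)
  have X: "indep_sets (\<lambda>i. {X i -` A \<inter> space M |A. A \<in> sets N}) {1..}"
    using assms by (auto simp: indep_vars_def2)
  show "indep_sets (\<lambda>i. {X (Suc i) -` A \<inter> space M |A. A \<in> sets N}) UNIV"
  proof (rule indep_setsI)
    show "{X (Suc i) -` A \<inter> space M |A. A \<in> sets N} \<subseteq> events" for i
      using X by (auto simp: indep_sets_def)
    fix A :: "nat \<Rightarrow> 'a set" and J
    assume J: "J \<noteq> {}" "J \<subseteq> UNIV" "finite J"
      and A: "\<forall>j\<in>J. A j \<in> {X (Suc j) -` A \<inter> space M |A. A \<in> sets N}"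
    have "prob (\<Inter>j\<in>Suc ` J. A (j - 1)) = (\<Prod>j\<in>Suc ` J. prob (A (j - 1)))"
      by (rule indep_setsD[OF X]) (use J A in auto)
    then show "prob (\<Inter>(A ` J)) = (\<Prod>j\<in>J. prob (A j))"
      by (simp add: prod.reindex image_image)
  qed
qed

text \<open>Variance 0 is treated apart because the central limit theorem divides by the standard
  deviation; in that case all \<open>V i\<close> vanish almost surely and both sides are 1.\<close>

lemma (in prob_space) iid_cis_tendsto:
  fixes V :: "nat \<Rightarrow> 'a \<Rightarrow> real"
  assumes indep: "indep_vars (\<lambda>_. borel) V UNIV"
    and distr: "\<And>i. distr M borel (V i) = \<mu>"
    and mean: "\<And>i. expectation (V i) = 0"
    and sq: "\<And>i. integrable M (\<lambda>\<omega>. (V i \<omega>)\<^sup>2)" "\<And>i. expectation (\<lambda>\<omega>. (V i \<omega>)\<^sup>2) = s"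
  shows "(\<lambda>n. \<integral>\<omega>. cis ((\<Sum>i<n. V i \<omega>) / sqrt (real n)) \<partial>M) \<longlonglongrightarrow> complex_of_real (exp (- s / 2))"
proof -
  have V[measurable]: "V i \<in> borel_measurable M" for i
    using indep by (auto simp: indep_vars_def2)
  have "s \<ge> 0" using sq(2)[of 0] by (metis Bochner_Integration.integral_nonneg zero_le_power2)
  show ?thesis
  proof (cases "s = 0")
    case True
    have "AE \<omega> in M. (V i \<omega>)\<^sup>2 = 0" for i
      using integral_nonneg_eq_0_iff_AE[OF sq(1)[of i]] sq(2)[of i] True by simp
    then have "AE \<omega> in M. \<forall>i. V i \<omega> = 0" by (simp add: AE_all_countable)
    then have "(\<integral>\<omega>. cis ((\<Sum>i<n. V i \<omega>) / sqrt (real n)) \<partial>M) = (\<integral>\<omega>. 1 \<partial>M)" for n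
      by (intro integral_cong_AE) (auto simp: cis_conv_exp)
    then show ?thesis using True by (simp add: prob_space)
  next
    case False
    define \<sigma> where "\<sigma> = sqrt s"
    have \<sigma>: "\<sigma> > 0" "\<sigma>\<^sup>2 = s" using False \<open>s \<ge> 0\<close> by (auto simp: \<sigma>_def)
    have "weak_conv_m (\<lambda>n. distr M borel (\<lambda>x. (\<Sum>i<n. V i x) / sqrt (n * \<sigma>\<^sup>2))) std_normal_distribution"
      by (rule central_limit_theorem_zero_mean[OF indep mean \<sigma>(1) sq(1) _ distr])
         (simp add: mean sq \<sigma>)
    \<comment> \<open>Evaluation at \<open>\<sigma>\<close> undoes the division by the standard
      deviation.\<close>
    from levy_continuity1[OF _ real_dist_normal_dist this, of \<sigma>]
    have "(\<lambda>n. char (distr M borel (\<lambda>x. (\<Sum>i<n. V i x) / sqrt (n * \<sigma>\<^sup>2))) \<sigma>)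
        \<longlonglongrightarrow> complex_of_real (exp (- s / 2))"
      by (simp add: char_std_normal_distribution \<sigma>)
    moreover have "char (distr M borel (\<lambda>x. (\<Sum>i<n. V i x) / sqrt (n * \<sigma>\<^sup>2))) \<sigma> =
        (\<integral>\<omega>. cis ((\<Sum>i<n. V i \<omega>) / sqrt (real n)) \<partial>M)" for n
      using \<sigma>(1) by (simp add: char_def integral_distr real_sqrt_mult cis_conv_exp del: \<sigma>)
    ultimately show ?thesis by simp
  qed
qed

text \<open>A centred Gaussian law, possibly the point mass at 0, is determined by its second
  moment. The limit can therefore be identified through covariances alone.\<close>

lemma gaussian_variable_zero_mean:
  assumes "prob_space N" "gaussian_variable N Y" "(\<integral>v. Y v \<partial>N) = 0"
  shows "integrable N (\<lambda>v. (Y v)\<^sup>2)"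
    and "(\<integral>v. cis (Y v) \<partial>N) = complex_of_real (exp (- (\<integral>v. (Y v)\<^sup>2 \<partial>N) / 2))"
proof -
  interpret prob_space N by fact
  have [measurable]: "Y \<in> borel_measurable N" using assms(2) by (simp add: gaussian_variable_def)
  consider (nd) \<mu> \<sigma> where "\<sigma> > 0" "distributed N lborel Y (normal_density \<mu> \<sigma>)"
    | (const) \<mu> where "distr N borel Y = return borel \<mu>"
    using assms(2) by (auto simp: gaussian_variable_def)
  then have "integrable N (\<lambda>v. (Y v)\<^sup>2) \<and>
    (\<integral>v. cis (Y v) \<partial>N) = complex_of_real (exp (- (\<integral>v. (Y v)\<^sup>2 \<partial>N) / 2))"
  proof cases
    case nd
    have mu: "\<mu> = 0" using normal_distributed_expectation[OF nd] assms(3) by simp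
    have var: "(\<integral>v. (Y v)\<^sup>2 \<partial>N) = \<sigma>\<^sup>2" using normal_distributed_variance[OF nd] assms(3) by simp
    have "distributed N lborel (\<lambda>v. Y v / \<sigma>) std_normal_density"
      using nd normal_standard_normal_convert[OF nd(1), of Y \<mu>] mu by simp
    then have d: "distr N lborel (\<lambda>v. Y v / \<sigma>) = std_normal_distribution"
      by (rule distributed_distr_eq_density)
    have "distr N borel (\<lambda>v. Y v / \<sigma>) = distr N lborel (\<lambda>v. Y v / \<sigma>)"
      by (rule distr_cong) auto
    then have d: "distr N borel (\<lambda>v. Y v / \<sigma>) = std_normal_distribution" using d by simp
    have "complex_of_real (exp (- \<sigma>\<^sup>2 / 2)) = char (distr N borel (\<lambda>v. Y v / \<sigma>)) \<sigma>"
      by (simp add: d char_std_normal_distribution)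
    also have "\<dots> = (\<integral>v. cis (Y v) \<partial>N)"
      using nd(1) by (simp add: char_def integral_distr cis_conv_exp)
    finally have c: "(\<integral>v. cis (Y v) \<partial>N) = complex_of_real (exp (- \<sigma>\<^sup>2 / 2))" by simp
    \<comment> \<open>A non-integrable function has integral 0 by convention, which the positive
      value \<open>\<sigma>\<^sup>2\<close> excludes.\<close>
    have "integrable N (\<lambda>v. (Y v)\<^sup>2)"
      using var nd(1) not_integrable_integral_eq[of N "\<lambda>v. (Y v)\<^sup>2"] by fastforce
    then show ?thesis using c var by simp
  next
    case const
    have "AE y in distr N borel Y. y = \<mu>" unfolding const by (subst AE_return) auto
    then have ae: "AE v in N. Y v = \<mu>" by (subst (asm) AE_distr_iff) auto
    have "(\<integral>v. Y v \<partial>N) = (\<integral>v. \<mu> \<partial>N)" using ae by (intro integral_cong_AE) auto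
    then have "\<mu> = 0" using assms(3) by (simp add: prob_space)
    with ae have ae: "AE v in N. Y v = 0" by simp
    have "integrable N (\<lambda>v. (Y v)\<^sup>2) \<longleftrightarrow> integrable N (\<lambda>v. 0 :: real)"
      by (rule integrable_cong_AE) (use ae in auto)
    moreover have "(\<integral>v. (Y v)\<^sup>2 \<partial>N) = (\<integral>v. 0 \<partial>N)" by (rule integral_cong_AE) (use ae in auto)
    moreover have "(\<integral>v. cis (Y v) \<partial>N) = (\<integral>v. 1 \<partial>N)"
      by (rule integral_cong_AE) (use ae in \<open>auto simp: cis_conv_exp\<close>)
    ultimately show ?thesis by (simp add: prob_space)
  qed
  then show "integrable N (\<lambda>v. (Y v)\<^sup>2)"
    "(\<integral>v. cis (Y v) \<partial>N) = complex_of_real (exp (- (\<integral>v. (Y v)\<^sup>2 \<partial>N) / 2))" by auto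
qed

section \<open>Linear combinations of square-integrable variables\<close>

lemma integrable_mult_of_squares:
  fixes f g :: "'a \<Rightarrow> real"
  assumes [measurable]: "f \<in> borel_measurable M" "g \<in> borel_measurable M"
    and "integrable M (\<lambda>x. (f x)\<^sup>2)" "integrable M (\<lambda>x. (g x)\<^sup>2)"
  shows "integrable M (\<lambda>x. f x * g x)"
proof (rule Bochner_Integration.integrable_bound[of M "\<lambda>x. (f x)\<^sup>2 + (g x)\<^sup>2"])
  show "AE x in M. norm (f x * g x) \<le> norm ((f x)\<^sup>2 + (g x)\<^sup>2)"
  proof (intro always_eventually allI)
    fix x
    have "0 \<le> (\<bar>f x\<bar> - \<bar>g x\<bar>)\<^sup>2" by simp
    also have "\<dots> = (f x)\<^sup>2 + (g x)\<^sup>2 - 2 * \<bar>f x * g x\<bar>" by (simp add: power2_diff abs_mult)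
    finally show "norm (f x * g x) \<le> norm ((f x)\<^sup>2 + (g x)\<^sup>2)" by simp
  qed
qed (use assms in auto)

lemma integrable_square_sum:
  fixes f :: "'i \<Rightarrow> 'a \<Rightarrow> real"
  assumes "finite I" "\<And>i. i \<in> I \<Longrightarrow> f i \<in> borel_measurable M"
    and "\<And>i. i \<in> I \<Longrightarrow> integrable M (\<lambda>x. (f i x)\<^sup>2)"
  shows "integrable M (\<lambda>x. (\<Sum>i\<in>I. c i * f i x)\<^sup>2)"
proof -
  have "(\<lambda>x. (\<Sum>i\<in>I. c i * f i x)\<^sup>2) = (\<lambda>x. \<Sum>i\<in>I. \<Sum>j\<in>I. c i * c j * (f i x * f j x))"
    by (simp add: power2_eq_square sum_product ac_simps)
  then show ?thesis
    using assms by (auto intro!: Bochner_Integration.integrable_sum integrable_mult_right integrable_mult_of_squares)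
qed

lemma covariance_sum:
  fixes Y :: "'i \<Rightarrow> 'a \<Rightarrow> real"
  assumes "prob_space Q" "finite I" "\<And>i. i \<in> I \<Longrightarrow> Y i \<in> borel_measurable Q"
    and sq: "\<And>i. i \<in> I \<Longrightarrow> integrable Q (\<lambda>x. (Y i x)\<^sup>2)"
  shows "covariance Q (\<lambda>x. \<Sum>i\<in>I. c i * Y i x) (\<lambda>x. \<Sum>i\<in>I. c i * Y i x) =
    (\<Sum>i\<in>I. \<Sum>j\<in>I. c i * c j * covariance Q (Y i) (Y j))"
proof -
  interpret prob_space Q by fact
  have int: "integrable Q (Y i)" if "i \<in> I" for i
    using square_integrable_imp_integrable[of "Y i"] assms that by auto
  define m where "m i = expectation (Y i)" for i
  have E: "expectation (\<lambda>x. \<Sum>i\<in>I. c i * Y i x) = (\<Sum>i\<in>I. c i * m i)"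
    using int by (subst Bochner_Integration.integral_sum) (auto simp: m_def)
  have prod: "integrable Q (\<lambda>x. (Y i x - m i) * (Y j x - m j))" if "i \<in> I" "j \<in> I" for i j
  proof -
    have "integrable Q (\<lambda>x. (Y i x - m i)\<^sup>2)" if "i \<in> I" for i
      using sq[OF that] int[OF that] by (simp add: power2_diff)
    then show ?thesis using that assms(3) by (intro integrable_mult_of_squares) auto
  qed
  have "covariance Q (\<lambda>x. \<Sum>i\<in>I. c i * Y i x) (\<lambda>x. \<Sum>i\<in>I. c i * Y i x) =
      expectation (\<lambda>x. \<Sum>i\<in>I. \<Sum>j\<in>I. c i * c j * ((Y i x - m i) * (Y j x - m j)))"
    unfolding covariance_def E
    by (simp add: sum_subtractf[symmetric] right_diff_distrib[symmetric] sum_product ac_simps)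
  also have "\<dots> = (\<Sum>i\<in>I. \<Sum>j\<in>I. c i * c j * expectation (\<lambda>x. (Y i x - m i) * (Y j x - m j)))"
    using prod by (simp add: Bochner_Integration.integral_sum Bochner_Integration.integrable_sum)
  finally show ?thesis by (simp add: covariance_def m_def)
qed

text \<open>Taylor expansion of second order with Lagrange remainder. The range 2 is the bound on a
  centred truncated summand after division by \<open>sqrt n\<close>.\<close>

lemma exp_le_quadratic:
  fixes u :: real
  assumes "\<bar>u\<bar> \<le> 2"
  shows "exp u \<le> 1 + u + exp 2 * u\<^sup>2"
proof -
  obtain t where t: "\<bar>t\<bar> \<le> \<bar>u\<bar>" "exp u = (\<Sum>m<2. u ^ m / fact m) + exp t / fact 2 * u ^ 2"
    using Maclaurin_exp_le[of u 2] by blast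
  have "exp t / 2 * u\<^sup>2 \<le> exp 2 * u\<^sup>2"
  proof (rule mult_right_mono)
    have "exp t \<le> exp 2" using t(1) assms by simp
    moreover have "0 < exp t" by simp
    ultimately show "exp t / 2 \<le> exp 2" by linarith
  qed simp
  then show ?thesis using t(2) by (simp add: numeral_2_eq_2)
qed

text \<open>
  The increments are bounded by \<open>2 * sqrt n\<close>, so after division by \<open>sqrt n\<close> the quadratic
  bound on the exponential applies; the \<open>n\<close> factors \<open>1 + exp 2 * v / n\<close> stay below \<open>exp (exp 2 * v)\<close>.
\<close>

lemma (in prob_space) bounded_sum_tail:
  fixes U :: "nat \<Rightarrow> 'a \<Rightarrow> real"
  assumes n: "n \<ge> 1" and indep: "indep_vars (\<lambda>_. borel) U {1..n}"
    and mean: "\<And>i. i \<in> {1..n} \<Longrightarrow> expectation (U i) = 0"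
    and bd: "\<And>i \<omega>. i \<in> {1..n} \<Longrightarrow> \<omega> \<in> space M \<Longrightarrow> \<bar>U i \<omega>\<bar> \<le> 2 * sqrt (real n)"
    and sq: "\<And>i. i \<in> {1..n} \<Longrightarrow> expectation (\<lambda>\<omega>. (U i \<omega>)\<^sup>2) \<le> v" and v: "v \<ge> 0"
  shows "prob {\<omega>\<in>space M. b \<le> (\<Sum>i=1..n. U i \<omega>) / sqrt (real n)} \<le> exp (exp 2 * v - b)"
proof -
  define W where "W i \<omega> = exp (U i \<omega> / sqrt (real n))" for i \<omega>
  have U[measurable]: "U i \<in> borel_measurable M" if "i \<in> {1..n}" for i
    using indep that by (auto simp: indep_vars_def2)
  have Wm: "W i \<in> borel_measurable M" if "i \<in> {1..n}" for i
    using U[OF that] unfolding W_def by measurable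
  have sn: "sqrt (real n) > 0" using n by simp
  have ui: "\<bar>U i \<omega> / sqrt (real n)\<bar> \<le> 2" if "i \<in> {1..n}" "\<omega> \<in> space M" for i \<omega>
    using bd[OF that] sn by (simp add: pos_divide_le_eq)
  have Wi: "integrable M (W i)" if "i \<in> {1..n}" for i
  proof (rule integrable_const_bound[of _ "exp 2"])
    show "AE \<omega> in M. norm (W i \<omega>) \<le> exp 2" 
    proof (rule AE_I2)
      fix \<omega> assume "\<omega> \<in> space M"
      then have "U i \<omega> / sqrt (real n) \<le> 2" using ui[OF that, of \<omega>] unfolding abs_le_iff by blast
      then show "norm (W i \<omega>) \<le> exp 2" by (simp add: W_def)
    qed
  qed (rule Wm[OF that])
  have Ui: "integrable M (U i)" "integrable M (\<lambda>\<omega>. (U i \<omega>)\<^sup>2)" if "i \<in> {1..n}" for i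
  proof -
    show "integrable M (U i)"
      by (rule integrable_const_bound[of _ "2 * sqrt (real n)"]) (use bd U that in auto)
    have "(U i \<omega>)\<^sup>2 \<le> (2 * sqrt (real n))\<^sup>2" if "\<omega> \<in> space M" for \<omega>
      using bd[OF \<open>i \<in> {1..n}\<close> that] by (intro abs_le_square_iff[THEN iffD1]) auto
    then show "integrable M (\<lambda>\<omega>. (U i \<omega>)\<^sup>2)"
      by (intro integrable_const_bound[of _ "(2 * sqrt (real n))\<^sup>2"]) (use U that in auto)
  qed
  have EW: "expectation (W i) \<le> exp (exp 2 * v / real n)" if i: "i \<in> {1..n}" for i
  proof -
    have "expectation (W i) \<le> expectation (\<lambda>\<omega>. 1 + U i \<omega> / sqrt (real n) + exp 2 * (U i \<omega> / sqrt (real n))\<^sup>2)"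
      using exp_le_quadratic[OF ui[OF i]] Ui[OF i]
      by (intro integral_mono Wi i) (auto simp: W_def power_divide)
    also have "\<dots> = 1 + exp 2 * (expectation (\<lambda>\<omega>. (U i \<omega>)\<^sup>2) / real n)"
      using Ui[OF i] mean[OF i] by (simp add: power_divide prob_space)
    also have "\<dots> \<le> 1 + exp 2 * (v / real n)"
      using sq[OF i] by (intro add_left_mono mult_left_mono divide_right_mono) auto
    also have "\<dots> \<le> exp (exp 2 * v / real n)"
      using exp_ge_add_one_self[of "exp 2 * v / real n"] by simp
    finally show ?thesis .
  qed
  have indW: "indep_vars (\<lambda>_. borel) W {1..n}"
    unfolding W_def[abs_def] by (rule indep_vars_compose2[OF indep]) auto
  have prodW: "(\<Prod>i=1..n. W i \<omega>) = exp ((\<Sum>i=1..n. U i \<omega>) / sqrt (real n))" for \<omega>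
    unfolding W_def by (simp add: exp_sum sum_divide_distrib)
  have iW: "integrable M (\<lambda>\<omega>. \<Prod>i=1..n. W i \<omega>)"
    by (rule indep_vars_integrable[OF _ indW Wi]) auto
  have "expectation (\<lambda>\<omega>. \<Prod>i=1..n. W i \<omega>) = (\<Prod>i=1..n. expectation (W i))"
    by (rule indep_vars_lebesgue_integral[OF _ indW Wi]) auto
  also have "\<dots> \<le> (\<Prod>i=1..n. exp (exp 2 * v / real n))"
    using EW by (intro prod_mono) (auto intro!: Bochner_Integration.integral_nonneg simp: W_def)
  also have "\<dots> = exp (exp 2 * v)"
    using n by (simp add: exp_of_nat_mult[symmetric])
  finally have E: "expectation (\<lambda>\<omega>. \<Prod>i=1..n. W i \<omega>) \<le> exp (exp 2 * v)" .
  have "{\<omega>\<in>space M. b \<le> (\<Sum>i=1..n. U i \<omega>) / sqrt (real n)} = {\<omega>\<in>space M. exp b \<le> (\<Prod>i=1..n. W i \<omega>)}"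
    unfolding prodW by simp
  also have "prob \<dots> \<le> expectation (\<lambda>\<omega>. \<Prod>i=1..n. W i \<omega>) / exp b"
    by (rule integral_Markov_inequality_measure[OF iW sets.empty_sets])
       (auto simp: W_def intro!: always_eventually prod_nonneg)
  also have "\<dots> \<le> exp (exp 2 * v) / exp b" using E by (intro divide_right_mono) auto
  finally show ?thesis by (simp add: exp_diff)
qed

section \<open>Infima and convergence in distribution\<close>

text \<open>Off the \<open>\<eta>\<close>-neighbourhood of its zeros, \<open>A\<close> attains a
  positive minimum by compactness, and this minimum serves as \<open>\<alpha>\<close>; if nothing is
  left there, any positive value will do.\<close>

lemma near_zero_set:
  fixes A :: "'b :: metric_space \<Rightarrow> real"
  assumes "compact \<Theta>" "continuous_on \<Theta> A" "\<And>\<theta>. \<theta> \<in> \<Theta> \<Longrightarrow> A \<theta> \<ge> 0" "\<eta> > 0"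
  shows "\<exists>\<alpha>>0. \<forall>\<theta>\<in>\<Theta>. A \<theta> < \<alpha> \<longrightarrow> (\<exists>z\<in>{\<theta>\<in>\<Theta>. A \<theta> = 0}. dist \<theta> z < \<eta>)"
proof -
  let ?K = "\<Theta> \<inter> - (\<Union>z\<in>{\<theta>\<in>\<Theta>. A \<theta> = 0}. ball z \<eta>)"
  have K: "compact ?K" using assms(1) by (intro compact_Int_closed) (auto intro!: closed_Compl)
  show ?thesis
  proof (cases "?K = {}")
    case True
    then show ?thesis by (intro exI[of _ 1]) (auto simp: dist_commute)
  next
    case False
    have "continuous_on ?K A" by (rule continuous_on_subset[OF assms(2) Int_lower1])
    from continuous_attains_inf[OF K False this]
    obtain x where x: "x \<in> ?K" "\<forall>y\<in>?K. A x \<le> A y" by (rule bexE)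
    have "A x \<noteq> 0" using x(1) assms(4) by auto
    then have "A x > 0" using assms(3)[of x] x(1) by simp
    moreover have "\<exists>z\<in>{\<theta>\<in>\<Theta>. A \<theta> = 0}. dist \<theta> z < \<eta>" if "\<theta> \<in> \<Theta>" "A \<theta> < A x" for \<theta>
      using x(2)[rule_format, of \<theta>] that by (auto simp: dist_commute not_le)
    ultimately show ?thesis by blast
  qed
qed

text \<open>
  A large multiple of \<open>A \<ge> 0\<close> forces near-minimizers of \<open>a * A + H\<close> into a neighbourhood of the
  zero set \<open>Z\<close> of \<open>A\<close>, where \<open>H\<close> varies by at most \<open>\<epsilon>\<close>.
\<close>

lemma penalized_INF:
  fixes A H :: "'b :: metric_space \<Rightarrow> real"
  assumes Z: "Z \<noteq> {}" "Z \<subseteq> \<Theta>" "\<And>z. z \<in> Z \<Longrightarrow> A z = 0"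
    and near: "\<And>\<theta>. \<theta> \<in> \<Theta> \<Longrightarrow> A \<theta> < \<alpha> \<Longrightarrow> \<exists>z\<in>Z. dist \<theta> z < \<eta>"
    and A: "\<And>\<theta>. \<theta> \<in> \<Theta> \<Longrightarrow> A \<theta> \<ge> 0"
    and b: "\<And>\<theta>. \<theta> \<in> \<Theta> \<Longrightarrow> \<bar>H \<theta>\<bar> \<le> b" and a: "a \<ge> 0" "2 * b \<le> a * \<alpha>"
    and mod: "\<And>s t. s \<in> \<Theta> \<Longrightarrow> t \<in> \<Theta> \<Longrightarrow> dist s t \<le> \<eta> \<Longrightarrow> \<bar>H s - H t\<bar> \<le> \<epsilon>" and "\<epsilon> \<ge> 0"
  shows "\<bar>(INF \<theta>\<in>\<Theta>. a * A \<theta> + H \<theta>) - (INF \<theta>\<in>Z. H \<theta>)\<bar> \<le> \<epsilon>"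
proof -
  have bddZ: "bdd_below (H ` Z)"
    unfolding bdd_below_def using b Z(2) by (intro exI[of _ "- b"]) (force simp: abs_le_iff)
  have "- b \<le> a * A \<theta> + H \<theta>" if "\<theta> \<in> \<Theta>" for \<theta>
    using b[OF that] mult_nonneg_nonneg[OF a(1) A[OF that]] by linarith
  then have bdd: "bdd_below ((\<lambda>\<theta>. a * A \<theta> + H \<theta>) ` \<Theta>)"
    unfolding bdd_below_def by (intro exI[of _ "- b"]) auto
  have "(INF \<theta>\<in>\<Theta>. a * A \<theta> + H \<theta>) \<le> (INF \<theta>\<in>Z. H \<theta>)"
  proof (rule cINF_greatest[OF Z(1)])
    fix z assume "z \<in> Z"
    then show "(INF \<theta>\<in>\<Theta>. a * A \<theta> + H \<theta>) \<le> H z"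
      using cINF_lower[OF bdd, of z] Z by auto
  qed
  moreover have "(INF \<theta>\<in>Z. H \<theta>) - \<epsilon> \<le> (INF \<theta>\<in>\<Theta>. a * A \<theta> + H \<theta>)"
  proof (rule cINF_greatest)
    fix \<theta> assume \<theta>: "\<theta> \<in> \<Theta>"
    show "(INF \<theta>\<in>Z. H \<theta>) - \<epsilon> \<le> a * A \<theta> + H \<theta>"
    proof (cases "A \<theta> < \<alpha>")
      case True
      then obtain z where z: "z \<in> Z" "dist \<theta> z < \<eta>" using near[OF \<theta>] by blast
      then have "\<bar>H \<theta> - H z\<bar> \<le> \<epsilon>" using mod[OF \<theta>, of z] Z(2) by auto
      then show ?thesis
        using cINF_lower[OF bddZ z(1)] mult_nonneg_nonneg[OF a(1) A[OF \<theta>]] by linarith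
    next
      case False
      \<comment> \<open>Here the penalty alone outweighs the oscillation of \<open>H\<close>, which
        is at most \<open>2 * b\<close>, so \<open>\<theta>\<close> cannot undercut the values on
        \<open>Z\<close>.\<close>
      then have "2 * b \<le> a * A \<theta>" using a mult_left_mono[of \<alpha> "A \<theta>" a] by linarith
      moreover obtain z where z: "z \<in> Z" using Z(1) by blast
      ultimately show ?thesis
        using cINF_lower[OF bddZ z] b[of z] b[OF \<theta>] Z(2) \<open>\<epsilon> \<ge> 0\<close> by (auto simp: abs_le_iff)
    qed
  qed (use Z in auto)
  ultimately show ?thesis using \<open>\<epsilon> \<ge> 0\<close> by linarith
qed

text \<open>The infimum is nonexpansive for the uniform distance. Boundedness below of
  \<open>v\<close> is a conclusion too, since a real infimum is meaningful only in its
  presence.\<close>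

lemma INF_perturbation:
  fixes u v :: "'b \<Rightarrow> real"
  assumes "I \<noteq> {}" "bdd_below (u ` I)" "\<And>i. i \<in> I \<Longrightarrow> \<bar>u i - v i\<bar> \<le> \<epsilon>"
  shows "bdd_below (v ` I)" "\<bar>(INF i\<in>I. u i) - (INF i\<in>I. v i)\<bar> \<le> \<epsilon>"
proof -
  obtain m where m: "\<And>i. i \<in> I \<Longrightarrow> m \<le> u i" using assms(2) by (auto simp: bdd_below_def)
  have "m - \<epsilon> \<le> v i" if "i \<in> I" for i using m[OF that] assms(3)[OF that] by linarith
  then show bv: "bdd_below (v ` I)" unfolding bdd_below_def by blast
  have "(INF i\<in>I. u i) - \<epsilon> \<le> (INF i\<in>I. v i)"
    using assms(1) by (rule cINF_greatest) (use cINF_lower[OF assms(2)] assms(3) in \<open>force simp: abs_le_iff\<close>)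
  moreover have "(INF i\<in>I. v i) - \<epsilon> \<le> (INF i\<in>I. u i)"
    using assms(1) by (rule cINF_greatest) (use cINF_lower[OF bv] assms(3) in \<open>force simp: abs_le_iff\<close>)
  ultimately show "\<bar>(INF i\<in>I. u i) - (INF i\<in>I. v i)\<bar> \<le> \<epsilon>" by linarith
qed

lemma INF_affine:
  fixes u :: "'b \<Rightarrow> real"
  assumes "I \<noteq> {}" "bdd_below (u ` I)" "a > 0"
  shows "(INF i\<in>I. a * (u i - c)) = a * ((INF i\<in>I. u i) - c)"
proof (rule antisym)
  have low: "a * ((INF i\<in>I. u i) - c) \<le> a * (u i - c)" if "i \<in> I" for i
    using cINF_lower[OF assms(2) that] assms(3) by simp
  then show "a * ((INF i\<in>I. u i) - c) \<le> (INF i\<in>I. a * (u i - c))"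
    by (intro cINF_greatest assms(1))
  have bdd: "bdd_below ((\<lambda>i. a * (u i - c)) ` I)" unfolding bdd_below_def using low by blast
  have "(INF i\<in>I. a * (u i - c)) / a + c \<le> (INF i\<in>I. u i)"
  proof (rule cINF_greatest[OF assms(1)])
    fix i assume "i \<in> I"
    from cINF_lower[OF bdd this] show "(INF i\<in>I. a * (u i - c)) / a + c \<le> u i"
      using assms(3) by (simp add: field_simps)
  qed
  then show "(INF i\<in>I. a * (u i - c)) \<le> a * ((INF i\<in>I. u i) - c)"
    using assms(3) by (simp add: field_simps)
qed

lemma INF_ereal:
  assumes "I \<noteq> {}" "bdd_below (u ` I)"
  shows "(INF i\<in>I. ereal (u i)) = ereal (INF i\<in>I. u i)"
  using ereal_Inf'[OF assms(2)] assms(1) by (simp add: image_image)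

text \<open>A single sequence whose initial segments become nets of every fineness. Finite infima
  are thus indexed by one \<open>k\<close>, and an infimum over a compact set becomes a countable
  limit, hence measurable.\<close>

lemma dense_sequence:
  fixes K :: "'b :: {metric_space, second_countable_topology} set"
  assumes "compact K" "K \<noteq> {}"
  shows "\<exists>q :: nat \<Rightarrow> 'b. range q \<subseteq> K \<and>
    (\<forall>\<eta>>0. \<exists>k0. \<forall>\<theta>\<in>K. \<exists>j\<le>k0. dist \<theta> (q j) < \<eta>)"
proof -
  obtain T where T: "countable T" "T \<subseteq> K" "K \<subseteq> closure T" using separable by blast
  have "T \<noteq> {}" using T(3) assms(2) by auto
  define q where "q = from_nat_into T"
  have q: "range q = T" unfolding q_def using \<open>T \<noteq> {}\<close> T(1) by (rule range_from_nat_into)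
  have "\<exists>k0. \<forall>\<theta>\<in>K. \<exists>j\<le>k0. dist \<theta> (q j) < \<eta>" if "\<eta> > 0" for \<eta>
  proof -
    have "K \<subseteq> (\<Union>j\<in>UNIV. ball (q j) \<eta>)"
    proof
      fix \<theta> assume "\<theta> \<in> K"
      then have "\<theta> \<in> closure T" using T(3) by blast
      then obtain t where "t \<in> T" "dist t \<theta> < \<eta>"
        using \<open>\<eta> > 0\<close> unfolding closure_approachable by blast
      then show "\<theta> \<in> (\<Union>j\<in>UNIV. ball (q j) \<eta>)" using q by auto
    qed
    from compactE_image[OF assms(1) _ this] obtain J where
      J: "finite J" "K \<subseteq> (\<Union>j\<in>J. ball (q j) \<eta>)" by auto
    show ?thesis
    proof (rule exI[of _ "Max (insert 0 J)"], rule ballI)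
      fix \<theta> assume "\<theta> \<in> K"
      then obtain j where "j \<in> J" "dist \<theta> (q j) < \<eta>" using J(2) by (auto simp: dist_commute)
      then show "\<exists>j\<le>Max (insert 0 J). dist \<theta> (q j) < \<eta>"
        using J(1) by (intro exI[of _ j]) auto
    qed
  qed
  then show ?thesis using q T(2) by (intro exI[of _ q]) auto
qed

lemma INF_net:
  fixes h :: "'b :: metric_space \<Rightarrow> real"
  assumes "K \<noteq> {}" and q: "range q \<subseteq> K" and bdd: "bdd_below (h ` K)"
    and net: "\<And>\<theta>. \<theta> \<in> K \<Longrightarrow> \<exists>j\<le>k. dist \<theta> (q j) < \<eta>"
    and mod: "\<And>s t. s \<in> K \<Longrightarrow> t \<in> K \<Longrightarrow> dist s t \<le> \<eta> \<Longrightarrow> \<bar>h s - h t\<bar> \<le> \<epsilon>"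
  shows "\<bar>(INF \<theta>\<in>K. h \<theta>) - (INF j\<in>{..k :: nat}. h (q j))\<bar> \<le> \<epsilon>"
proof -
  have "(INF \<theta>\<in>K. h \<theta>) \<le> (INF j\<in>{..k}. h (q j))"
    by (rule cINF_greatest) (use cINF_lower[OF bdd] q in auto)
  moreover have "(INF j\<in>{..k}. h (q j)) - \<epsilon> \<le> (INF \<theta>\<in>K. h \<theta>)"
  proof (rule cINF_greatest[OF assms(1)])
    fix \<theta> assume \<theta>: "\<theta> \<in> K"
    then obtain j where j: "j \<le> k" "dist \<theta> (q j) < \<eta>" using net by blast
    then have "\<bar>h \<theta> - h (q j)\<bar> \<le> \<epsilon>" using mod[OF \<theta>, of "q j"] q by auto
    moreover have "(INF j\<in>{..k}. h (q j)) \<le> h (q j)" by (rule cINF_lower) (use j in auto)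
    ultimately show "(INF j\<in>{..k}. h (q j)) - \<epsilon> \<le> h \<theta>" by linarith
  qed
  ultimately show ?thesis by linarith
qed

lemma bdd_below_continuous_image:
  fixes h :: "'b :: topological_space \<Rightarrow> real"
  assumes "compact K" "continuous_on K h"
  shows "bdd_below (h ` K)"
  using compact_continuous_image[OF assms(2,1)] by (intro bounded_imp_bdd_below compact_imp_bounded)

lemma INF_dense_sequence_tendsto:
  fixes h :: "'b :: metric_space \<Rightarrow> real"
  assumes "compact K" "K \<noteq> {}" "continuous_on K h" and q: "range q \<subseteq> K"
    "\<And>\<eta>. \<eta> > 0 \<Longrightarrow> \<exists>k0. \<forall>\<theta>\<in>K. \<exists>j\<le>k0 :: nat. dist \<theta> (q j) < \<eta>"
  shows "(\<lambda>k. INF j\<in>{..k}. h (q j)) \<longlonglongrightarrow> (INF \<theta>\<in>K. h \<theta>)"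
proof (rule LIMSEQ_I)
  fix r :: real assume "r > 0"
  have "uniformly_continuous_on K h" by (rule compact_uniformly_continuous[OF assms(3,1)])
  then obtain d where d: "d > 0" "\<And>s t. s \<in> K \<Longrightarrow> t \<in> K \<Longrightarrow> dist t s < d \<Longrightarrow> dist (h t) (h s) < r / 2"
    unfolding uniformly_continuous_on_def using \<open>r > 0\<close> by (metis half_gt_zero)
  obtain k0 where k0: "\<forall>\<theta>\<in>K. \<exists>j\<le>k0. dist \<theta> (q j) < d / 2" using q(2)[of "d / 2"] d(1) by auto
  show "\<exists>k0. \<forall>k\<ge>k0. norm ((INF j\<in>{..k}. h (q j)) - (INF \<theta>\<in>K. h \<theta>)) < r"
  proof (intro exI allI impI)
    fix k assume "k \<ge> k0"
    have "\<bar>(INF \<theta>\<in>K. h \<theta>) - (INF j\<in>{..k}. h (q j))\<bar> \<le> r / 2"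
    proof (rule INF_net[OF assms(2) q(1) bdd_below_continuous_image[OF assms(1,3)]])
      show "\<exists>j\<le>k. dist \<theta> (q j) < d / 2" if "\<theta> \<in> K" for \<theta>
        using k0 that \<open>k \<ge> k0\<close> by (meson order_trans)
      show "\<bar>h s - h t\<bar> \<le> r / 2" if "s \<in> K" "t \<in> K" "dist s t \<le> d / 2" for s t
        using d(2)[of t s] that d(1) by (auto simp: dist_real_def)
    qed
    then show "norm ((INF j\<in>{..k}. h (q j)) - (INF \<theta>\<in>K. h \<theta>)) < r"
      using \<open>r > 0\<close> unfolding real_norm_def by linarith
  qed
qed

lemma borel_measurable_INF_continuous:
  fixes h :: "'b :: {metric_space, second_countable_topology} \<Rightarrow> 'w \<Rightarrow> real"
  assumes "compact K" "K \<noteq> {}" "\<And>\<theta>. \<theta> \<in> K \<Longrightarrow> h \<theta> \<in> borel_measurable M"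
    and "\<And>\<omega>. \<omega> \<in> space M \<Longrightarrow> continuous_on K (\<lambda>\<theta>. h \<theta> \<omega>)"
  shows "(\<lambda>\<omega>. INF \<theta>\<in>K. h \<theta> \<omega>) \<in> borel_measurable M"
proof -
  obtain q :: "nat \<Rightarrow> 'b" where q: "range q \<subseteq> K"
    "\<And>\<eta>. \<eta> > 0 \<Longrightarrow> \<exists>k0. \<forall>\<theta>\<in>K. \<exists>j\<le>k0. dist \<theta> (q j) < \<eta>"
    using dense_sequence[OF assms(1,2)] by blast
  show ?thesis
  proof (rule borel_measurable_LIMSEQ_real)
    show "(\<lambda>k. INF j\<in>{..k}. h (q j) \<omega>) \<longlonglongrightarrow> (INF \<theta>\<in>K. h \<theta> \<omega>)" if "\<omega> \<in> space M" for \<omega>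
      by (rule INF_dense_sequence_tendsto[OF assms(1,2) assms(4)[OF that] q])
    show "(\<lambda>\<omega>. INF j\<in>{..k}. h (q j) \<omega>) \<in> borel_measurable M" for k
      by (rule borel_measurable_cINF_real) (use assms(3) q(1) in auto)
  qed
qed

lemma continuous_on_INF_atMost:
  fixes f :: "nat \<Rightarrow> 'a :: topological_space \<Rightarrow> real"
  assumes "\<And>j. continuous_on S (f j)"
  shows "continuous_on S (\<lambda>y. INF j\<in>{..k}. f j y)"
proof (induction k)
  case (Suc k)
  have "(INF j\<in>{..Suc k}. f j y) = min (f (Suc k) y) (INF j\<in>{..k}. f j y)" for y
    unfolding atMost_Suc by (subst cINF_insert) (auto simp: inf_real_def)
  then show ?case using Suc assms by (auto intro!: continuous_intros)
qed (use assms in simp)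

section \<open>Approximation of laws by Lipschitz test functions\<close>

lemma cts_step_bounds: "0 \<le> cts_step a b x \<and> cts_step a b x \<le> 1" if "a < b"
  using that by (auto simp: cts_step_def divide_simps)

lemma cts_step_lipschitz:
  assumes "a < b"
  shows "\<bar>cts_step a b x - cts_step a b y\<bar> \<le> \<bar>x - y\<bar> / (b - a)"
proof -
  have clip: "cts_step a b z = max 0 (min 1 ((b - z) / (b - a)))" for z
    using assms by (auto simp: cts_step_def divide_simps)
  have "\<bar>cts_step a b x - cts_step a b y\<bar> \<le> \<bar>(b - x) / (b - a) - (b - y) / (b - a)\<bar>"
    unfolding clip by linarith
  also have "\<dots> = \<bar>(y - x) / (b - a)\<bar>" by (simp add: diff_divide_distrib[symmetric])
  also have "\<dots> = \<bar>x - y\<bar> / (b - a)" using assms by (simp add: abs_minus_commute)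
  finally show ?thesis .
qed

text \<open>Interchange of two limits: \<open>W k n\<close> is close to \<open>V n\<close> for large
  \<open>k\<close>, it converges to \<open>Y k\<close> in law as \<open>n\<close> grows, and
  \<open>Y k\<close> tends to \<open>Z\<close>. The test functions are Lipschitz with values in the
  unit interval, so an exceptional event costs no more than its probability.\<close>

lemma weak_conv_approx:
  fixes V :: "nat \<Rightarrow> 'w \<Rightarrow> real" and Z :: "'v \<Rightarrow> real"
  assumes M: "prob_space M" and N: "prob_space N"
    and meas: "\<And>n. V n \<in> borel_measurable M" "\<And>k n. W k n \<in> borel_measurable M"
      "Z \<in> borel_measurable N" "\<And>k. Y k \<in> borel_measurable N"
    and close: "\<And>\<epsilon> \<tau>. \<epsilon> > 0 \<Longrightarrow> \<tau> > 0 \<Longrightarrow> \<exists>k0. \<forall>k\<ge>k0. \<forall>\<^sub>F n in sequentially.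
      likely M \<tau> (\<lambda>\<omega>. \<bar>V n \<omega> - W k n \<omega>\<bar> \<le> \<epsilon>)"
    and conv: "\<And>k a b. a < b \<Longrightarrow> (\<lambda>n. \<integral>\<omega>. cts_step a b (W k n \<omega>) \<partial>M) \<longlonglongrightarrow> (\<integral>v. cts_step a b (Y k v) \<partial>N)"
    and lim: "\<And>v. v \<in> space N \<Longrightarrow> (\<lambda>k. Y k v) \<longlonglongrightarrow> Z v"
  shows "weak_conv_m (\<lambda>n. distr M borel (V n)) (distr N borel Z)"
proof -
  interpret M: prob_space M by fact
  interpret N: prob_space N by fact
  note [measurable] = meas
  show ?thesis
  proof (rule integral_cts_step_conv_imp_weak_conv)
    show "real_distribution (distr M borel (V n))" for n by (rule M.real_distribution_distr) simp
    show "real_distribution (distr N borel Z)" by (rule N.real_distribution_distr) simp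
    fix a b :: real assume ab: "a < b"
    have [measurable]: "cts_step a b \<in> borel_measurable borel"
      by (intro borel_measurable_continuous_onI uniformly_continuous_imp_continuous cts_step_uniformly_continuous ab)
    have intM: "integrable M (\<lambda>x. cts_step a b (u x))" if [measurable]: "u \<in> borel_measurable M" for u
      by (rule M.integrable_const_bound[of _ 1]) (use cts_step_bounds[OF ab] in auto)
    have limY: "(\<lambda>k. \<integral>v. cts_step a b (Y k v) \<partial>N) \<longlonglongrightarrow> (\<integral>v. cts_step a b (Z v) \<partial>N)"
    proof (rule integral_dominated_convergence[where w = "\<lambda>_. 1"])
      show "AE v in N. (\<lambda>k. cts_step a b (Y k v)) \<longlonglongrightarrow> cts_step a b (Z v)"
      proof (rule AE_I2)
        fix v assume "v \<in> space N"
        have "continuous_on UNIV (cts_step a b)"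
          by (intro uniformly_continuous_imp_continuous cts_step_uniformly_continuous ab)
        then show "(\<lambda>k. cts_step a b (Y k v)) \<longlonglongrightarrow> cts_step a b (Z v)"
          by (rule continuous_on_tendsto_compose[OF _ lim[OF \<open>v \<in> space N\<close>]]) auto
      qed
    qed (use cts_step_bounds[OF ab] in auto)
    have "(\<lambda>n. \<integral>\<omega>. cts_step a b (V n \<omega>) \<partial>M) \<longlonglongrightarrow> (\<integral>v. cts_step a b (Z v) \<partial>N)"
    proof (rule LIMSEQ_I)
      fix r :: real assume r: "r > 0"
      \<comment> \<open>The Lipschitz constant of \<open>cts_step a b\<close> is
        \<open>1 / (b - a)\<close>, so the good event contributes \<open>r / 4\<close>; with
        \<open>r / 8\<close> for the bad event and \<open>r / 4\<close> for each of the two limits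
        the total stays below \<open>r\<close>.\<close>
      define \<epsilon> where "\<epsilon> = (b - a) * (r / 4)"
      have \<epsilon>: "\<epsilon> > 0" using ab r by (simp add: \<epsilon>_def)
      have \<epsilon>_ab: "\<epsilon> / (b - a) = r / 4"
        unfolding \<epsilon>_def by (rule nonzero_mult_div_cancel_left) (use ab in simp)
      obtain k0 where k0: "\<And>k. k \<ge> k0 \<Longrightarrow> \<forall>\<^sub>F n in sequentially.
          likely M (r / 8) (\<lambda>\<omega>. \<bar>V n \<omega> - W k n \<omega>\<bar> \<le> \<epsilon>)"
        using close[OF \<epsilon>, of "r / 8"] r by auto
      obtain k1 where k1: "\<And>k. k \<ge> k1 \<Longrightarrow>
          norm ((\<integral>v. cts_step a b (Y k v) \<partial>N) - (\<integral>v. cts_step a b (Z v) \<partial>N)) < r / 4"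
        using LIMSEQ_D[OF limY, of "r / 4"] r by auto
      define k where "k = max k0 k1"
      have "\<forall>\<^sub>F n in sequentially.
          norm ((\<integral>\<omega>. cts_step a b (W k n \<omega>) \<partial>M) - (\<integral>v. cts_step a b (Y k v) \<partial>N)) < r / 4"
        using tendstoD[OF conv[OF ab, of k], of "r / 4"] r by (simp add: dist_norm)
      moreover have "\<forall>\<^sub>F n in sequentially. likely M (r / 8) (\<lambda>\<omega>. \<bar>V n \<omega> - W k n \<omega>\<bar> \<le> \<epsilon>)"
        by (rule k0) (simp add: k_def)
      ultimately have "\<forall>\<^sub>F n in sequentially.
          norm ((\<integral>\<omega>. cts_step a b (V n \<omega>) \<partial>M) - (\<integral>v. cts_step a b (Z v) \<partial>N)) < r"
      proof eventually_elim
        case (elim n)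
        then obtain B where B[measurable]: "B \<in> sets M" and PB: "measure M B \<le> r / 8"
          and good: "\<And>\<omega>. \<omega> \<in> space M - B \<Longrightarrow> \<bar>V n \<omega> - W k n \<omega>\<bar> \<le> \<epsilon>"
          unfolding likely_def by blast
        have "\<bar>(\<integral>\<omega>. cts_step a b (V n \<omega>) \<partial>M) - (\<integral>\<omega>. cts_step a b (W k n \<omega>) \<partial>M)\<bar> =
            \<bar>\<integral>\<omega>. cts_step a b (V n \<omega>) - cts_step a b (W k n \<omega>) \<partial>M\<bar>"
          by (subst Bochner_Integration.integral_diff) (auto intro: intM meas)
        also have "\<dots> \<le> (\<integral>\<omega>. \<bar>cts_step a b (V n \<omega>) - cts_step a b (W k n \<omega>)\<bar> \<partial>M)"
          by (rule integral_abs_bound)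
        also have "\<dots> \<le> (\<integral>\<omega>. r / 4 + indicator B \<omega> \<partial>M)"
        proof (rule integral_mono)
          fix \<omega> assume \<omega>: "\<omega> \<in> space M"
          show "\<bar>cts_step a b (V n \<omega>) - cts_step a b (W k n \<omega>)\<bar> \<le> r / 4 + indicator B \<omega>"
          proof (cases "\<omega> \<in> B")
            case True
            then show ?thesis
              using cts_step_bounds[OF ab, of "V n \<omega>"] cts_step_bounds[OF ab, of "W k n \<omega>"] r by auto
          next
            case False
            have "\<bar>cts_step a b (V n \<omega>) - cts_step a b (W k n \<omega>)\<bar> \<le> \<bar>V n \<omega> - W k n \<omega>\<bar> / (b - a)"
              by (rule cts_step_lipschitz[OF ab])
            also have "\<dots> \<le> \<epsilon> / (b - a)" using good[of \<omega>] \<omega> False ab by (intro divide_right_mono) auto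
            finally show ?thesis using \<epsilon>_ab False by simp
          qed
        qed (auto intro!: intM meas integrable_real_indicator Bochner_Integration.integrable_add simp: M.emeasure_eq_measure)
        also have "\<dots> = r / 4 + measure M B"
          by (subst Bochner_Integration.integral_add)
             (auto simp: M.prob_space M.emeasure_eq_measure intro!: integrable_real_indicator)
        finally have "\<bar>(\<integral>\<omega>. cts_step a b (V n \<omega>) \<partial>M) - (\<integral>\<omega>. cts_step a b (W k n \<omega>) \<partial>M)\<bar> \<le> r / 4 + r / 8"
          using PB by linarith
        moreover have "norm ((\<integral>v. cts_step a b (Y k v) \<partial>N) - (\<integral>v. cts_step a b (Z v) \<partial>N)) < r / 4"
          by (rule k1) (simp add: k_def)
        ultimately show ?case using elim(1) r unfolding real_norm_def by linarith
      qed
      then show "\<exists>n0. \<forall>n\<ge>n0. norm ((\<integral>\<omega>. cts_step a b (V n \<omega>) \<partial>M) - (\<integral>v. cts_step a b (Z v) \<partial>N)) < r"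
        by (simp add: eventually_sequentially)
    qed
    then show "(\<lambda>n. integral\<^sup>L (distr M borel (V n)) (cts_step a b)) \<longlonglongrightarrow>
        integral\<^sup>L (distr N borel Z) (cts_step a b)"
      by (simp only: integral_distr[OF meas(1)] integral_distr[OF meas(3)] \<open>cts_step a b \<in> borel_measurable borel\<close>)
  qed
qed

lemma abs_bilinear_le: "\<bar>x * y + z * w\<bar> \<le> \<bar>x\<bar> * \<bar>y\<bar> + \<bar>z\<bar> * \<bar>w\<bar>" for x y z w :: real
  using abs_triangle_ineq[of "x * y" "z * w"] by (simp add: abs_mult)

lemma small_o_p_likely:
  assumes "prob_space M" "small_o_p M Y 0" "e > 0" "\<tau> > 0"
  shows "\<forall>\<^sub>F n in sequentially. likely M \<tau> (\<lambda>\<omega>. \<bar>Y n \<omega>\<bar> \<le> ereal e)"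
proof -
  let ?Y = "\<lambda>n \<omega>. ereal (real n powr 0) * Y n \<omega>"
  have meas: "\<forall>\<^sub>F n in sequentially. ?Y n \<in> borel_measurable M"
    and lim: "(\<lambda>n. measure M {\<omega>\<in>space M. \<bar>?Y n \<omega>\<bar> > ereal e}) \<longlonglongrightarrow> 0"
    using assms(2,3) unfolding small_o_p_def tends_to_zero_in_prob_def by blast+
  from lim have "\<forall>\<^sub>F n in sequentially. measure M {\<omega>\<in>space M. \<bar>?Y n \<omega>\<bar> > ereal e} < \<tau>"
    using assms(4) by (rule order_tendstoD(2))
  with meas show ?thesis using eventually_ge_at_top[of 1]
  proof eventually_elim
    case (elim n)
    \<comment> \<open>\<open>0 powr 0\<close> is 0, so the factor is 1 from \<open>n = 1\<close> on
      only.\<close>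
    have one: "ereal (real n powr 0) = 1" using elim(3) by (simp add: one_ereal_def)
    have [measurable]: "Y n \<in> borel_measurable M" using elim(1) unfolding one by simp
    show ?case
      unfolding likely_def using elim(2) unfolding one
      by (intro bexI[of _ "{\<omega>\<in>space M. \<bar>Y n \<omega>\<bar> > ereal e}"]) (auto simp: not_less)
  qed
qed

lemma likely_tends_to_zero_in_prob:
  assumes M: "prob_space M" and meas: "\<forall>\<^sub>F n in sequentially. Y n \<in> borel_measurable M"
    and likely: "\<And>e \<tau> :: real. e > 0 \<Longrightarrow> \<tau> > 0 \<Longrightarrow>
      \<forall>\<^sub>F n in sequentially. likely M \<tau> (\<lambda>\<omega>. \<bar>Y n \<omega>\<bar> \<le> ereal e)"
  shows "tends_to_zero_in_prob M Y"
  unfolding tends_to_zero_in_prob_def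
proof (intro conjI allI impI meas)
  interpret prob_space M by fact
  fix e :: real assume e: "e > 0"
  show "(\<lambda>n. measure M {\<omega>\<in>space M. \<bar>Y n \<omega>\<bar> > ereal e}) \<longlonglongrightarrow> 0"
  proof (rule order_tendstoI)
    fix a :: real assume "0 < a"
    then have "\<forall>\<^sub>F n in sequentially. likely M (a / 2) (\<lambda>\<omega>. \<bar>Y n \<omega>\<bar> \<le> ereal e)" using likely[OF e] by simp
    then show "\<forall>\<^sub>F n in sequentially. measure M {\<omega>\<in>space M. \<bar>Y n \<omega>\<bar> > ereal e} < a"
    proof eventually_elim
      case (elim n)
      then obtain B where B: "B \<in> sets M" "measure M B \<le> a / 2"
        "\<forall>\<omega>\<in>space M - B. \<bar>Y n \<omega>\<bar> \<le> ereal e" unfolding likely_def by blast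
      have "measure M {\<omega>\<in>space M. \<bar>Y n \<omega>\<bar> > ereal e} \<le> measure M B"
      proof (rule finite_measure_mono[OF _ B(1)], rule subsetI, rule ccontr)
        fix \<omega> assume "\<omega> \<in> {\<omega>\<in>space M. \<bar>Y n \<omega>\<bar> > ereal e}" "\<omega> \<notin> B"
        moreover from this have "\<bar>Y n \<omega>\<bar> \<le> ereal e" using B(3) by auto
        ultimately show False by (auto dest: leD)
      qed
      then show ?case using B(2) \<open>0 < a\<close> by linarith
    qed
  qed (auto intro!: always_eventually intro: less_le_trans[OF _ measure_nonneg])
qed

section \<open>The empirical process of a Lipschitz loss\<close>

text \<open>The sampling side alone: the ambiguity sets and the Gaussian limit enter later, as
  parameters of single lemmas.\<close>

locale iid_lipschitz_loss = prob_space M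
  for M :: "'w measure" +
  fixes S :: "'s :: topological_space set" and \<Theta> :: "(real ^ 'm) set"
    and l :: "'s \<Rightarrow> real ^ 'm \<Rightarrow> real" and P :: "'s measure"
    and X :: "nat \<Rightarrow> 'w \<Rightarrow> 's" and \<psi> :: "'s \<Rightarrow> real" and \<theta>bar :: "real ^ 'm"
  assumes compact: "compact \<Theta>"
    and l_cont: "continuous_on (S \<times> \<Theta>) (\<lambda>(x, \<theta>). l x \<theta>)"
    and P_in: "P \<in> prob_measures_on S"
    and X: "\<And>i. i \<ge> 1 \<Longrightarrow> X i \<in> measurable M (borel_on S)"
      "\<And>i. i \<ge> 1 \<Longrightarrow> distr M (borel_on S) (X i) = P"
    and X_indep: "indep_vars (\<lambda>_. borel_on S) X {1..}"
    and \<theta>bar: "\<theta>bar \<in> \<Theta>" "integrable P (\<lambda>x. (l x \<theta>bar)\<^sup>2)"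
    and \<psi>: "\<psi> \<in> borel_measurable (borel_on S)" "\<And>x. x \<in> S \<Longrightarrow> \<psi> x \<ge> 0"
      "integrable P (\<lambda>x. (\<psi> x)\<^sup>2)"
    and lipschitz: "AE x in P. \<forall>\<theta>\<in>\<Theta>. \<forall>\<theta>'\<in>\<Theta>. \<bar>l x \<theta> - l x \<theta>'\<bar> \<le> \<psi> x * norm (\<theta> - \<theta>')"
begin

lemma sets_P: "sets P = sets (borel_on S)" and prob_space_P: "prob_space P"
  using P_in by (auto simp: prob_measures_on_def space_prob_algebra)

lemma space_P: "space P = S"
  using sets_eq_imp_space_eq[OF sets_P] by (simp add: space_restrict_space)

sublocale P: prob_space P by (rule prob_space_P)

lemma measurable_X[measurable]: "i \<ge> 1 \<Longrightarrow> X i \<in> measurable M P"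
  using X(1) measurable_cong_sets[OF refl sets_P] by blast

lemma distr_X: "i \<ge> 1 \<Longrightarrow> distr M P (X i) = P"
  using X(2) distr_cong[OF refl sets_P] by metis

lemma X_in_S: "\<omega> \<in> space M \<Longrightarrow> i \<ge> 1 \<Longrightarrow> X i \<omega> \<in> S"
  using measurable_space[OF measurable_X] space_P by blast

lemma indep_X: "indep_vars (\<lambda>_. P) X {1..}"
  using X_indep measurable_cong_sets[OF refl sets_P] unfolding indep_vars_def2 by (simp add: sets_P)

lemma expectation_X:
  fixes h :: "'s \<Rightarrow> real"
  assumes "i \<ge> 1" "h \<in> borel_measurable P"
  shows "expectation (\<lambda>\<omega>. h (X i \<omega>)) = (\<integral>x. h x \<partial>P)"
  using integral_distr[OF measurable_X[OF assms(1)] assms(2)] distr_X[OF assms(1)] by simp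

lemma integrable_X:
  fixes h :: "'s \<Rightarrow> real"
  assumes "i \<ge> 1" "integrable P h"
  shows "integrable M (\<lambda>\<omega>. h (X i \<omega>))"
  using integrable_distr[of "X i" M P h] assms distr_X[OF assms(1)] by simp

lemma measurable_psi[measurable]: "\<psi> \<in> borel_measurable P"
  using \<psi>(1) measurable_cong_sets[OF sets_P refl] by blast

lemma measurable_l: "\<theta> \<in> \<Theta> \<Longrightarrow> (\<lambda>x. l x \<theta>) \<in> borel_measurable (borel_on S)"
proof -
  assume "\<theta> \<in> \<Theta>"
  then have "continuous_on S (\<lambda>x. case (x, \<theta>) of (x, \<theta>) \<Rightarrow> l x \<theta>)"
    by (intro continuous_on_compose2[OF l_cont]) (auto intro!: continuous_intros)
  then show ?thesis using borel_measurable_continuous_on_restrict by auto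
qed

lemma measurable_l_P[measurable]: "\<theta> \<in> \<Theta> \<Longrightarrow> (\<lambda>x. l x \<theta>) \<in> borel_measurable P"
  using measurable_l measurable_cong_sets[OF sets_P refl] by blast

lemma l_cont_parameter: "x \<in> S \<Longrightarrow> continuous_on \<Theta> (l x)"
proof -
  assume "x \<in> S"
  then have "continuous_on \<Theta> (\<lambda>\<theta>. case (x, \<theta>) of (x, \<theta>) \<Rightarrow> l x \<theta>)"
    by (intro continuous_on_compose2[OF l_cont]) (auto intro!: continuous_intros)
  then show ?thesis by simp
qed

lemma integrable_psi: "integrable P \<psi>"
  using P.square_integrable_imp_integrable[OF measurable_psi \<psi>(3)] .

text \<open>The Lipschitz bound spreads square integrability from \<open>\<theta>bar\<close> to all
  of \<open>\<Theta>\<close>, through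
  \<open>(a + b)\<^sup>2 \<le> 2 * a\<^sup>2 + 2 * b\<^sup>2\<close>.\<close>

lemma integrable_l_square: "\<theta> \<in> \<Theta> \<Longrightarrow> integrable P (\<lambda>x. (l x \<theta>)\<^sup>2)"
proof -
  assume t: "\<theta> \<in> \<Theta>"
  show ?thesis
  proof (rule Bochner_Integration.integrable_bound)
    show "integrable P (\<lambda>x. 2 * (l x \<theta>bar)\<^sup>2 + 2 * (norm (\<theta> - \<theta>bar))\<^sup>2 * (\<psi> x)\<^sup>2)"
      using \<theta>bar \<psi> by auto
    show "(\<lambda>x. (l x \<theta>)\<^sup>2) \<in> borel_measurable P" using t by measurable
    show "AE x in P. norm ((l x \<theta>)\<^sup>2) \<le> norm (2 * (l x \<theta>bar)\<^sup>2 + 2 * (norm (\<theta> - \<theta>bar))\<^sup>2 * (\<psi> x)\<^sup>2)"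
      using lipschitz
    proof eventually_elim
      case (elim x)
      define a where "a = l x \<theta>bar"
      define b where "b = l x \<theta> - l x \<theta>bar"
      have b: "b\<^sup>2 \<le> (\<psi> x * norm (\<theta> - \<theta>bar))\<^sup>2"
        using elim t \<theta>bar(1) abs_ge_zero[of b]
        by (intro abs_le_square_iff[THEN iffD1]) (force simp: b_def intro: order_trans[OF _ abs_ge_self])
      have "(l x \<theta>)\<^sup>2 = (a + b)\<^sup>2" by (simp add: a_def b_def)
      also have "\<dots> \<le> 2 * a\<^sup>2 + 2 * b\<^sup>2" using sum_squares_bound[of a b] by (simp add: power2_sum)
      finally show ?case using b by (simp add: a_def power_mult_distrib mult.commute)
    qed
  qed
qed

lemma integrable_l: "\<theta> \<in> \<Theta> \<Longrightarrow> integrable P (\<lambda>x. l x \<theta>)"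
  using P.square_integrable_imp_integrable[OF measurable_l_P integrable_l_square] by blast

definition G :: "nat \<Rightarrow> real ^ 'm \<Rightarrow> 'w \<Rightarrow> real" where
  "G n \<theta> \<omega> = (\<Sum>i=1..n. l (X i \<omega>) \<theta> - risk l P \<theta>) / sqrt (real n)"

text \<open>The set \<open>A\<close> is a parameter so that it can discard large values of
  \<open>\<psi>\<close> together with the null set on which the Lipschitz bound fails. Centering by
  the truncated mean keeps the mean of each summand at 0.\<close>

definition truncated_G :: "'s set \<Rightarrow> nat \<Rightarrow> real ^ 'm \<Rightarrow> 'w \<Rightarrow> real" where
  "truncated_G A n \<theta> \<omega> =
     (\<Sum>i=1..n. indicator A (X i \<omega>) * l (X i \<omega>) \<theta> - (\<integral>x. indicator A x * l x \<theta> \<partial>P)) / sqrt (real n)"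

lemma measurable_G[measurable]: "\<theta> \<in> \<Theta> \<Longrightarrow> G n \<theta> \<in> borel_measurable M"
  unfolding G_def by (intro borel_measurable_divide borel_measurable_sum borel_measurable_diff
      measurable_compose[OF measurable_X measurable_l_P]) auto

lemma integrable_indicator_l: "\<theta> \<in> \<Theta> \<Longrightarrow> A \<in> sets P \<Longrightarrow> integrable P (\<lambda>x. indicator A x * l x \<theta>)"
  using integrable_mult_indicator[OF _ integrable_l] by simp

lemma measurable_truncated_G:
  assumes "\<theta> \<in> \<Theta>" "A \<in> sets P"
  shows "truncated_G A n \<theta> \<in> borel_measurable M"
proof -
  have "(\<lambda>x. indicator A x * l x \<theta>) \<in> borel_measurable P"
    using assms by measurable
  from measurable_compose[OF measurable_X this] show ?thesis
    unfolding truncated_G_def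
    by (intro borel_measurable_divide borel_measurable_sum borel_measurable_diff) auto
qed

text \<open>Serves with three sets: the whole space for the risk, the truncation set for path
  continuity of \<open>truncated_G\<close>, and its complement for the change of centering.\<close>

lemma indicator_integral_lipschitz:
  assumes "s \<in> \<Theta>" "t \<in> \<Theta>" and A[measurable]: "A \<in> sets P"
  shows "\<bar>(\<integral>x. indicator A x * l x s \<partial>P) - (\<integral>x. indicator A x * l x t \<partial>P)\<bar>
    \<le> (\<integral>x. indicator A x * \<psi> x \<partial>P) * dist s t"
proof -
  have i: "integrable P (\<lambda>x. indicator A x * l x \<theta>)" if "\<theta> \<in> \<Theta>" for \<theta>
    using integrable_indicator_l[OF that A] .
  have "\<bar>(\<integral>x. indicator A x * l x s \<partial>P) - (\<integral>x. indicator A x * l x t \<partial>P)\<bar> =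
      \<bar>\<integral>x. indicator A x * l x s - indicator A x * l x t \<partial>P\<bar>"
    using i assms by simp
  also have "\<dots> \<le> (\<integral>x. \<bar>indicator A x * l x s - indicator A x * l x t\<bar> \<partial>P)"
    by (rule integral_abs_bound)
  also have "\<dots> \<le> (\<integral>x. indicator A x * \<psi> x * dist s t \<partial>P)"
  proof (rule integral_mono_AE)
    show "integrable P (\<lambda>x. indicator A x * \<psi> x * dist s t)"
      using integrable_mult_indicator[OF A integrable_psi] by simp
    show "AE x in P. \<bar>indicator A x * l x s - indicator A x * l x t\<bar> \<le> indicator A x * \<psi> x * dist s t"
      using lipschitz by eventually_elim (use assms in \<open>auto simp: indicator_def dist_norm\<close>)
  qed (use i assms in auto)
  finally show ?thesis by simp
qed

lemma risk_lipschitz: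
  assumes "s \<in> \<Theta>" "t \<in> \<Theta>"
  shows "\<bar>risk l P s - risk l P t\<bar> \<le> (\<integral>x. \<psi> x \<partial>P) * dist s t"
proof -
  have "(\<integral>x. indicator (space P) x * h x \<partial>P) = (\<integral>x. h x \<partial>P)" for h :: "'s \<Rightarrow> real"
    by (intro Bochner_Integration.integral_cong) auto
  then show ?thesis
    using indicator_integral_lipschitz[OF assms sets.top] unfolding risk_def by simp
qed

lemma lipschitz_bound_imp_continuous:
  fixes h :: "real ^ 'm \<Rightarrow> real"
  assumes "\<And>s t. s \<in> \<Theta> \<Longrightarrow> t \<in> \<Theta> \<Longrightarrow> \<bar>h s - h t\<bar> \<le> K * dist s t"
  shows "continuous_on \<Theta> h"
proof -
  have "\<bar>K\<bar>-lipschitz_on \<Theta> h"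
  proof (rule lipschitz_onI)
    fix s t assume "s \<in> \<Theta>" "t \<in> \<Theta>"
    then have "dist (h s) (h t) \<le> K * dist s t" using assms by (simp add: dist_real_def)
    also have "\<dots> \<le> \<bar>K\<bar> * dist s t" by (intro mult_right_mono) auto
    finally show "dist (h s) (h t) \<le> \<bar>K\<bar> * dist s t" .
  qed simp
  then show ?thesis by (rule lipschitz_on_continuous_on)
qed

lemma continuous_risk: "continuous_on \<Theta> (risk l P)"
  by (rule lipschitz_bound_imp_continuous[OF risk_lipschitz])

lemma continuous_G: "\<omega> \<in> space M \<Longrightarrow> continuous_on \<Theta> (\<lambda>\<theta>. G n \<theta> \<omega>)"
  unfolding G_def by (cases "n = 0")
    (auto intro!: continuous_intros continuous_risk l_cont_parameter X_in_S)

lemma continuous_truncated_G: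
  assumes "\<omega> \<in> space M" "A \<in> sets P"
  shows "continuous_on \<Theta> (\<lambda>\<theta>. truncated_G A n \<theta> \<omega>)"
proof -
  have "continuous_on \<Theta> (\<lambda>\<theta>. \<integral>x. indicator A x * l x \<theta> \<partial>P)"
    by (rule lipschitz_bound_imp_continuous[OF indicator_integral_lipschitz]) (use assms in auto)
  then show ?thesis
    unfolding truncated_G_def using assms
    by (cases "n = 0") (auto intro!: continuous_intros l_cont_parameter X_in_S)
qed

text \<open>Divided by \<open>d\<close>, the loss increments on \<open>A\<close> are dominated by
  \<open>\<psi>\<close>, hence by \<open>sqrt n\<close>, and their second moment by that of
  \<open>\<psi>\<close>, whatever the pair \<open>s\<close>, \<open>t\<close>. The threshold becomes
  \<open>a / d\<close>; the factor 2 counts the two signs.\<close>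

lemma truncated_tail:
  assumes A: "A \<in> sets P" and n: "n \<ge> 1" and st: "s \<in> \<Theta>" "t \<in> \<Theta>" "dist s t \<le> d" and d: "d > 0"
    and lip: "\<And>x. x \<in> A \<Longrightarrow> \<bar>l x s - l x t\<bar> \<le> \<psi> x * dist s t"
    and cut: "\<And>x. x \<in> A \<Longrightarrow> \<psi> x \<le> sqrt (real n)"
  shows "prob {\<omega>\<in>space M. a \<le> \<bar>truncated_G A n s \<omega> - truncated_G A n t \<omega>\<bar>}
    \<le> 2 * exp (exp 2 * (\<integral>x. (\<psi> x)\<^sup>2 \<partial>P)) * exp (- a / d)"
proof -
  note [measurable] = A measurable_truncated_G[OF st(1) A] measurable_truncated_G[OF st(2) A]
  have AS: "A \<subseteq> S" using sets.sets_into_space[OF A] space_P by simp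
  define w where "w x = indicator A x * (l x s - l x t) / d" for x
  have [measurable]: "w \<in> borel_measurable P" unfolding w_def using st by measurable
  have w: "\<bar>w x\<bar> \<le> indicator A x * \<psi> x" for x
  proof (cases "x \<in> A")
    case True
    have "\<bar>l x s - l x t\<bar> \<le> \<psi> x * d"
      using lip[OF True] st(3) \<psi>(2)[of x] True AS by (auto intro: order_trans mult_left_mono)
    then show ?thesis using True d by (simp add: w_def pos_divide_le_eq)
  qed (simp add: w_def)
  have wn: "\<bar>w x\<bar> \<le> sqrt (real n)" for x
    using w[of x] cut[of x] by (cases "x \<in> A") (auto intro: order_trans)
  have iw: "integrable P w"
    by (rule P.integrable_const_bound[of _ "sqrt (real n)"]) (use wn in auto)
  define m where "m = (\<integral>x. w x \<partial>P)"
  have m: "\<bar>m\<bar> \<le> sqrt (real n)"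
  proof -
    have "\<bar>m\<bar> \<le> (\<integral>x. \<bar>w x\<bar> \<partial>P)" unfolding m_def by (rule integral_abs_bound)
    also have "\<dots> \<le> (\<integral>x. sqrt (real n) \<partial>P)"
      by (intro integral_mono) (use iw wn in auto)
    finally show ?thesis by (simp add: P.prob_space)
  qed
  have w2: "integrable P (\<lambda>x. (w x)\<^sup>2)" and Ew2: "(\<integral>x. (w x)\<^sup>2 \<partial>P) \<le> (\<integral>x. (\<psi> x)\<^sup>2 \<partial>P)"
  proof -
    have le: "(w x)\<^sup>2 \<le> (\<psi> x)\<^sup>2" if "x \<in> space P" for x
    proof (rule abs_le_square_iff[THEN iffD1])
      show "\<bar>w x\<bar> \<le> \<bar>\<psi> x\<bar>"
        using w[of x] by (cases "x \<in> A") auto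
    qed
    show i: "integrable P (\<lambda>x. (w x)\<^sup>2)"
      by (rule Bochner_Integration.integrable_bound[OF \<psi>(3)]) (use le in auto)
    show "(\<integral>x. (w x)\<^sup>2 \<partial>P) \<le> (\<integral>x. (\<psi> x)\<^sup>2 \<partial>P)"
      by (rule integral_mono[OF i \<psi>(3) le])
  qed
  define u where "u x = w x - m" for x
  have um[measurable]: "u \<in> borel_measurable P" unfolding u_def by measurable
  have Eu: "(\<integral>x. u x \<partial>P) = 0" unfolding u_def using iw by (simp add: m_def P.prob_space)
  have bu: "\<bar>u x\<bar> \<le> 2 * sqrt (real n)" for x using wn[of x] m unfolding u_def by linarith
  have Eu2: "(\<integral>x. (u x)\<^sup>2 \<partial>P) \<le> (\<integral>x. (\<psi> x)\<^sup>2 \<partial>P)"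
  proof -
    have "(\<integral>x. (u x)\<^sup>2 \<partial>P) = (\<integral>x. (w x)\<^sup>2 \<partial>P) - m\<^sup>2"
      using P.variance_eq[OF iw w2] unfolding u_def m_def by simp
    then show ?thesis using Ew2 zero_le_power2[of m] by linarith
  qed
  \<comment> \<open>The factor \<open>c\<close> is later 1 or \<open>- 1\<close>, for the upper and
    the lower tail.\<close>
  have ind: "indep_vars (\<lambda>_. borel) (\<lambda>i \<omega>. c * u (X i \<omega>)) {1..n}" for c :: real
    by (rule indep_vars_compose2[OF indep_vars_subset[OF indep_X]]) auto
  have tail: "prob {\<omega>\<in>space M. a / d \<le> (\<Sum>i=1..n. c * u (X i \<omega>)) / sqrt (real n)}
      \<le> exp (exp 2 * (\<integral>x. (\<psi> x)\<^sup>2 \<partial>P) - a / d)" if c: "\<bar>c\<bar> = 1" for c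
  proof (rule bounded_sum_tail[OF n ind])
    have cc: "c * c = 1" using c by (metis abs_mult_self_eq mult_1)
    fix i assume i: "i \<in> {1..n}"
    show "expectation (\<lambda>\<omega>. c * u (X i \<omega>)) = 0"
      using expectation_X[of i u] i Eu by simp
    show "expectation (\<lambda>\<omega>. (c * u (X i \<omega>))\<^sup>2) \<le> (\<integral>x. (\<psi> x)\<^sup>2 \<partial>P)"
      using expectation_X[of i "\<lambda>x. (u x)\<^sup>2"] i Eu2 cc
      by (simp add: power_mult_distrib power2_eq_square[of c])
    show "\<bar>c * u (X i \<omega>)\<bar> \<le> 2 * sqrt (real n)" for \<omega>
      using bu[of "X i \<omega>"] c by (simp add: abs_mult)
  qed (auto intro: Bochner_Integration.integral_nonneg)
  have md: "m * d = (\<integral>x. indicator A x * l x s \<partial>P) - (\<integral>x. indicator A x * l x t \<partial>P)"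
  proof -
    have "m * d = (\<integral>x. indicator A x * l x s - indicator A x * l x t \<partial>P)"
      unfolding m_def w_def using d by (simp add: right_diff_distrib)
    then show ?thesis using integrable_indicator_l[OF _ A] st by simp
  qed
  have diff: "truncated_G A n s \<omega> - truncated_G A n t \<omega> = d * ((\<Sum>i=1..n. u (X i \<omega>)) / sqrt (real n))" for \<omega>
  proof -
    have dw: "d * w x = indicator A x * l x s - indicator A x * l x t" for x
      using d unfolding w_def by (simp only: right_diff_distrib) simp
    have "truncated_G A n s \<omega> - truncated_G A n t \<omega> = (\<Sum>i=1..n. d * u (X i \<omega>)) / sqrt (real n)"
      unfolding truncated_G_def diff_divide_distrib[symmetric] sum_subtractf[symmetric]
      by (intro arg_cong2[where f = "(/)"] sum.cong refl)
         (simp add: u_def right_diff_distrib dw md mult.commute[of d m])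
    then show ?thesis by (simp add: sum_distrib_left)
  qed
  let ?E = "\<lambda>c. {\<omega>\<in>space M. a / d \<le> (\<Sum>i=1..n. c * u (X i \<omega>)) / sqrt (real n)}"
  have Em: "?E c \<in> sets M" for c by measurable
  have "{\<omega>\<in>space M. a \<le> \<bar>truncated_G A n s \<omega> - truncated_G A n t \<omega>\<bar>} \<subseteq> ?E 1 \<union> ?E (- 1)"
    using d by (auto simp: diff abs_mult pos_divide_le_eq sum_negf abs_le_iff mult.commute abs_if split: if_splits)
  then have "prob {\<omega>\<in>space M. a \<le> \<bar>truncated_G A n s \<omega> - truncated_G A n t \<omega>\<bar>} \<le> prob (?E 1 \<union> ?E (- 1))"
    by (intro finite_measure_mono) (use Em in auto)
  also have "\<dots> \<le> prob (?E 1) + prob (?E (- 1))" by (rule measure_Un_le) (use Em in auto)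
  also have "\<dots> \<le> 2 * exp (exp 2 * (\<integral>x. (\<psi> x)\<^sup>2 \<partial>P) - a / d)"
    using tail[of 1] tail[of "- 1"] by simp
  finally show ?thesis by (simp add: exp_add[symmetric] mult.assoc)
qed

section \<open>Removal of the truncation\<close>

lemma measure_X: "i \<ge> 1 \<Longrightarrow> A \<in> sets P \<Longrightarrow> prob {\<omega>\<in>space M. X i \<omega> \<in> A} = measure P A"
  using measure_distr[OF measurable_X, of i A] distr_X[of i] by (simp add: vimage_def Int_def conj_commute)

text \<open>
  Truncating at \<open>\<psi> \<le> sqrt n\<close> costs little because \<open>n * P (\<psi> > sqrt n)\<close> is at most the integral
  of \<open>\<psi>\<^sup>2\<close> over \<open>\<psi> > sqrt n\<close>, and changes the centering by a Lipschitz function of \<open>\<theta>\<close> only.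
\<close>

lemma truncation_tendsto:
  "(\<lambda>n. \<integral>x. indicator {x. \<psi> x > sqrt (real n)} x * (\<psi> x)\<^sup>2 \<partial>P) \<longlonglongrightarrow> 0"
proof -
  have "(\<lambda>n. \<integral>x. indicator {x. \<psi> x > sqrt (real n)} x * (\<psi> x)\<^sup>2 \<partial>P) \<longlonglongrightarrow> (\<integral>x. 0 \<partial>P)"
  proof (rule integral_dominated_convergence)
    show "integrable P (\<lambda>x. (\<psi> x)\<^sup>2)" by (rule \<psi>)
    show "(\<lambda>x. indicator {x. \<psi> x > sqrt (real n)} x * (\<psi> x)\<^sup>2) \<in> borel_measurable P" for n
      by measurable
    show "AE x in P. (\<lambda>n. indicator {x. \<psi> x > sqrt (real n)} x * (\<psi> x)\<^sup>2) \<longlonglongrightarrow> 0"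
    proof (rule AE_I2, rule tendsto_eventually)
      fix x
      obtain N :: nat where "real N \<ge> (\<psi> x)\<^sup>2" using real_arch_simple by blast
      then have "\<psi> x \<le> sqrt (real n)" if "n \<ge> N" for n
        using that by (intro real_le_rsqrt) (auto intro: order_trans)
      then show "\<forall>\<^sub>F n in sequentially. indicator {x. \<psi> x > sqrt (real n)} x * (\<psi> x)\<^sup>2 = 0"
        unfolding eventually_sequentially by (intro exI[of _ N]) (force simp: indicator_def)
    qed
  qed (auto simp: indicator_def)
  then show ?thesis by simp
qed

text \<open>Three contributions: the truncated process, whose modulus comes from chaining with a
  constant free of \<open>n\<close>; the event that some sample leaves \<open>A n\<close>; and the
  deterministic shift of the centering. The first two share the probability \<open>\<tau>\<close>,
  the first and the third the error \<open>\<epsilon>\<close>.\<close>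

lemma equicontinuous_G:
  assumes eps: "\<epsilon> > 0" and tau: "\<tau> > 0"
  shows "\<exists>\<eta>>0. \<forall>\<^sub>F n in sequentially.
    likely M \<tau> (\<lambda>\<omega>. \<forall>s\<in>\<Theta>. \<forall>t\<in>\<Theta>. dist s t \<le> \<eta> \<longrightarrow> \<bar>G n s \<omega> - G n t \<omega>\<bar> \<le> \<epsilon>)"
proof -
  define v where "v = (\<integral>x. (\<psi> x)\<^sup>2 \<partial>P)"
  have v: "v \<ge> 0" unfolding v_def by (intro Bochner_Integration.integral_nonneg) simp
  obtain B where B: "{x\<in>space P. \<not> (\<forall>\<theta>\<in>\<Theta>. \<forall>\<theta>'\<in>\<Theta>. \<bar>l x \<theta> - l x \<theta>'\<bar> \<le> \<psi> x * norm (\<theta> - \<theta>'))} \<subseteq> B"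
    "emeasure P B = 0" "B \<in> sets P"
    using lipschitz by (rule AE_E)
  define A where "A n = {x\<in>space P - B. \<psi> x \<le> sqrt (real n)}" for n :: nat
  have A[measurable]: "A n \<in> sets P" for n
  proof -
    have "A n = {x\<in>space P. \<psi> x \<le> sqrt (real n)} - B" by (auto simp: A_def)
    then show ?thesis using B(3) by auto
  qed
  have lip: "\<bar>l x s - l x t\<bar> \<le> \<psi> x * dist s t" if "x \<in> A n" "s \<in> \<Theta>" "t \<in> \<Theta>" for x s t n
    using B(1) that by (auto simp: A_def dist_norm)
  obtain \<eta>0 where \<eta>0: "\<eta>0 > 0" and chain: "\<And>Z. exponential_increments M \<Theta> (2 * exp (exp 2 * v)) Z \<Longrightarrow>
    likely M (\<tau> / 2) (\<lambda>\<omega>. \<forall>s\<in>\<Theta>. \<forall>t\<in>\<Theta>. dist s t \<le> \<eta>0 \<longrightarrow> \<bar>Z s \<omega> - Z t \<omega>\<bar> \<le> \<epsilon> / 2)"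
    using chaining[OF compact_imp_bounded[OF compact] half_gt_zero[OF eps] half_gt_zero[OF tau],
        where 'w = 'w and C = "2 * exp (exp 2 * v)"] prob_space_axioms by blast
  \<comment> \<open>The second entry controls the shift of the centering, whose Lipschitz constant
    is at most \<open>v\<close>; adding 1 prevents division by 0.\<close>
  define \<eta> where "\<eta> = min \<eta>0 (\<epsilon> / (2 * (v + 1)))"
  have \<eta>: "\<eta> > 0" "\<eta> \<le> \<eta>0" using \<eta>0 eps v by (auto simp: \<eta>_def)
  have "v * \<eta> \<le> (v + 1) * (\<epsilon> / (2 * (v + 1)))"
    using \<eta>(1) v by (intro mult_mono) (auto simp: \<eta>_def)
  also have "\<dots> = \<epsilon> / 2" using v by (simp add: field_simps)
  finally have v\<eta>: "v * \<eta> \<le> \<epsilon> / 2" .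
  have "\<forall>\<^sub>F n in sequentially. (\<integral>x. indicator {x. \<psi> x > sqrt (real n)} x * (\<psi> x)\<^sup>2 \<partial>P) < \<tau> / 2"
    using order_tendstoD(2)[OF truncation_tendsto, of "\<tau> / 2"] tau by simp
  then have "\<forall>\<^sub>F n in sequentially.
    likely M \<tau> (\<lambda>\<omega>. \<forall>s\<in>\<Theta>. \<forall>t\<in>\<Theta>. dist s t \<le> \<eta> \<longrightarrow> \<bar>G n s \<omega> - G n t \<omega>\<bar> \<le> \<epsilon>)"
    using eventually_ge_at_top[of 1]
  proof eventually_elim
    case (elim n)
    let ?I = "\<lambda>x. indicator {x. \<psi> x > sqrt (real n)} x * (\<psi> x)\<^sup>2"
    have sn: "sqrt (real n) > 0" using elim(2) by simp
    have "AE x in P. x \<notin> B" using B(2,3) by (intro AE_not_in null_setsI)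
    then have ae: "AE x in P. x \<in> A n \<or> \<psi> x > sqrt (real n)"
      using AE_space by eventually_elim (auto simp: A_def)
    have iI: "integrable P ?I"
      by (rule Bochner_Integration.integrable_bound[OF \<psi>(3)]) (auto simp: indicator_def)
    have "likely M (\<tau> / 2) (\<lambda>\<omega>. \<forall>s\<in>\<Theta>. \<forall>t\<in>\<Theta>. dist s t \<le> \<eta>0 \<longrightarrow>
        \<bar>truncated_G (A n) n s \<omega> - truncated_G (A n) n t \<omega>\<bar> \<le> \<epsilon> / 2)"
      by (rule chain, unfold exponential_increments_def v_def)
         (intro conjI ballI allI impI truncated_tail[OF A elim(2)] measurable_truncated_G
           continuous_truncated_G A; auto intro: lip simp: A_def)
    moreover have "likely M (\<tau> / 2) (\<lambda>\<omega>. \<forall>i\<in>{1..n}. X i \<omega> \<in> A n)"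
      unfolding likely_def
    proof (intro bexI[of _ "\<Union>i\<in>{1..n}. {\<omega>\<in>space M. X i \<omega> \<in> space P - A n}"] conjI)
      have ev: "{\<omega>\<in>space M. X i \<omega> \<in> space P - A n} \<in> sets M" if "i \<in> {1..n}" for i
        using that measurable_sets[OF measurable_X[of i], of "space P - A n"]
        by (auto simp: vimage_def Int_def conj_commute)
      then show "(\<Union>i\<in>{1..n}. {\<omega>\<in>space M. X i \<omega> \<in> space P - A n}) \<in> sets M"
        by (intro sets.finite_UN) auto
      have "prob (\<Union>i\<in>{1..n}. {\<omega>\<in>space M. X i \<omega> \<in> space P - A n}) \<le>
          (\<Sum>i\<in>{1..n}. prob {\<omega>\<in>space M. X i \<omega> \<in> space P - A n})"
        by (intro measure_UNION_le) (use ev in auto)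
      also have "\<dots> = (\<Sum>i\<in>{1..n}. measure P (space P - A n))"
        by (intro sum.cong refl measure_X) auto
      also have "\<dots> = (\<integral>x. real n * indicator (space P - A n) x \<partial>P)" by simp
      also have "\<dots> \<le> (\<integral>x. ?I x \<partial>P)"
      proof (rule integral_mono_AE)
        show "integrable P (\<lambda>x. real n * indicator (space P - A n) x)"
          by (intro integrable_mult_right integrable_real_indicator) (auto simp: P.emeasure_eq_measure)
        show "AE x in P. real n * indicator (space P - A n) x \<le> ?I x"
          using ae
        proof eventually_elim
          case x: (elim x)
          show ?case
          proof (cases "x \<in> A n")
            case False
            then have "sqrt (real n) < \<psi> x" using x by simp
            then have "real n \<le> (\<psi> x)\<^sup>2" by (metis less_eq_real_def real_sqrt_le_iff sqrt_le_D)
            then show ?thesis using \<open>sqrt (real n) < \<psi> x\<close> by (auto simp: indicator_def)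
          qed simp
        qed
      qed (use iI in auto)
      also have "\<dots> \<le> \<tau> / 2" using elim(1) by simp
      finally show "prob (\<Union>i\<in>{1..n}. {\<omega>\<in>space M. X i \<omega> \<in> space P - A n}) \<le> \<tau> / 2" .
      show "\<forall>\<omega>\<in>space M - (\<Union>i\<in>{1..n}. {\<omega>\<in>space M. X i \<omega> \<in> space P - A n}).
          \<forall>i\<in>{1..n}. X i \<omega> \<in> A n"
        using X_in_S space_P by auto
    qed
    ultimately have "likely M (\<tau> / 2 + \<tau> / 2) (\<lambda>\<omega>. (\<forall>s\<in>\<Theta>. \<forall>t\<in>\<Theta>. dist s t \<le> \<eta>0 \<longrightarrow>
        \<bar>truncated_G (A n) n s \<omega> - truncated_G (A n) n t \<omega>\<bar> \<le> \<epsilon> / 2) \<and> (\<forall>i\<in>{1..n}. X i \<omega> \<in> A n))"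
      by (rule likely_conj)
    then show ?case
    proof (rule likely_mono)
      fix \<omega> assume "\<omega> \<in> space M" and *: "(\<forall>s\<in>\<Theta>. \<forall>t\<in>\<Theta>. dist s t \<le> \<eta>0 \<longrightarrow>
        \<bar>truncated_G (A n) n s \<omega> - truncated_G (A n) n t \<omega>\<bar> \<le> \<epsilon> / 2) \<and> (\<forall>i\<in>{1..n}. X i \<omega> \<in> A n)"
      show "\<forall>s\<in>\<Theta>. \<forall>t\<in>\<Theta>. dist s t \<le> \<eta> \<longrightarrow> \<bar>G n s \<omega> - G n t \<omega>\<bar> \<le> \<epsilon>"
      proof (intro ballI impI)
        fix s t assume st: "s \<in> \<Theta>" "t \<in> \<Theta>" "dist s t \<le> \<eta>"
        let ?c = "\<lambda>\<theta>. \<integral>x. indicator (space P - A n) x * l x \<theta> \<partial>P"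
        \<comment> \<open>Once all samples lie in \<open>A n\<close>, the two processes differ in
          their centering only.\<close>
        have G: "G n \<theta> \<omega> = truncated_G (A n) n \<theta> \<omega> - sqrt (real n) * ?c \<theta>" if "\<theta> \<in> \<Theta>" for \<theta>
        proof -
          have "risk l P \<theta> = (\<integral>x. indicator (A n) x * l x \<theta> + indicator (space P - A n) x * l x \<theta> \<partial>P)"
            unfolding risk_def by (intro Bochner_Integration.integral_cong) (auto simp: indicator_def)
          also have "\<dots> = (\<integral>x. indicator (A n) x * l x \<theta> \<partial>P) + ?c \<theta>"
            by (intro Bochner_Integration.integral_add integrable_indicator_l that) auto
          finally have r: "risk l P \<theta> = (\<integral>x. indicator (A n) x * l x \<theta> \<partial>P) + ?c \<theta>" .
          have "(\<Sum>i=1..n. l (X i \<omega>) \<theta> - risk l P \<theta>) =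
              (\<Sum>i=1..n. (indicator (A n) (X i \<omega>) * l (X i \<omega>) \<theta> - (\<integral>x. indicator (A n) x * l x \<theta> \<partial>P)) - ?c \<theta>)"
            using * by (intro sum.cong refl) (auto simp: r)
          also have "\<dots> = (\<Sum>i=1..n. indicator (A n) (X i \<omega>) * l (X i \<omega>) \<theta> - (\<integral>x. indicator (A n) x * l x \<theta> \<partial>P))
              - real n * ?c \<theta>"
            by (simp only: sum_subtractf) simp
          finally have "G n \<theta> \<omega> = truncated_G (A n) n \<theta> \<omega> - real n / sqrt (real n) * ?c \<theta>"
            unfolding G_def truncated_G_def by (simp only: diff_divide_distrib times_divide_eq_left)
          then show ?thesis by (simp only: real_div_sqrt of_nat_0_le_iff)
        qed
        \<comment> \<open>Off \<open>A n\<close>, \<open>\<psi>\<close> exceeds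
          \<open>sqrt n\<close> almost surely, so a second factor \<open>\<psi>\<close> absorbs
          \<open>sqrt n\<close>.\<close>
        have "sqrt (real n) * (\<integral>x. indicator (space P - A n) x * \<psi> x \<partial>P) \<le> v"
        proof -
          have "sqrt (real n) * (\<integral>x. indicator (space P - A n) x * \<psi> x \<partial>P) =
              (\<integral>x. sqrt (real n) * (indicator (space P - A n) x * \<psi> x) \<partial>P)" by simp
          also have "\<dots> \<le> v" unfolding v_def
          proof (rule integral_mono_AE)
            show "integrable P (\<lambda>x. sqrt (real n) * (indicator (space P - A n) x * \<psi> x))"
              using integrable_mult_indicator[OF _ integrable_psi, of "space P - A n"] by simp
            show "AE x in P. sqrt (real n) * (indicator (space P - A n) x * \<psi> x) \<le> (\<psi> x)\<^sup>2"
              using ae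
            proof eventually_elim
              case x: (elim x)
              show ?case
              proof (cases "x \<in> A n")
                case False
                then have "sqrt (real n) < \<psi> x" using x by simp
                then have "sqrt (real n) * \<psi> x \<le> \<psi> x * \<psi> x" using sn by (intro mult_right_mono) linarith+
                then show ?thesis by (auto simp: indicator_def power2_eq_square)
              qed simp
            qed
          qed (rule \<psi>)
          finally show ?thesis .
        qed
        then have "sqrt (real n) * (\<integral>x. indicator (space P - A n) x * \<psi> x \<partial>P) * dist s t \<le> v * \<eta>"
          using st v by (intro mult_mono) auto
        then have le: "sqrt (real n) * ((\<integral>x. indicator (space P - A n) x * \<psi> x \<partial>P) * dist s t) \<le> \<epsilon> / 2"
          using v\<eta> by (simp add: mult.assoc)
        have "\<bar>sqrt (real n) * (?c s - ?c t)\<bar> \<le> \<epsilon> / 2"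
          unfolding abs_mult using sn
          by (intro order_trans[OF mult_left_mono[OF indicator_integral_lipschitz[OF st(1,2)]] order_trans[OF _ le]]) auto
        moreover have "\<bar>truncated_G (A n) n s \<omega> - truncated_G (A n) n t \<omega>\<bar> \<le> \<epsilon> / 2"
          using * st \<eta>(2) by auto
        moreover have "G n s \<omega> - G n t \<omega> = (truncated_G (A n) n s \<omega> - truncated_G (A n) n t \<omega>) - sqrt (real n) * (?c s - ?c t)"
          using G st by (simp add: right_diff_distrib)
        ultimately show "\<bar>G n s \<omega> - G n t \<omega>\<bar> \<le> \<epsilon>" by linarith
      qed
    qed simp
  qed
  with \<eta>(1) show ?thesis by blast
qed

text \<open>Mixed products have mean 0 by independence. From \<open>n = 1\<close> on there is
  equality; the inequality also admits \<open>n = 0\<close>, where \<open>G\<close> is 0, and so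
  gives a bound for all \<open>n\<close>.\<close>

lemma second_moment_G:
  assumes t: "\<theta> \<in> \<Theta>"
  shows "integrable M (\<lambda>\<omega>. (G n \<theta> \<omega>)\<^sup>2)"
    and "expectation (\<lambda>\<omega>. (G n \<theta> \<omega>)\<^sup>2) \<le> covariance P (\<lambda>x. l x \<theta>) (\<lambda>x. l x \<theta>)"
proof -
  define v where "v x = l x \<theta> - risk l P \<theta>" for x
  define c where "c = covariance P (\<lambda>x. l x \<theta>) (\<lambda>x. l x \<theta>)"
  have vm[measurable]: "v \<in> borel_measurable P" unfolding v_def using t by measurable
  have iv: "integrable P v" unfolding v_def using integrable_l[OF t] by simp
  have iv2: "integrable P (\<lambda>x. (v x)\<^sup>2)"
    unfolding v_def using integrable_l[OF t] integrable_l_square[OF t] by (simp add: power2_diff)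
  have Ev: "(\<integral>x. v x \<partial>P) = 0"
    unfolding v_def using integrable_l[OF t] by (simp add: risk_def P.prob_space)
  have Ev2: "(\<integral>x. (v x)\<^sup>2 \<partial>P) = c" by (simp add: c_def covariance_def v_def risk_def power2_eq_square)
  have c: "c \<ge> 0" unfolding Ev2[symmetric] by (intro Bochner_Integration.integral_nonneg) simp
  have ind: "indep_vars (\<lambda>_. borel) (\<lambda>i \<omega>. v (X i \<omega>)) {1..}"
    by (rule indep_vars_compose2[OF indep_X]) auto
  have Vi: "integrable M (\<lambda>\<omega>. v (X i \<omega>))" "integrable M (\<lambda>\<omega>. (v (X i \<omega>))\<^sup>2)" if "i \<ge> 1" for i
    using integrable_X[OF that iv] integrable_X[OF that iv2] by auto
  have Vm: "(\<lambda>\<omega>. v (X i \<omega>)) \<in> borel_measurable M" if "i \<ge> 1" for i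
    using measurable_compose[OF measurable_X[OF that] vm] .
  have prod: "integrable M (\<lambda>\<omega>. v (X i \<omega>) * v (X j \<omega>))" if "i \<ge> 1" "j \<ge> 1" for i j
    by (rule integrable_mult_of_squares) (use Vi Vm that in auto)
  have Eprod: "expectation (\<lambda>\<omega>. v (X i \<omega>) * v (X j \<omega>)) = (if i = j then c else 0)"
    if ij: "i \<ge> 1" "j \<ge> 1" for i j
  proof (cases "i = j")
    case True
    then show ?thesis using expectation_X[OF ij(1), of "\<lambda>x. (v x)\<^sup>2"] Ev2 by (simp add: power2_eq_square)
  next
    case False
    have "expectation (\<lambda>\<omega>. \<Prod>a\<in>{i, j}. v (X a \<omega>)) = (\<Prod>a\<in>{i, j}. expectation (\<lambda>\<omega>. v (X a \<omega>)))"
      by (rule indep_vars_lebesgue_integral[OF _ indep_vars_subset[OF ind]]) (use ij Vi in auto)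
    then show ?thesis using False expectation_X[OF ij(1) vm] Ev by simp
  qed
  have G: "(G n \<theta> \<omega>)\<^sup>2 = (\<Sum>i=1..n. \<Sum>j=1..n. v (X i \<omega>) * v (X j \<omega>)) / real n" for \<omega>
    unfolding G_def v_def[symmetric] by (simp add: power_divide power2_eq_square sum_product)
  show "integrable M (\<lambda>\<omega>. (G n \<theta> \<omega>)\<^sup>2)"
    unfolding G using prod by (intro integrable_divide_zero Bochner_Integration.integrable_sum) auto
  have "expectation (\<lambda>\<omega>. (G n \<theta> \<omega>)\<^sup>2) = (\<Sum>i=1..n. \<Sum>j=1..n. expectation (\<lambda>\<omega>. v (X i \<omega>) * v (X j \<omega>))) / real n"
  proof -
    have "expectation (\<lambda>\<omega>. \<Sum>i=1..n. \<Sum>j=1..n. v (X i \<omega>) * v (X j \<omega>)) =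
        (\<Sum>i=1..n. \<Sum>j=1..n. expectation (\<lambda>\<omega>. v (X i \<omega>) * v (X j \<omega>)))"
      using prod by (subst Bochner_Integration.integral_sum)
        (auto intro!: Bochner_Integration.integrable_sum Bochner_Integration.integral_sum sum.cong)
    then show ?thesis unfolding G by simp
  qed
  also have "\<dots> = (\<Sum>i=1..n. c) / real n"
    by (intro arg_cong2[where f = "(/)"] sum.cong refl) (simp add: Eprod)
  also have "\<dots> \<le> c" using c by simp
  finally show "expectation (\<lambda>\<omega>. (G n \<theta> \<omega>)\<^sup>2) \<le> covariance P (\<lambda>x. l x \<theta>) (\<lambda>x. l x \<theta>)"
    by (simp add: c_def)
qed

text \<open>A linear combination of coordinates of \<open>G n\<close> is itself the normalised sum
  of one centred function \<open>u\<close> of the sample, so the one-dimensional central limit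
  theorem applies. The variance of \<open>u\<close> is the quadratic form of the
  covariances.\<close>

lemma cis_G_tendsto:
  fixes k :: nat
  assumes \<theta>: "\<And>j. j < k \<Longrightarrow> \<theta> j \<in> \<Theta>"
  shows "(\<lambda>n. expectation (\<lambda>\<omega>. cis (\<Sum>j<k. t j * G n (\<theta> j) \<omega>))) \<longlonglongrightarrow>
    complex_of_real (exp (- (\<Sum>i<k. \<Sum>j<k. t i * t j * covariance P (\<lambda>x. l x (\<theta> i)) (\<lambda>x. l x (\<theta> j))) / 2))"
proof -
  define h where "h x = (\<Sum>j<k. t j * l x (\<theta> j))" for x
  define m where "m = (\<integral>x. h x \<partial>P)"
  have hm[measurable]: "h \<in> borel_measurable P" unfolding h_def using \<theta> by (intro borel_measurable_sum borel_measurable_times) auto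
  have h2: "integrable P (\<lambda>x. (h x)\<^sup>2)"
    unfolding h_def using \<theta> by (intro integrable_square_sum) (auto intro: integrable_l_square)
  have hi: "integrable P h" by (rule P.square_integrable_imp_integrable[OF hm h2])
  have m: "m = (\<Sum>j<k. t j * risk l P (\<theta> j))"
    unfolding m_def h_def risk_def using \<theta>
    by (subst Bochner_Integration.integral_sum) (auto intro: integrable_l)
  define u where "u x = h x - m" for x
  have um[measurable]: "u \<in> borel_measurable P" unfolding u_def by measurable
  have u2: "integrable P (\<lambda>x. (u x)\<^sup>2)" unfolding u_def using hi h2 by (simp add: power2_diff)
  have Eu: "(\<integral>x. u x \<partial>P) = 0" unfolding u_def using hi by (simp add: m_def P.prob_space)
  have Eu2: "(\<integral>x. (u x)\<^sup>2 \<partial>P) = (\<Sum>i<k. \<Sum>j<k. t i * t j * covariance P (\<lambda>x. l x (\<theta> i)) (\<lambda>x. l x (\<theta> j)))"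
  proof -
    have "(\<integral>x. (u x)\<^sup>2 \<partial>P) = covariance P h h"
      by (simp add: covariance_def u_def m_def power2_eq_square)
    also have "\<dots> = (\<Sum>i<k. \<Sum>j<k. t i * t j * covariance P (\<lambda>x. l x (\<theta> i)) (\<lambda>x. l x (\<theta> j)))"
      unfolding h_def[abs_def]
      by (rule covariance_sum[OF prob_space_P]) (use \<theta> in \<open>auto intro: integrable_l_square\<close>)
    finally show ?thesis .
  qed
  have ind: "indep_vars (\<lambda>_. borel) (\<lambda>i \<omega>. u (X (Suc i) \<omega>)) UNIV"
    by (rule indep_vars_compose2[OF indep_vars_Suc[OF indep_X]]) auto
  have "(\<lambda>n. \<integral>\<omega>. cis ((\<Sum>i<n. u (X (Suc i) \<omega>)) / sqrt (real n)) \<partial>M) \<longlonglongrightarrow>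
      complex_of_real (exp (- (\<integral>x. (u x)\<^sup>2 \<partial>P) / 2))"
  proof (rule iid_cis_tendsto[OF ind])
    fix i
    show "distr M borel (\<lambda>\<omega>. u (X (Suc i) \<omega>)) = distr P borel u"
      using distr_distr[OF um measurable_X[of "Suc i"]] distr_X[of "Suc i"] by (simp add: comp_def)
    show "expectation (\<lambda>\<omega>. u (X (Suc i) \<omega>)) = 0" using expectation_X[of "Suc i" u] Eu by simp
    show "integrable M (\<lambda>\<omega>. (u (X (Suc i) \<omega>))\<^sup>2)" using integrable_X[OF _ u2] by simp
    show "expectation (\<lambda>\<omega>. (u (X (Suc i) \<omega>))\<^sup>2) = (\<integral>x. (u x)\<^sup>2 \<partial>P)"
      using expectation_X[of "Suc i" "\<lambda>x. (u x)\<^sup>2"] by simp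
  qed
  moreover have "(\<Sum>i<n. u (X (Suc i) \<omega>)) / sqrt (real n) = (\<Sum>j<k. t j * G n (\<theta> j) \<omega>)" for n \<omega>
  proof -
    have "(\<Sum>i<n. u (X (Suc i) \<omega>)) = (\<Sum>i=1..n. u (X i \<omega>))"
      by (simp add: sum.atLeast1_atMost_eq)
    also have "\<dots> = (\<Sum>i=1..n. \<Sum>j<k. t j * (l (X i \<omega>) (\<theta> j) - risk l P (\<theta> j)))"
      by (simp add: u_def h_def m sum_subtractf right_diff_distrib)
    also have "\<dots> = (\<Sum>j<k. t j * (\<Sum>i=1..n. l (X i \<omega>) (\<theta> j) - risk l P (\<theta> j)))"
      by (subst sum.swap) (simp only: sum_distrib_left)
    finally show ?thesis by (simp only: G_def sum_divide_distrib[of _ "{..<k}"] times_divide_eq_right)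
  qed
  ultimately show ?thesis by (simp add: Eu2)
qed

text \<open>Equality of the covariances makes the limit in \<open>cis_G_tendsto\<close> the joint
  characteristic function of the field \<open>g\<close>; the diagonal covariances supply the uniform
  bound on second moments.\<close>

lemma finite_dimensional_convergence:
  fixes h :: "(nat \<Rightarrow> real) \<Rightarrow> real" and g :: "real ^ 'm \<Rightarrow> 'v \<Rightarrow> real"
  assumes N: "prob_space N" and g: "gaussian_field N \<Theta> g"
    and mean: "\<And>\<theta>. \<theta> \<in> \<Theta> \<Longrightarrow> (\<integral>v. g \<theta> v \<partial>N) = 0"
    and cov: "\<And>\<theta> \<theta>'. \<theta> \<in> \<Theta> \<Longrightarrow> \<theta>' \<in> \<Theta> \<Longrightarrow>
      covariance N (g \<theta>) (g \<theta>') = covariance P (\<lambda>x. l x \<theta>) (\<lambda>x. l x \<theta>')"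
    and \<theta>: "\<And>j. j < k \<Longrightarrow> \<theta> j \<in> \<Theta>"
    and h: "continuous_on UNIV h" and B: "\<And>y. \<bar>h y\<bar> \<le> B"
    and hY: "\<And>n. (\<lambda>\<omega>. h (\<lambda>j. if j < k then G n (\<theta> j) \<omega> else 0)) \<in> borel_measurable M"
    and hZ: "(\<lambda>v. h (\<lambda>j. if j < k then g (\<theta> j) v else 0)) \<in> borel_measurable N"
  shows "(\<lambda>n. expectation (\<lambda>\<omega>. h (\<lambda>j. if j < k then G n (\<theta> j) \<omega> else 0))) \<longlonglongrightarrow>
    (\<integral>v. h (\<lambda>j. if j < k then g (\<theta> j) v else 0) \<partial>N)"
proof -
  interpret N: prob_space N by fact
  define c where "c i j = covariance P (\<lambda>x. l x (\<theta> i)) (\<lambda>x. l x (\<theta> j))" for i j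
  have gm[measurable]: "g \<theta> \<in> borel_measurable N" if "\<theta> \<in> \<Theta>" for \<theta>
    using g that by (auto simp: gaussian_field_def random_field_def)
  have g_comb: "gaussian_variable N (\<lambda>v. \<Sum>j<k. t j * g (\<theta> j) v)" for t :: "nat \<Rightarrow> real"
  proof -
    \<comment> \<open>Gaussianity is stated for finite sets of parameters, while the points
      \<open>\<theta> j\<close> may coincide; coefficients of equal points are collected.\<close>
    let ?F = "\<theta> ` {..<k}" and ?c = "\<lambda>q. \<Sum>j\<in>{j\<in>{..<k}. \<theta> j = q}. t j"
    have "gaussian_variable N (\<lambda>v. \<Sum>q\<in>?F. ?c q * g q v)"
      using g[unfolded gaussian_field_def, THEN conjunct2, rule_format, of ?F ?c] \<theta> by auto
    moreover have "(\<Sum>j<k. t j * g (\<theta> j) v) = (\<Sum>q\<in>?F. ?c q * g q v)" for v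
      by (subst sum.image_gen[of "{..<k}" _ \<theta>]) (auto simp: sum_distrib_right intro!: sum.cong)
    ultimately show ?thesis by simp
  qed
  have single: "integrable N (\<lambda>v. (g (\<theta> j) v)\<^sup>2)" if j: "j < k" for j
  proof -
    have "(\<Sum>i<k. (if i = j then 1 else 0) * g (\<theta> i) v) = g (\<theta> j) v" for v
      using j by (simp add: if_distrib[of "\<lambda>x. x * _"] cong: if_cong)
    then have "gaussian_variable N (g (\<theta> j))" using g_comb[of "\<lambda>i. if i = j then 1 else 0"] by simp
    then show ?thesis using gaussian_variable_zero_mean(1)[OF N _ mean] \<theta>[OF j] by blast
  qed
  have g_int: "integrable N (g (\<theta> j))" if "j < k" for j
    using N.square_integrable_imp_integrable[OF gm single] \<theta> that by blast
  have g_mean: "(\<integral>v. (\<Sum>j<k. t j * g (\<theta> j) v) \<partial>N) = 0" for t :: "nat \<Rightarrow> real"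
    using g_int mean \<theta> by (subst Bochner_Integration.integral_sum) auto
  have g_sq: "(\<integral>v. (\<Sum>j<k. t j * g (\<theta> j) v)\<^sup>2 \<partial>N) = (\<Sum>i<k. \<Sum>j<k. t i * t j * c i j)" for t :: "nat \<Rightarrow> real"
  proof -
    have "(\<integral>v. (\<Sum>j<k. t j * g (\<theta> j) v)\<^sup>2 \<partial>N) =
        covariance N (\<lambda>v. \<Sum>j<k. t j * g (\<theta> j) v) (\<lambda>v. \<Sum>j<k. t j * g (\<theta> j) v)"
      by (simp add: covariance_def g_mean power2_eq_square)
    also have "\<dots> = (\<Sum>i<k. \<Sum>j<k. t i * t j * covariance N (g (\<theta> i)) (g (\<theta> j)))"
      by (rule covariance_sum[OF N]) (use \<theta> single in auto)
    also have "\<dots> = (\<Sum>i<k. \<Sum>j<k. t i * t j * c i j)"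
      using cov \<theta> by (simp add: c_def)
    finally show ?thesis .
  qed
  have c0: "c j j \<ge> 0" for j
    unfolding c_def covariance_def by (intro Bochner_Integration.integral_nonneg) simp
  have cV: "c j j \<le> (\<Sum>j<k. c j j)" if "j < k" for j
    by (rule member_le_sum) (use that c0 in auto)
  have g_var: "(\<integral>v. (g (\<theta> j) v)\<^sup>2 \<partial>N) = c j j" if "j < k" for j
    using cov[of "\<theta> j" "\<theta> j"] \<theta>[OF that] mean by (simp add: covariance_def c_def power2_eq_square)
  show ?thesis
  proof (rule multivariate_convergence[OF prob_space_axioms N _ _ _ _ _ h B hY hZ])
    fix t :: "nat \<Rightarrow> real"
    show "(\<lambda>n. expectation (\<lambda>\<omega>. cis (\<Sum>j<k. t j * G n (\<theta> j) \<omega>))) \<longlonglongrightarrow>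
        (\<integral>v. cis (\<Sum>j<k. t j * g (\<theta> j) v) \<partial>N)"
      using cis_G_tendsto[of k \<theta> t] \<theta>
      by (simp add: gaussian_variable_zero_mean(2)[OF N g_comb g_mean] g_sq c_def)
  next
    fix n j assume j: "j < k"
    show "integrable M (\<lambda>\<omega>. (G n (\<theta> j) \<omega>)\<^sup>2) \<and> expectation (\<lambda>\<omega>. (G n (\<theta> j) \<omega>)\<^sup>2) \<le> (\<Sum>j<k. c j j)"
      using second_moment_G[OF \<theta>[OF j], of n] cV[OF j] by (auto simp: c_def)
  next
    fix j assume j: "j < k"
    show "integrable N (\<lambda>v. (g (\<theta> j) v)\<^sup>2) \<and> (\<integral>v. (g (\<theta> j) v)\<^sup>2 \<partial>N) \<le> (\<Sum>j<k. c j j)"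
      using single[OF j] cV[OF j] g_var[OF j] by simp
  qed (use \<theta> in auto)
qed

section \<open>Asymptotics of the robust value\<close>

text \<open>Chebyshev's inequality bounds the process on a finite net, and equicontinuity carries
  the bound to the rest of \<open>\<Theta>\<close> at the cost of 1.\<close>

lemma bounded_G:
  assumes tau: "\<tau> > 0"
  shows "\<exists>b\<ge>0. \<forall>\<^sub>F n in sequentially. likely M \<tau> (\<lambda>\<omega>. \<forall>\<theta>\<in>\<Theta>. \<bar>G n \<theta> \<omega>\<bar> \<le> b)"
proof -
  obtain \<eta> where \<eta>: "\<eta> > 0" and equi: "\<forall>\<^sub>F n in sequentially.
    likely M (\<tau> / 2) (\<lambda>\<omega>. \<forall>s\<in>\<Theta>. \<forall>t\<in>\<Theta>. dist s t \<le> \<eta> \<longrightarrow> \<bar>G n s \<omega> - G n t \<omega>\<bar> \<le> 1)"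
    using equicontinuous_G[of 1 "\<tau> / 2"] tau by auto
  obtain q :: "nat \<Rightarrow> real ^ 'm" where q: "range q \<subseteq> \<Theta>"
    and dense: "\<forall>\<eta>>0. \<exists>k0. \<forall>\<theta>\<in>\<Theta>. \<exists>j\<le>k0. dist \<theta> (q j) < \<eta>"
    using dense_sequence[OF compact] \<theta>bar(1) by blast
  obtain k where k: "\<And>\<theta>. \<theta> \<in> \<Theta> \<Longrightarrow> \<exists>j\<le>k. dist \<theta> (q j) < \<eta>" using dense[rule_format, OF \<eta>] by blast
  define c where "c j = covariance P (\<lambda>x. l x (q j)) (\<lambda>x. l x (q j))" for j
  define V where "V = (\<Sum>j\<le>k. c j)"
  have c0: "c j \<ge> 0" for j
    unfolding c_def covariance_def by (intro Bochner_Integration.integral_nonneg) simp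
  have V0: "V \<ge> 0" unfolding V_def by (intro sum_nonneg c0)
  \<comment> \<open>Chebyshev gives probability at most \<open>V / K\<^sup>2\<close> over the net,
    here at most \<open>\<tau> / 2\<close>; the summand 1 keeps \<open>K\<close> positive.\<close>
  define K where "K = sqrt (2 * (V + 1) / \<tau>)"
  have K: "K > 0" "K\<^sup>2 = 2 * (V + 1) / \<tau>" using V0 tau by (auto simp: K_def)
  have qT: "q j \<in> \<Theta>" for j using q by auto
  have net: "likely M (\<tau> / 2) (\<lambda>\<omega>. \<forall>j\<le>k. \<bar>G n (q j) \<omega>\<bar> \<le> K)" for n
    unfolding likely_def
  proof (intro bexI[of _ "\<Union>j\<in>{..k}. {\<omega>\<in>space M. K\<^sup>2 \<le> (G n (q j) \<omega>)\<^sup>2}"] conjI)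
    have [measurable]: "G n (q j) \<in> borel_measurable M" for j by (rule measurable_G[OF qT])
    have m: "{\<omega>\<in>space M. K\<^sup>2 \<le> (G n (q j) \<omega>)\<^sup>2} \<in> sets M" for j by measurable
    then show "(\<Union>j\<in>{..k}. {\<omega>\<in>space M. K\<^sup>2 \<le> (G n (q j) \<omega>)\<^sup>2}) \<in> sets M" by auto
    have "prob (\<Union>j\<in>{..k}. {\<omega>\<in>space M. K\<^sup>2 \<le> (G n (q j) \<omega>)\<^sup>2})
        \<le> (\<Sum>j\<in>{..k}. prob {\<omega>\<in>space M. K\<^sup>2 \<le> (G n (q j) \<omega>)\<^sup>2})"
      by (intro measure_UNION_le) (use m in auto)
    also have "\<dots> \<le> (\<Sum>j\<in>{..k}. c j / K\<^sup>2)"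
    proof (rule sum_mono)
      fix j
      have "prob {\<omega>\<in>space M. K\<^sup>2 \<le> (G n (q j) \<omega>)\<^sup>2} \<le> expectation (\<lambda>\<omega>. (G n (q j) \<omega>)\<^sup>2) / K\<^sup>2"
        by (rule integral_Markov_inequality_measure[OF second_moment_G(1)[OF qT] sets.empty_sets])
           (use K(1) in auto)
      also have "\<dots> \<le> c j / K\<^sup>2"
        unfolding c_def by (intro divide_right_mono second_moment_G(2)[OF qT]) simp
      finally show "prob {\<omega>\<in>space M. K\<^sup>2 \<le> (G n (q j) \<omega>)\<^sup>2} \<le> c j / K\<^sup>2" .
    qed
    also have "\<dots> = V / K\<^sup>2" by (simp add: V_def sum_divide_distrib)
    also have "\<dots> \<le> \<tau> / 2" using V0 tau unfolding K(2) by (simp add: field_simps)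
    finally show "prob (\<Union>j\<in>{..k}. {\<omega>\<in>space M. K\<^sup>2 \<le> (G n (q j) \<omega>)\<^sup>2}) \<le> \<tau> / 2" .
    show "\<forall>\<omega>\<in>space M - (\<Union>j\<in>{..k}. {\<omega>\<in>space M. K\<^sup>2 \<le> (G n (q j) \<omega>)\<^sup>2}). \<forall>j\<le>k. \<bar>G n (q j) \<omega>\<bar> \<le> K"
    proof (intro ballI allI impI)
      fix \<omega> j assume "\<omega> \<in> space M - (\<Union>j\<in>{..k}. {\<omega>\<in>space M. K\<^sup>2 \<le> (G n (q j) \<omega>)\<^sup>2})" "j \<le> k"
      then have "(G n (q j) \<omega>)\<^sup>2 < K\<^sup>2" by (auto simp: not_le)
      then have "\<bar>G n (q j) \<omega>\<bar> \<le> \<bar>K\<bar>" by (simp add: abs_le_square_iff)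
      then show "\<bar>G n (q j) \<omega>\<bar> \<le> K" using K(1) by simp
    qed
  qed
  have "\<forall>\<^sub>F n in sequentially. likely M \<tau> (\<lambda>\<omega>. \<forall>\<theta>\<in>\<Theta>. \<bar>G n \<theta> \<omega>\<bar> \<le> K + 1)"
    using equi
  proof eventually_elim
    case (elim n)
    show ?case
    proof (rule likely_mono[OF likely_conj[OF elim net[of n]]])
      fix \<omega> assume *: "(\<forall>s\<in>\<Theta>. \<forall>t\<in>\<Theta>. dist s t \<le> \<eta> \<longrightarrow> \<bar>G n s \<omega> - G n t \<omega>\<bar> \<le> 1) \<and>
        (\<forall>j\<le>k. \<bar>G n (q j) \<omega>\<bar> \<le> K)"
      show "\<forall>\<theta>\<in>\<Theta>. \<bar>G n \<theta> \<omega>\<bar> \<le> K + 1"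
      proof
        fix \<theta> assume \<theta>: "\<theta> \<in> \<Theta>"
        then obtain j where j: "j \<le> k" "dist \<theta> (q j) < \<eta>" using k by blast
        then have "\<bar>G n \<theta> \<omega> - G n (q j) \<omega>\<bar> \<le> 1" "\<bar>G n (q j) \<omega>\<bar> \<le> K" using * \<theta> qT by auto
        then show "\<bar>G n \<theta> \<omega>\<bar> \<le> K + 1" by linarith
      qed
    qed simp
  qed
  then show ?thesis using K(1) by (intro exI[of _ "K + 1"]) auto
qed

text \<open>An explicit sum for \<open>f n\<close>, so that measurability and path continuity are
  visible without the empirical measure; both versions agree on \<open>\<Theta>\<close> for
  \<open>n \<ge> 1\<close>.\<close>

definition sample_risk :: "nat \<Rightarrow> real ^ 'm \<Rightarrow> 'w \<Rightarrow> real" where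
  "sample_risk n \<theta> \<omega> = (\<Sum>i=1..n. l (X i \<omega>) \<theta>) / real n"

lemma sample_risk_eq: "n \<ge> 1 \<Longrightarrow> sample_risk n \<theta> \<omega> = risk l P \<theta> + G n \<theta> \<omega> / sqrt (real n)"
  unfolding sample_risk_def G_def by (simp add: sum_subtractf diff_divide_distrib)

lemma sample_risk_empirical:
  assumes "n \<ge> 1" "\<omega> \<in> space M" "\<theta> \<in> \<Theta>"
  shows "risk l (empirical_measure S X n \<omega>) \<theta> = sample_risk n \<theta> \<omega>"
  unfolding sample_risk_def
  by (rule risk_empirical_measure) (use assms X_in_S measurable_l in auto)

lemma measurable_sample_risk: "\<theta> \<in> \<Theta> \<Longrightarrow> sample_risk n \<theta> \<in> borel_measurable M"
  unfolding sample_risk_def by (intro borel_measurable_divide borel_measurable_sum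
      measurable_compose[OF measurable_X measurable_l_P]) auto

lemma continuous_sample_risk: "\<omega> \<in> space M \<Longrightarrow> continuous_on \<Theta> (\<lambda>\<theta>. sample_risk n \<theta> \<omega>)"
  unfolding sample_risk_def by (cases "n = 0")
    (auto intro!: continuous_intros l_cont_parameter X_in_S)

abbreviation optimum :: real where "optimum \<equiv> optimal_value \<Theta> (risk l P)"

lemma optimum_le: "\<theta> \<in> \<Theta> \<Longrightarrow> optimum \<le> risk l P \<theta>"
  unfolding optimal_value_def
  by (rule cINF_lower[OF bdd_below_continuous_image[OF compact continuous_risk]])

text \<open>The minimisers as a zero set, the shape required by the penalty argument and by
  compactness.\<close>

lemma optimal_set_eq: "optimal_set \<Theta> (risk l P) = {\<theta>\<in>\<Theta>. risk l P \<theta> - optimum = 0}"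
proof (intro equalityI subsetI)
  fix \<theta> assume "\<theta> \<in> optimal_set \<Theta> (risk l P)"
  then have \<theta>: "\<theta> \<in> \<Theta>" "\<And>t. t \<in> \<Theta> \<Longrightarrow> risk l P \<theta> \<le> risk l P t"
    by (auto simp: optimal_set_def is_arg_min_linorder)
  then have "risk l P \<theta> \<le> optimum" unfolding optimal_value_def by (intro cINF_greatest) auto
  then show "\<theta> \<in> {\<theta>\<in>\<Theta>. risk l P \<theta> - optimum = 0}" using optimum_le[OF \<theta>(1)] \<theta>(1) by simp
next
  fix \<theta> assume "\<theta> \<in> {\<theta>\<in>\<Theta>. risk l P \<theta> - optimum = 0}"
  then show "\<theta> \<in> optimal_set \<Theta> (risk l P)"
    using optimum_le by (auto simp: optimal_set_def is_arg_min_linorder)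
qed

lemma compact_optimal_set: "compact (optimal_set \<Theta> (risk l P))"
proof -
  have "continuous_on \<Theta> (\<lambda>\<theta>. risk l P \<theta> - optimum)"
    by (intro continuous_intros continuous_risk)
  from continuous_closed_preimage[OF this compact_imp_closed[OF compact] closed_singleton[of 0]]
  have "closed {\<theta>\<in>\<Theta>. risk l P \<theta> - optimum \<in> {0}}"
    by (simp add: vimage_def Int_def)
  then have "compact (\<Theta> \<inter> {\<theta>\<in>\<Theta>. risk l P \<theta> - optimum \<in> {0}})"
    by (rule compact_Int_closed[OF compact])
  then show ?thesis unfolding optimal_set_eq by (simp add: Int_def)
qed

lemma optimal_set_nonempty: "optimal_set \<Theta> (risk l P) \<noteq> {}"
proof -
  obtain \<theta> where "\<theta> \<in> \<Theta>" "\<forall>t\<in>\<Theta>. risk l P \<theta> \<le> risk l P t"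
    using continuous_attains_inf[OF compact _ continuous_risk] \<theta>bar(1) by blast
  then show ?thesis by (auto simp: optimal_set_def is_arg_min_linorder)
qed

lemma optimal_set_subset: "optimal_set \<Theta> (risk l P) \<subseteq> \<Theta>"
  by (auto simp: optimal_set_eq)

text \<open>Scaling \<open>sample_risk n \<theta> \<omega> + c n * \<rho> \<theta> - optimum\<close>
  by \<open>a n\<close> gives a penalty \<open>a n * A \<theta>\<close> plus multiples of
  \<open>G n\<close> and \<open>\<rho>\<close>. Boundedness of these two allows their factors to be
  replaced by the limits \<open>\<alpha>\<close> and \<open>\<beta>\<close>, and the diverging
  penalty confines the infimum to the minimisers. The ambiguity sets are hidden in
  \<open>r n\<close>, of which only closeness to an infimum is used.\<close>

lemma scaled_value_close:
  fixes \<alpha> \<beta> :: real and r :: "nat \<Rightarrow> 'w \<Rightarrow> real"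
  assumes \<rho>: "continuous_on \<Theta> \<rho>"
    and a: "filterlim a at_top sequentially" and a\<alpha>: "(\<lambda>n. a n / sqrt (real n)) \<longlonglongrightarrow> \<alpha>"
    and c\<beta>: "(\<lambda>n. a n * c n) \<longlonglongrightarrow> \<beta>"
    and r: "\<And>\<epsilon> \<tau>. \<epsilon> > 0 \<Longrightarrow> \<tau> > 0 \<Longrightarrow> \<forall>\<^sub>F n in sequentially. likely M \<tau>
      (\<lambda>\<omega>. \<bar>r n \<omega> - (INF \<theta>\<in>\<Theta>. sample_risk n \<theta> \<omega> + c n * \<rho> \<theta>)\<bar> \<le> c n * \<epsilon>)"
    and eps: "\<epsilon> > 0" and tau: "\<tau> > 0"
  shows "\<forall>\<^sub>F n in sequentially. likely M \<tau> (\<lambda>\<omega>. \<bar>a n * (r n \<omega> - optimum) -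
    (INF \<theta>\<in>optimal_set \<Theta> (risk l P). \<alpha> * G n \<theta> \<omega> + \<beta> * \<rho> \<theta>)\<bar> \<le> \<epsilon>)"
proof -
  define A where "A \<theta> = risk l P \<theta> - optimum" for \<theta>
  have A0: "A \<theta> \<ge> 0" if "\<theta> \<in> \<Theta>" for \<theta> using optimum_le[OF that] by (simp add: A_def)
  have Acont: "continuous_on \<Theta> A" unfolding A_def by (intro continuous_intros continuous_risk)
  let ?Z = "optimal_set \<Theta> (risk l P)"
  have Z: "?Z = {\<theta>\<in>\<Theta>. A \<theta> = 0}" unfolding optimal_set_eq A_def ..
  have ne: "\<Theta> \<noteq> {}" using \<theta>bar(1) by auto
  obtain \<rho>b where \<rho>b: "\<rho>b \<ge> 0" "\<And>\<theta>. \<theta> \<in> \<Theta> \<Longrightarrow> \<bar>\<rho> \<theta>\<bar> \<le> \<rho>b"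
  proof -
    obtain B where B: "\<And>\<theta>. \<theta> \<in> \<Theta> \<Longrightarrow> \<bar>\<rho> \<theta>\<bar> \<le> B"
      using compact_imp_bounded[OF compact_continuous_image[OF \<rho> compact]] by (auto simp: bounded_iff)
    then show thesis using that[of "\<bar>B\<bar>"] by (meson abs_ge_self abs_ge_zero order_trans)
  qed
  obtain b where b: "b \<ge> 0" "\<forall>\<^sub>F n in sequentially. likely M (\<tau> / 3) (\<lambda>\<omega>. \<forall>\<theta>\<in>\<Theta>. \<bar>G n \<theta> \<omega>\<bar> \<le> b)"
    using bounded_G[of "\<tau> / 3"] tau by auto
  \<comment> \<open>\<open>e1\<close> and \<open>e2\<close> each contribute
    \<open>\<epsilon> / 8\<close> to the oscillation of \<open>H\<close>. The 1 in their
    denominators admits the factors 0 of regimes (a) and (c).\<close>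
  define e1 where "e1 = \<epsilon> / (8 * (\<bar>\<alpha>\<bar> + 1))"
  have e1: "e1 > 0" "\<bar>\<alpha>\<bar> * e1 \<le> \<epsilon> / 8" using eps by (auto simp: e1_def field_simps)
  obtain \<eta>1 where \<eta>1: "\<eta>1 > 0" and equi: "\<forall>\<^sub>F n in sequentially.
    likely M (\<tau> / 3) (\<lambda>\<omega>. \<forall>s\<in>\<Theta>. \<forall>t\<in>\<Theta>. dist s t \<le> \<eta>1 \<longrightarrow> \<bar>G n s \<omega> - G n t \<omega>\<bar> \<le> e1)"
    using equicontinuous_G[OF e1(1), of "\<tau> / 3"] tau by auto
  define e2 where "e2 = \<epsilon> / (8 * (\<bar>\<beta>\<bar> + 1))"
  have e2: "e2 > 0" "\<bar>\<beta>\<bar> * e2 \<le> \<epsilon> / 8" using eps by (auto simp: e2_def field_simps)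
  obtain \<eta>2 where \<eta>2: "\<eta>2 > 0" "\<And>s t. s \<in> \<Theta> \<Longrightarrow> t \<in> \<Theta> \<Longrightarrow> dist t s < \<eta>2 \<Longrightarrow> dist (\<rho> t) (\<rho> s) < e2"
    using compact_uniformly_continuous[OF \<rho> compact] e2(1) unfolding uniformly_continuous_on_def by blast
  define \<eta> where "\<eta> = min \<eta>1 (\<eta>2 / 2)"
  have \<eta>: "\<eta> > 0" "\<eta> \<le> \<eta>1" "\<eta> < \<eta>2" using \<eta>1 \<eta>2(1) by (auto simp: \<eta>_def)
  obtain \<kappa> where \<kappa>: "\<kappa> > 0" "\<And>\<theta>. \<theta> \<in> \<Theta> \<Longrightarrow> A \<theta> < \<kappa> \<Longrightarrow> \<exists>z\<in>?Z. dist \<theta> z < \<eta>"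
    using near_zero_set[OF compact Acont A0 \<eta>(1)] unfolding Z by blast
  define bH where "bH = \<bar>\<alpha>\<bar> * b + \<bar>\<beta>\<bar> * \<rho>b"
  \<comment> \<open>\<open>a n * c n\<close> is eventually below
    \<open>\<bar>\<beta>\<bar> + 1\<close>, so an error \<open>c n * e3\<close> in
    \<open>r n\<close> becomes at most \<open>\<epsilon> / 4\<close> after scaling.\<close>
  define e3 where "e3 = \<epsilon> / (4 * (\<bar>\<beta>\<bar> + 1))"
  have e3: "e3 > 0" "(\<bar>\<beta>\<bar> + 1) * e3 = \<epsilon> / 4" using eps by (auto simp: e3_def field_simps)
  have "\<forall>\<^sub>F n in sequentially. a n \<ge> max 1 (2 * bH / \<kappa>)"
    using a unfolding filterlim_at_top by blast
  moreover have "\<forall>\<^sub>F n in sequentially. \<bar>a n / sqrt (real n) - \<alpha>\<bar> * b + \<bar>a n * c n - \<beta>\<bar> * \<rho>b < \<epsilon> / 4"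
  proof (rule order_tendstoD(2))
    have "(\<lambda>n. \<bar>a n / sqrt (real n) - \<alpha>\<bar> * b + \<bar>a n * c n - \<beta>\<bar> * \<rho>b) \<longlonglongrightarrow> \<bar>\<alpha> - \<alpha>\<bar> * b + \<bar>\<beta> - \<beta>\<bar> * \<rho>b"
      by (intro tendsto_intros a\<alpha> c\<beta>)
    then show "(\<lambda>n. \<bar>a n / sqrt (real n) - \<alpha>\<bar> * b + \<bar>a n * c n - \<beta>\<bar> * \<rho>b) \<longlonglongrightarrow> 0" by simp
  qed (use eps in simp)
  moreover have "\<forall>\<^sub>F n in sequentially. a n * c n < \<bar>\<beta>\<bar> + 1"
    by (rule order_tendstoD(2)[OF c\<beta>]) simp
  moreover have "\<forall>\<^sub>F n in sequentially. likely M (\<tau> / 3)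
      (\<lambda>\<omega>. \<bar>r n \<omega> - (INF \<theta>\<in>\<Theta>. sample_risk n \<theta> \<omega> + c n * \<rho> \<theta>)\<bar> \<le> c n * e3)"
    by (rule r) (use e3 tau in auto)
  ultimately show ?thesis using b(2) equi eventually_ge_at_top[of 1]
  proof eventually_elim
    case (elim n)
    \<comment> \<open>Positivity is for the affine rescaling of the infimum; the second bound lets
      the penalty exceed the oscillation of \<open>H\<close>.\<close>
    have an: "a n > 0" "2 * bH \<le> a n * \<kappa>" using elim(1) \<kappa>(1) by (auto simp: field_simps)
    have n: "n \<ge> 1" by fact
    show ?case
    proof (rule likely_mono[OF likely_conj[OF likely_conj[OF elim(4) elim(5)] elim(6)]])
      fix \<omega> assume \<omega>: "\<omega> \<in> space M" and "(\<bar>r n \<omega> - (INF \<theta>\<in>\<Theta>. sample_risk n \<theta> \<omega> + c n * \<rho> \<theta>)\<bar> \<le> c n * e3 \<and>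
        (\<forall>\<theta>\<in>\<Theta>. \<bar>G n \<theta> \<omega>\<bar> \<le> b)) \<and>
        (\<forall>s\<in>\<Theta>. \<forall>t\<in>\<Theta>. dist s t \<le> \<eta>1 \<longrightarrow> \<bar>G n s \<omega> - G n t \<omega>\<bar> \<le> e1)"
      then have r': "\<bar>r n \<omega> - (INF \<theta>\<in>\<Theta>. sample_risk n \<theta> \<omega> + c n * \<rho> \<theta>)\<bar> \<le> c n * e3"
        and Gb: "\<And>\<theta>. \<theta> \<in> \<Theta> \<Longrightarrow> \<bar>G n \<theta> \<omega>\<bar> \<le> b"
        and Ge: "\<And>s t. s \<in> \<Theta> \<Longrightarrow> t \<in> \<Theta> \<Longrightarrow> dist s t \<le> \<eta>1 \<Longrightarrow> \<bar>G n s \<omega> - G n t \<omega>\<bar> \<le> e1" by auto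
      define u where "u \<theta> = sample_risk n \<theta> \<omega> + c n * \<rho> \<theta>" for \<theta>
      define H where "H \<theta> = \<alpha> * G n \<theta> \<omega> + \<beta> * \<rho> \<theta>" for \<theta>
      have ucont: "continuous_on \<Theta> u" unfolding u_def
        by (intro continuous_intros continuous_sample_risk \<omega> \<rho>)
      have ubdd: "bdd_below (u ` \<Theta>)" by (rule bdd_below_continuous_image[OF compact ucont])
      have Hb: "\<bar>H \<theta>\<bar> \<le> bH" if "\<theta> \<in> \<Theta>" for \<theta>
      proof -
        have "\<bar>H \<theta>\<bar> \<le> \<bar>\<alpha>\<bar> * \<bar>G n \<theta> \<omega>\<bar> + \<bar>\<beta>\<bar> * \<bar>\<rho> \<theta>\<bar>"
          unfolding H_def by (rule abs_bilinear_le)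
        also have "\<dots> \<le> bH" unfolding bH_def
          by (intro add_mono mult_left_mono Gb \<rho>b that) auto
        finally show ?thesis .
      qed
      have Hmod: "\<bar>H s - H t\<bar> \<le> \<epsilon> / 4" if st: "s \<in> \<Theta>" "t \<in> \<Theta>" "dist s t \<le> \<eta>" for s t
      proof -
        have "H s - H t = \<alpha> * (G n s \<omega> - G n t \<omega>) + \<beta> * (\<rho> s - \<rho> t)"
          by (simp add: H_def algebra_simps)
        then have "\<bar>H s - H t\<bar> \<le> \<bar>\<alpha>\<bar> * \<bar>G n s \<omega> - G n t \<omega>\<bar> + \<bar>\<beta>\<bar> * \<bar>\<rho> s - \<rho> t\<bar>"
          by (simp only: abs_bilinear_le)
        also have "\<dots> \<le> \<bar>\<alpha>\<bar> * e1 + \<bar>\<beta>\<bar> * e2"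
        proof (intro add_mono mult_left_mono)
          show "\<bar>G n s \<omega> - G n t \<omega>\<bar> \<le> e1" using Ge[OF st(1,2)] st(3) \<eta>(2) by simp
          show "\<bar>\<rho> s - \<rho> t\<bar> \<le> e2" using \<eta>2(2)[OF st(2,1)] st(3) \<eta>(3) by (simp add: dist_real_def)
        qed auto
        finally show ?thesis using e1(2) e2(2) by linarith
      qed
      have Hbdd: "bdd_below ((\<lambda>\<theta>. a n * A \<theta> + H \<theta>) ` \<Theta>)"
        unfolding H_def by (intro bdd_below_continuous_image[OF compact] continuous_intros Acont \<rho> continuous_G \<omega>)
      have 1: "\<bar>(INF \<theta>\<in>\<Theta>. a n * A \<theta> + H \<theta>) - (INF \<theta>\<in>?Z. H \<theta>)\<bar> \<le> \<epsilon> / 4"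
        by (rule penalized_INF[OF optimal_set_nonempty optimal_set_subset _ \<kappa>(2) A0 Hb _ an(2) Hmod])
           (use Z an eps in auto)
      have "\<bar>(INF \<theta>\<in>\<Theta>. a n * A \<theta> + H \<theta>) - (INF \<theta>\<in>\<Theta>. a n * (u \<theta> - optimum))\<bar> \<le> \<epsilon> / 4"
      proof (rule INF_perturbation(2)[OF ne Hbdd])
        fix \<theta> assume \<theta>: "\<theta> \<in> \<Theta>"
        have "a n * A \<theta> + H \<theta> - a n * (u \<theta> - optimum) =
            - ((a n / sqrt (real n) - \<alpha>) * G n \<theta> \<omega> + (a n * c n - \<beta>) * \<rho> \<theta>)"
          by (simp add: A_def H_def u_def sample_risk_eq[OF n] algebra_simps)
        then have "\<bar>a n * A \<theta> + H \<theta> - a n * (u \<theta> - optimum)\<bar> \<le>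
            \<bar>a n / sqrt (real n) - \<alpha>\<bar> * \<bar>G n \<theta> \<omega>\<bar> + \<bar>a n * c n - \<beta>\<bar> * \<bar>\<rho> \<theta>\<bar>"
          by (simp only: abs_minus_cancel abs_bilinear_le)
        also have "\<dots> \<le> \<bar>a n / sqrt (real n) - \<alpha>\<bar> * b + \<bar>a n * c n - \<beta>\<bar> * \<rho>b"
          by (intro add_mono mult_left_mono Gb \<rho>b \<theta>) auto
        finally show "\<bar>a n * A \<theta> + H \<theta> - a n * (u \<theta> - optimum)\<bar> \<le> \<epsilon> / 4" using elim(2) by linarith
      qed
      then have 2: "\<bar>(INF \<theta>\<in>\<Theta>. a n * A \<theta> + H \<theta>) - a n * ((INF \<theta>\<in>\<Theta>. u \<theta>) - optimum)\<bar> \<le> \<epsilon> / 4"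
        unfolding INF_affine[OF ne ubdd an(1)] .
      have "a n * \<bar>r n \<omega> - (INF \<theta>\<in>\<Theta>. u \<theta>)\<bar> \<le> a n * (c n * e3)"
        using r' an(1) unfolding u_def by (intro mult_left_mono) auto
      also have "\<dots> = (a n * c n) * e3" by simp
      also have "\<dots> \<le> (\<bar>\<beta>\<bar> + 1) * e3" using elim(3) e3(1) by (intro mult_right_mono) auto
      finally have "\<bar>a n * (r n \<omega> - (INF \<theta>\<in>\<Theta>. u \<theta>))\<bar> \<le> \<epsilon> / 4" using e3(2) an(1) by (simp add: abs_mult)
      moreover have "a n * (r n \<omega> - optimum) = a n * (r n \<omega> - (INF \<theta>\<in>\<Theta>. u \<theta>)) + a n * ((INF \<theta>\<in>\<Theta>. u \<theta>) - optimum)"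
        by (simp add: algebra_simps)
      ultimately have "\<bar>a n * (r n \<omega> - optimum) - (INF \<theta>\<in>?Z. H \<theta>)\<bar> \<le> \<epsilon>"
        using 1 2 eps by linarith
      then show "\<bar>a n * (r n \<omega> - optimum) - (INF \<theta>\<in>?Z. \<alpha> * G n \<theta> \<omega> + \<beta> * \<rho> \<theta>)\<bar> \<le> \<epsilon>"
        unfolding H_def .
    qed simp
  qed
qed

text \<open>Infima over initial segments of a dense sequence of minimisers link the two sides:
  equicontinuity makes them accurate for \<open>G n\<close>, path continuity for \<open>g\<close>,
  and for fixed \<open>k\<close> only finitely many coordinates have to converge.\<close>

lemma scaled_value_weak_conv:
  fixes \<alpha> \<beta> :: real and r :: "nat \<Rightarrow> 'w \<Rightarrow> real" and g :: "real ^ 'm \<Rightarrow> 'v \<Rightarrow> real"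
  assumes N: "prob_space N" and g: "gaussian_field N \<Theta> g"
    and mean: "\<And>\<theta>. \<theta> \<in> \<Theta> \<Longrightarrow> (\<integral>v. g \<theta> v \<partial>N) = 0"
    and cov: "\<And>\<theta> \<theta>'. \<theta> \<in> \<Theta> \<Longrightarrow> \<theta>' \<in> \<Theta> \<Longrightarrow>
      covariance N (g \<theta>) (g \<theta>') = covariance P (\<lambda>x. l x \<theta>) (\<lambda>x. l x \<theta>')"
    and g_cont: "\<And>v. v \<in> space N \<Longrightarrow> continuous_on \<Theta> (\<lambda>\<theta>. g \<theta> v)"
    and \<rho>: "continuous_on \<Theta> \<rho>"
    and a: "filterlim a at_top sequentially" and a\<alpha>: "(\<lambda>n. a n / sqrt (real n)) \<longlonglongrightarrow> \<alpha>"
    and c\<beta>: "(\<lambda>n. a n * c n) \<longlonglongrightarrow> \<beta>"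
    and rm: "\<And>n. r n \<in> borel_measurable M"
    and r: "\<And>\<epsilon> \<tau>. \<epsilon> > 0 \<Longrightarrow> \<tau> > 0 \<Longrightarrow> \<forall>\<^sub>F n in sequentially. likely M \<tau>
      (\<lambda>\<omega>. \<bar>r n \<omega> - (INF \<theta>\<in>\<Theta>. sample_risk n \<theta> \<omega> + c n * \<rho> \<theta>)\<bar> \<le> c n * \<epsilon>)"
  shows "converges_in_distribution M (\<lambda>n \<omega>. a n * (r n \<omega> - optimum))
    N (\<lambda>v. INF \<theta>\<in>optimal_set \<Theta> (risk l P). \<alpha> * g \<theta> v + \<beta> * \<rho> \<theta>)"
proof -
  let ?Z = "optimal_set \<Theta> (risk l P)"
  note ZT = subsetD[OF optimal_set_subset]
  have gm: "g \<theta> \<in> borel_measurable N" if "\<theta> \<in> \<Theta>" for \<theta>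
    using g that by (auto simp: gaussian_field_def random_field_def)
  obtain q :: "nat \<Rightarrow> real ^ 'm" where q: "range q \<subseteq> ?Z"
    and dense: "\<And>\<eta>. \<eta> > 0 \<Longrightarrow> \<exists>k0. \<forall>\<theta>\<in>?Z. \<exists>j\<le>k0. dist \<theta> (q j) < \<eta>"
    using dense_sequence[OF compact_optimal_set optimal_set_nonempty] by blast
  have qT: "q j \<in> \<Theta>" for j using q ZT by blast
  have rm': "(\<lambda>\<omega>. a n * (r n \<omega> - optimum)) \<in> borel_measurable M" for n
    using rm[of n] by measurable
  have Zm: "(\<lambda>v. INF \<theta>\<in>?Z. \<alpha> * g \<theta> v + \<beta> * \<rho> \<theta>) \<in> borel_measurable N"
  proof (rule borel_measurable_INF_continuous[OF compact_optimal_set optimal_set_nonempty])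
    show "(\<lambda>v. \<alpha> * g \<theta> v + \<beta> * \<rho> \<theta>) \<in> borel_measurable N" if "\<theta> \<in> ?Z" for \<theta>
      using gm[OF ZT[OF that]] by measurable
    show "continuous_on ?Z (\<lambda>\<theta>. \<alpha> * g \<theta> v + \<beta> * \<rho> \<theta>)" if "v \<in> space N" for v
      using g_cont[OF that] \<rho>
      by (intro continuous_intros) (auto intro: continuous_on_subset[OF _ optimal_set_subset])
  qed
  have "weak_conv_m (\<lambda>n. distr M borel (\<lambda>\<omega>. a n * (r n \<omega> - optimum)))
      (distr N borel (\<lambda>v. INF \<theta>\<in>?Z. \<alpha> * g \<theta> v + \<beta> * \<rho> \<theta>))"
  proof (rule weak_conv_approx[OF prob_space_axioms N rm' _ Zm,
        where W = "\<lambda>k n \<omega>. INF j\<in>{..k}. \<alpha> * G n (q j) \<omega> + \<beta> * \<rho> (q j)"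
        and Y = "\<lambda>k v. INF j\<in>{..k}. \<alpha> * g (q j) v + \<beta> * \<rho> (q j)"])
    show WM: "(\<lambda>\<omega>. INF j\<in>{..k}. \<alpha> * G n (q j) \<omega> + \<beta> * \<rho> (q j)) \<in> borel_measurable M" for k n
      by (intro borel_measurable_cINF_real borel_measurable_add borel_measurable_times measurable_G qT) auto
    show YM: "(\<lambda>v. INF j\<in>{..k}. \<alpha> * g (q j) v + \<beta> * \<rho> (q j)) \<in> borel_measurable N" for k
      by (intro borel_measurable_cINF_real borel_measurable_add borel_measurable_times gm qT) auto
    show "(\<lambda>k. INF j\<in>{..k}. \<alpha> * g (q j) v + \<beta> * \<rho> (q j)) \<longlonglongrightarrow> (INF \<theta>\<in>?Z. \<alpha> * g \<theta> v + \<beta> * \<rho> \<theta>)"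
      if "v \<in> space N" for v
      using g_cont[OF that] \<rho>
      by (intro INF_dense_sequence_tendsto[OF compact_optimal_set optimal_set_nonempty _ q dense] continuous_intros)
         (auto intro: continuous_on_subset[OF _ optimal_set_subset])
    show "(\<lambda>n. expectation (\<lambda>\<omega>. cts_step x y (INF j\<in>{..k}. \<alpha> * G n (q j) \<omega> + \<beta> * \<rho> (q j)))) \<longlonglongrightarrow>
        (\<integral>v. cts_step x y (INF j\<in>{..k}. \<alpha> * g (q j) v + \<beta> * \<rho> (q j)) \<partial>N)" if xy: "x < y" for k x y
    proof -
      \<comment> \<open>A continuous function of the coordinates in \<open>{..k}\<close>, which is
        why the convergence below runs over \<open>Suc k\<close> of them.\<close>
      define h where "h z = cts_step x y (INF j\<in>{..k}. \<alpha> * z j + \<beta> * \<rho> (q j))" for z :: "nat \<Rightarrow> real"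
      have ctsc: "continuous_on UNIV (cts_step x y)"
        by (intro uniformly_continuous_imp_continuous cts_step_uniformly_continuous xy)
      have hc: "continuous_on UNIV h"
        unfolding h_def by (rule continuous_on_compose2[OF ctsc])
          (auto intro!: continuous_on_INF_atMost continuous_intros)
      have ctsm: "cts_step x y \<in> borel_measurable borel"
        by (rule borel_measurable_continuous_onI[OF ctsc])
      have cut: "h (\<lambda>j. if j < Suc k then z j else 0) = cts_step x y (INF j\<in>{..k}. \<alpha> * z j + \<beta> * \<rho> (q j))" for z
        unfolding h_def by (intro arg_cong[where f = "cts_step x y"] INF_cong refl) auto
      have "(\<lambda>n. expectation (\<lambda>\<omega>. h (\<lambda>j. if j < Suc k then G n (q j) \<omega> else 0))) \<longlonglongrightarrow>
          (\<integral>v. h (\<lambda>j. if j < Suc k then g (q j) v else 0) \<partial>N)"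
      proof (rule finite_dimensional_convergence[OF N g mean cov qT hc])
        show "\<bar>h z\<bar> \<le> 1" for z using cts_step_bounds[OF xy] by (simp add: h_def)
        show "(\<lambda>\<omega>. h (\<lambda>j. if j < Suc k then G n (q j) \<omega> else 0)) \<in> borel_measurable M" for n
          unfolding cut by (rule measurable_compose[OF WM ctsm])
        show "(\<lambda>v. h (\<lambda>j. if j < Suc k then g (q j) v else 0)) \<in> borel_measurable N"
          unfolding cut by (rule measurable_compose[OF YM ctsm])
      qed
      then show ?thesis unfolding cut .
    qed
    fix \<epsilon> \<tau> :: real assume eps: "\<epsilon> > 0" and tau: "\<tau> > 0"
    \<comment> \<open>Half of \<open>\<epsilon>\<close> is spent on
      \<open>scaled_value_close\<close>; the passage to the net takes the other half, split between
      \<open>G n\<close> and \<open>\<rho>\<close>.\<close>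
    define e1 where "e1 = \<epsilon> / (4 * (\<bar>\<alpha>\<bar> + 1))"
    have e1: "e1 > 0" "\<bar>\<alpha>\<bar> * e1 \<le> \<epsilon> / 4" using eps by (auto simp: e1_def field_simps)
    define e2 where "e2 = \<epsilon> / (4 * (\<bar>\<beta>\<bar> + 1))"
    have e2: "e2 > 0" "\<bar>\<beta>\<bar> * e2 \<le> \<epsilon> / 4" using eps by (auto simp: e2_def field_simps)
    obtain \<eta>1 where \<eta>1: "\<eta>1 > 0" and equi: "\<forall>\<^sub>F n in sequentially.
      likely M (\<tau> / 2) (\<lambda>\<omega>. \<forall>s\<in>\<Theta>. \<forall>t\<in>\<Theta>. dist s t \<le> \<eta>1 \<longrightarrow> \<bar>G n s \<omega> - G n t \<omega>\<bar> \<le> e1)"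
      using equicontinuous_G[OF e1(1), of "\<tau> / 2"] tau by auto
    obtain \<eta>2 where \<eta>2: "\<eta>2 > 0" "\<And>s t. s \<in> \<Theta> \<Longrightarrow> t \<in> \<Theta> \<Longrightarrow> dist t s < \<eta>2 \<Longrightarrow> dist (\<rho> t) (\<rho> s) < e2"
      using compact_uniformly_continuous[OF \<rho> compact] e2(1) unfolding uniformly_continuous_on_def by blast
    define \<eta> where "\<eta> = min \<eta>1 (\<eta>2 / 2)"
    have \<eta>: "\<eta> > 0" "\<eta> \<le> \<eta>1" "\<eta> < \<eta>2" using \<eta>1 \<eta>2(1) by (auto simp: \<eta>_def)
    obtain k0 where k0: "\<And>\<theta>. \<theta> \<in> ?Z \<Longrightarrow> \<exists>j\<le>k0. dist \<theta> (q j) < \<eta>" using dense[OF \<eta>(1)] by blast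
    have close: "\<forall>\<^sub>F n in sequentially. likely M (\<tau> / 2) (\<lambda>\<omega>. \<bar>a n * (r n \<omega> - optimum) -
        (INF \<theta>\<in>?Z. \<alpha> * G n \<theta> \<omega> + \<beta> * \<rho> \<theta>)\<bar> \<le> \<epsilon> / 2)"
      by (rule scaled_value_close[OF \<rho> a a\<alpha> c\<beta> r]) (use eps tau in auto)
    show "\<exists>k0. \<forall>k\<ge>k0. \<forall>\<^sub>F n in sequentially. likely M \<tau> (\<lambda>\<omega>. \<bar>a n * (r n \<omega> - optimum) -
        (INF j\<in>{..k}. \<alpha> * G n (q j) \<omega> + \<beta> * \<rho> (q j))\<bar> \<le> \<epsilon>)"
    proof (rule exI[of _ k0], intro allI impI)
      fix k assume k: "k \<ge> k0"
      show "\<forall>\<^sub>F n in sequentially. likely M \<tau> (\<lambda>\<omega>. \<bar>a n * (r n \<omega> - optimum) -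
        (INF j\<in>{..k}. \<alpha> * G n (q j) \<omega> + \<beta> * \<rho> (q j))\<bar> \<le> \<epsilon>)"
        using close equi
      proof eventually_elim
        case (elim n)
        show ?case
        proof (rule likely_mono[OF likely_conj[OF elim]])
          fix \<omega> assume \<omega>: "\<omega> \<in> space M" and *: "\<bar>a n * (r n \<omega> - optimum) -
              (INF \<theta>\<in>?Z. \<alpha> * G n \<theta> \<omega> + \<beta> * \<rho> \<theta>)\<bar> \<le> \<epsilon> / 2 \<and>
            (\<forall>s\<in>\<Theta>. \<forall>t\<in>\<Theta>. dist s t \<le> \<eta>1 \<longrightarrow> \<bar>G n s \<omega> - G n t \<omega>\<bar> \<le> e1)"
          define H where "H \<theta> = \<alpha> * G n \<theta> \<omega> + \<beta> * \<rho> \<theta>" for \<theta>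
          have Hbdd: "bdd_below (H ` ?Z)"
            unfolding H_def using continuous_G[OF \<omega>] \<rho>
            by (intro bdd_below_continuous_image[OF compact_optimal_set] continuous_intros)
               (auto intro: continuous_on_subset[OF _ optimal_set_subset])
          have "\<bar>(INF \<theta>\<in>?Z. H \<theta>) - (INF j\<in>{..k}. H (q j))\<bar> \<le> \<epsilon> / 2"
          proof (rule INF_net[OF optimal_set_nonempty q Hbdd])
            show "\<exists>j\<le>k. dist \<theta> (q j) < \<eta>" if "\<theta> \<in> ?Z" for \<theta> using k0[OF that] k by (meson order_trans)
            fix s t assume Zst: "s \<in> ?Z" "t \<in> ?Z" and d: "dist s t \<le> \<eta>"
            note st = ZT[OF Zst(1)] ZT[OF Zst(2)]
            have "H s - H t = \<alpha> * (G n s \<omega> - G n t \<omega>) + \<beta> * (\<rho> s - \<rho> t)"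
              by (simp add: H_def algebra_simps)
            then have "\<bar>H s - H t\<bar> \<le> \<bar>\<alpha>\<bar> * \<bar>G n s \<omega> - G n t \<omega>\<bar> + \<bar>\<beta>\<bar> * \<bar>\<rho> s - \<rho> t\<bar>"
              by (simp only: abs_bilinear_le)
            also have "\<dots> \<le> \<bar>\<alpha>\<bar> * e1 + \<bar>\<beta>\<bar> * e2"
            proof (intro add_mono mult_left_mono)
              show "\<bar>G n s \<omega> - G n t \<omega>\<bar> \<le> e1" using * st d \<eta>(2) by auto
              show "\<bar>\<rho> s - \<rho> t\<bar> \<le> e2" using \<eta>2(2)[OF st(2,1)] d \<eta>(3) by (simp add: dist_real_def)
            qed auto
            finally show "\<bar>H s - H t\<bar> \<le> \<epsilon> / 2" using e1(2) e2(2) by linarith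
          qed
          then show "\<bar>a n * (r n \<omega> - optimum) - (INF j\<in>{..k}. \<alpha> * G n (q j) \<omega> + \<beta> * \<rho> (q j))\<bar> \<le> \<epsilon>"
            using * unfolding H_def by linarith
        qed simp
      qed
    qed
  qed
  then show ?thesis using rm' Zm by (simp add: converges_in_distribution_def)
qed

text \<open>Uniform errors pass to the infimum undiminished but not enlarged. A real witness
  \<open>r\<close> is part of the claim because the robust value is extended real and its finiteness
  follows from the expansion, hence only outside the exceptional event.\<close>

lemma robust_value_close:
  assumes \<rho>: "continuous_on \<Theta> \<rho>" and c: "\<And>n. c n \<ge> 0"
    and expansion: "\<And>n. n \<ge> 1 \<Longrightarrow> AE \<omega> in M. \<forall>\<theta>\<in>\<Theta>. worst_case_risk S D l (empirical_measure S X n \<omega>) (\<delta> n) \<theta> =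
      ereal (risk l (empirical_measure S X n \<omega>) \<theta> + c n * R n \<theta> \<omega> + c n * \<epsilon> n \<theta> \<omega>)"
    and R: "\<And>n. n \<ge> 1 \<Longrightarrow> AE \<omega> in M. \<forall>\<theta>\<in>\<Theta>. R n \<theta> \<omega> = \<rho> \<theta> + \<epsilon>' n \<theta> \<omega>"
    and \<epsilon>: "small_o_p M (\<lambda>n \<omega>. SUP \<theta>\<in>\<Theta>. ereal \<bar>\<epsilon> n \<theta> \<omega>\<bar>) 0"
    and \<epsilon>': "small_o_p M (\<lambda>n \<omega>. SUP \<theta>\<in>\<Theta>. ereal \<bar>\<epsilon>' n \<theta> \<omega>\<bar>) 0"
    and e: "e > 0" and tau: "\<tau> > 0"
  shows "\<forall>\<^sub>F n in sequentially. likely M \<tau> (\<lambda>\<omega>.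
    \<exists>r. robust_value S D l \<Theta> (empirical_measure S X n \<omega>) (\<delta> n) = ereal r \<and>
      \<bar>r - (INF \<theta>\<in>\<Theta>. sample_risk n \<theta> \<omega> + c n * \<rho> \<theta>)\<bar> \<le> c n * e)"
proof -
  have sup: "\<bar>f \<theta>\<bar> \<le> e / 2" if "\<bar>SUP \<theta>\<in>\<Theta>. ereal \<bar>f \<theta>\<bar>\<bar> \<le> ereal (e / 2)" "\<theta> \<in> \<Theta>" for f :: "real ^ 'm \<Rightarrow> real" and \<theta>
  proof -
    have "ereal \<bar>f \<theta>\<bar> \<le> (SUP \<theta>\<in>\<Theta>. ereal \<bar>f \<theta>\<bar>)" using that(2) by (rule SUP_upper)
    also have "\<dots> \<le> \<bar>SUP \<theta>\<in>\<Theta>. ereal \<bar>f \<theta>\<bar>\<bar>" by (cases "SUP \<theta>\<in>\<Theta>. ereal \<bar>f \<theta>\<bar>") auto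
    finally have "ereal \<bar>f \<theta>\<bar> \<le> ereal (e / 2)" using that(1) by (rule order_trans)
    then show ?thesis by simp
  qed
  \<comment> \<open>Four exceptional events share \<open>\<tau>\<close>: one for each almost sure
    expansion and one for each remainder. The two remainders share \<open>e\<close>.\<close>
  have "e / 2 > 0" "\<tau> / 4 > 0" using e tau by auto
  from small_o_p_likely[OF prob_space_axioms \<epsilon> this] small_o_p_likely[OF prob_space_axioms \<epsilon>' this]
    eventually_ge_at_top[of 1]
  show ?thesis
  proof eventually_elim
    case (elim n)
    have "likely M (\<tau> / 4) (\<lambda>\<omega>. \<forall>\<theta>\<in>\<Theta>. worst_case_risk S D l (empirical_measure S X n \<omega>) (\<delta> n) \<theta> =
        ereal (risk l (empirical_measure S X n \<omega>) \<theta> + c n * R n \<theta> \<omega> + c n * \<epsilon> n \<theta> \<omega>))"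
      using expansion[OF elim(3)] tau by (intro likely_AE) auto
    moreover have "likely M (\<tau> / 4) (\<lambda>\<omega>. \<forall>\<theta>\<in>\<Theta>. R n \<theta> \<omega> = \<rho> \<theta> + \<epsilon>' n \<theta> \<omega>)"
      using R[OF elim(3)] tau by (intro likely_AE) auto
    ultimately have "likely M (\<tau> / 4 + \<tau> / 4) (\<lambda>\<omega>. (\<forall>\<theta>\<in>\<Theta>.
        worst_case_risk S D l (empirical_measure S X n \<omega>) (\<delta> n) \<theta> =
        ereal (risk l (empirical_measure S X n \<omega>) \<theta> + c n * R n \<theta> \<omega> + c n * \<epsilon> n \<theta> \<omega>)) \<and>
        (\<forall>\<theta>\<in>\<Theta>. R n \<theta> \<omega> = \<rho> \<theta> + \<epsilon>' n \<theta> \<omega>))" by (rule likely_conj)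
    from likely_conj[OF this likely_conj[OF elim(1,2)]] show ?case
    proof (rule likely_mono)
      fix \<omega> assume \<omega>: "\<omega> \<in> space M" and *: "((\<forall>\<theta>\<in>\<Theta>.
        worst_case_risk S D l (empirical_measure S X n \<omega>) (\<delta> n) \<theta> =
        ereal (risk l (empirical_measure S X n \<omega>) \<theta> + c n * R n \<theta> \<omega> + c n * \<epsilon> n \<theta> \<omega>)) \<and>
        (\<forall>\<theta>\<in>\<Theta>. R n \<theta> \<omega> = \<rho> \<theta> + \<epsilon>' n \<theta> \<omega>)) \<and>
        \<bar>SUP \<theta>\<in>\<Theta>. ereal \<bar>\<epsilon> n \<theta> \<omega>\<bar>\<bar> \<le> ereal (e / 2) \<and> \<bar>SUP \<theta>\<in>\<Theta>. ereal \<bar>\<epsilon>' n \<theta> \<omega>\<bar>\<bar> \<le> ereal (e / 2)"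
      define w where "w \<theta> = sample_risk n \<theta> \<omega> + c n * R n \<theta> \<omega> + c n * \<epsilon> n \<theta> \<omega>" for \<theta>
      have ne: "\<Theta> \<noteq> {}" using \<theta>bar(1) by auto
      have bdd: "bdd_below ((\<lambda>\<theta>. sample_risk n \<theta> \<omega> + c n * \<rho> \<theta>) ` \<Theta>)"
        by (intro bdd_below_continuous_image[OF compact] continuous_intros continuous_sample_risk \<omega> \<rho>)
      have le: "\<bar>(sample_risk n \<theta> \<omega> + c n * \<rho> \<theta>) - w \<theta>\<bar> \<le> c n * e" if \<theta>: "\<theta> \<in> \<Theta>" for \<theta>
      proof -
        have "(sample_risk n \<theta> \<omega> + c n * \<rho> \<theta>) - w \<theta> = - (c n * (\<epsilon>' n \<theta> \<omega> + \<epsilon> n \<theta> \<omega>))"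
          using * \<theta> by (simp add: w_def algebra_simps)
        moreover have "\<bar>\<epsilon>' n \<theta> \<omega> + \<epsilon> n \<theta> \<omega>\<bar> \<le> e"
          using sup[of "\<lambda>\<theta>. \<epsilon> n \<theta> \<omega>", OF _ \<theta>] sup[of "\<lambda>\<theta>. \<epsilon>' n \<theta> \<omega>", OF _ \<theta>] * by linarith
        ultimately show ?thesis using c[of n] by (simp add: abs_mult mult_left_mono)
      qed
      note pert = INF_perturbation[OF ne bdd le]
      have "robust_value S D l \<Theta> (empirical_measure S X n \<omega>) (\<delta> n) = (INF \<theta>\<in>\<Theta>. ereal (w \<theta>))"
        unfolding robust_value_def w_def
        by (rule INF_cong) (use * sample_risk_empirical[OF elim(3) \<omega>] in auto)
      also have "\<dots> = ereal (INF \<theta>\<in>\<Theta>. w \<theta>)" by (rule INF_ereal[OF ne pert(1)])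
      finally show "\<exists>r. robust_value S D l \<Theta> (empirical_measure S X n \<omega>) (\<delta> n) = ereal r \<and>
          \<bar>r - (INF \<theta>\<in>\<Theta>. sample_risk n \<theta> \<omega> + c n * \<rho> \<theta>)\<bar> \<le> c n * e"
        using pert(2) by (intro exI conjI) (assumption, simp add: abs_minus_commute)
    qed (use tau in simp)
  qed
qed

lemma optimal_value_empirical:
  assumes "n \<ge> 1" "\<omega> \<in> space M"
  shows "optimal_value \<Theta> (risk l (empirical_measure S X n \<omega>)) = (INF \<theta>\<in>\<Theta>. sample_risk n \<theta> \<omega>)"
  unfolding optimal_value_def by (intro INF_cong refl sample_risk_empirical assms)

lemma measurable_optimal_value_empirical:
  assumes "n \<ge> 1"
  shows "(\<lambda>\<omega>. optimal_value \<Theta> (risk l (empirical_measure S X n \<omega>))) \<in> borel_measurable M"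
proof (subst measurable_cong[OF optimal_value_empirical[OF assms]])
  show "(\<lambda>\<omega>. INF \<theta>\<in>\<Theta>. sample_risk n \<theta> \<omega>) \<in> borel_measurable M"
    by (rule borel_measurable_INF_continuous[OF compact])
       (use \<theta>bar(1) measurable_sample_risk continuous_sample_risk in auto)
qed

end

section \<open>The three regimes of the radius\<close>

theorem theorem3p1:
  fixes S :: "(real ^ 'd) set"
    and \<Theta> :: "(real ^ 'm) set"
    and l :: "real ^ 'd \<Rightarrow> real ^ 'm \<Rightarrow> real"
    and Pstar :: "(real ^ 'd) measure"
    and M :: "'w measure"
    and X :: "nat \<Rightarrow> 'w \<Rightarrow> real ^ 'd"
    and D :: "(real ^ 'd) measure \<Rightarrow> (real ^ 'd) measure \<Rightarrow> ereal"
    and \<delta> :: "nat \<Rightarrow> real"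
    and N :: "'v measure"
    and g :: "real ^ 'm \<Rightarrow> 'v \<Rightarrow> real"
    and \<psi> :: "real ^ 'd \<Rightarrow> real"
    and \<theta>bar :: "real ^ 'm"
    and \<gamma> :: real
    and R \<epsilon> \<epsilon>' :: "nat \<Rightarrow> real ^ 'm \<Rightarrow> 'w \<Rightarrow> real"
    and \<rho> :: "real ^ 'm \<Rightarrow> real"
  \<comment> \<open>setting\<close>
  assumes "closed S" and "S \<noteq> {}" and "compact \<Theta>"
    and "continuous_on (S \<times> \<Theta>) (\<lambda>(x, \<theta>). l x \<theta>)"
    and "Pstar \<in> prob_measures_on S"
    and "prob_space M"
    and "\<forall>i\<ge>1. X i \<in> measurable M (borel_on S) \<and> distr M (borel_on S) (X i) = Pstar"
    and "prob_space.indep_vars M (\<lambda>_. borel_on S) X {1..}"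
    and "\<forall>P\<in>prob_measures_on S. \<forall>Q\<in>prob_measures_on S. D P Q \<ge> 0"
    and "\<forall>P\<in>prob_measures_on S. D P P = 0"
    and "\<forall>n. \<delta> n > 0" and "decseq \<delta>" and "\<delta> \<longlonglongrightarrow> 0"
    and "\<forall>n\<ge>1. (\<lambda>\<omega>. robust_value S D l \<Theta> (empirical_measure S X n \<omega>) (\<delta> n))
            \<in> borel_measurable M"
  \<comment> \<open>the Gaussian field\<close>
    and "prob_space N"
    and "gaussian_field N \<Theta> g"
    and "\<forall>\<theta>\<in>\<Theta>. (\<integral>v. g \<theta> v \<partial>N) = 0"
    and "\<forall>v\<in>space N. continuous_on \<Theta> (\<lambda>\<theta>. g \<theta> v)"
    and "\<forall>\<theta>\<in>\<Theta>. \<forall>\<theta>'\<in>\<Theta>. covariance N (g \<theta>) (g \<theta>') =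
            covariance Pstar (\<lambda>x. l x \<theta>) (\<lambda>x. l x \<theta>')"
  \<comment> \<open>assumption (1)\<close>
    and "\<theta>bar \<in> \<Theta>" and "integrable Pstar (\<lambda>x. (l x \<theta>bar)\<^sup>2)"
    and "\<psi> \<in> borel_measurable (borel_on S)" and "\<forall>x\<in>S. \<psi> x \<ge> 0"
    and "integrable Pstar (\<lambda>x. (\<psi> x)\<^sup>2)"
    and "AE x in Pstar. \<forall>\<theta>\<in>\<Theta>. \<forall>\<theta>'\<in>\<Theta>. \<bar>l x \<theta> - l x \<theta>'\<bar> \<le> \<psi> x * norm (\<theta> - \<theta>')"
  \<comment> \<open>assumption (2)\<close>
    and "\<gamma> > 0" and "continuous_on \<Theta> \<rho>"
    and "\<forall>n\<ge>1. random_field M \<Theta> (R n) \<and> random_field M \<Theta> (\<epsilon> n) \<and> random_field M \<Theta> (\<epsilon>' n)"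
    and "\<forall>n\<ge>1. AE \<omega> in M. \<forall>\<theta>\<in>\<Theta>.
            worst_case_risk S D l (empirical_measure S X n \<omega>) (\<delta> n) \<theta> =
              ereal (risk l (empirical_measure S X n \<omega>) \<theta>
                + \<delta> n powr \<gamma> * R n \<theta> \<omega> + \<delta> n powr \<gamma> * \<epsilon> n \<theta> \<omega>)"
    and "\<forall>n\<ge>1. AE \<omega> in M. \<forall>\<theta>\<in>\<Theta>. R n \<theta> \<omega> = \<rho> \<theta> + \<epsilon>' n \<theta> \<omega>"
    and "small_o_p M (\<lambda>n \<omega>. SUP \<theta>\<in>\<Theta>. ereal \<bar>\<epsilon> n \<theta> \<omega>\<bar>) 0"
    and "small_o_p M (\<lambda>n \<omega>. SUP \<theta>\<in>\<Theta>. ereal \<bar>\<epsilon>' n \<theta> \<omega>\<bar>) 0"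
  shows
    "((\<lambda>n. \<delta> n powr \<gamma>) \<in> o(\<lambda>n. real n powr (- 1 / 2)) \<longrightarrow>
        small_o_p M
          (\<lambda>n \<omega>. robust_value S D l \<Theta> (empirical_measure S X n \<omega>) (\<delta> n)
             - ereal (optimal_value \<Theta> (risk l (empirical_measure S X n \<omega>)))) (1 / 2)
      \<and> converges_in_distribution M
          (\<lambda>n \<omega>. real n powr (1 / 2) *
             (real_of_ereal (robust_value S D l \<Theta> (empirical_measure S X n \<omega>) (\<delta> n))
                - optimal_value \<Theta> (risk l Pstar)))
          N (\<lambda>v. INF \<theta>\<in>optimal_set \<Theta> (risk l Pstar). g \<theta> v))
   \<and> ((\<forall>n\<ge>1. \<delta> n powr \<gamma> = real n powr (- 1 / 2)) \<longrightarrow>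
        converges_in_distribution M
          (\<lambda>n \<omega>. real n powr (1 / 2) *
             (real_of_ereal (robust_value S D l \<Theta> (empirical_measure S X n \<omega>) (\<delta> n))
                - optimal_value \<Theta> (risk l Pstar)))
          N (\<lambda>v. INF \<theta>\<in>optimal_set \<Theta> (risk l Pstar). g \<theta> v + \<rho> \<theta>))
   \<and> ((\<lambda>n. real n powr (- 1 / 2)) \<in> o(\<lambda>n. \<delta> n powr \<gamma>) \<longrightarrow>
        converges_in_distribution M
          (\<lambda>n \<omega>. \<delta> n powr (- \<gamma>) *
             (real_of_ereal (robust_value S D l \<Theta> (empirical_measure S X n \<omega>) (\<delta> n))
                - optimal_value \<Theta> (risk l Pstar)))
          M (\<lambda>_. INF \<theta>\<in>optimal_set \<Theta> (risk l Pstar). \<rho> \<theta>))"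
proof -
  interpret iid_lipschitz_loss M S \<Theta> l Pstar X \<psi> \<theta>bar
    by (rule iid_lipschitz_loss.intro[OF assms(6)], unfold_locales) (use assms in auto)
  have ne: "\<Theta> \<noteq> {}" using assms(20) by auto
  define c where "c n = \<delta> n powr \<gamma>" for n
  have c: "c n > 0" for n using assms(11)[rule_format, of n] by (simp add: c_def)
  let ?rv = "\<lambda>n \<omega>. robust_value S D l \<Theta> (empirical_measure S X n \<omega>) (\<delta> n)"
  let ?r = "\<lambda>n \<omega>. real_of_ereal (?rv n \<omega>)"
  \<comment> \<open>Measurability is assumed from \<open>n = 1\<close> on. For \<open>n = 0\<close>
    the sum over the samples is empty, so the empirical measure does not depend on the outcome and
    the value is constant.\<close>
  have rm: "?r n \<in> borel_measurable M" for n
  proof (cases "n = 0")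
    case True
    then show ?thesis by (simp add: empirical_measure_def)
  next
    case False
    then show ?thesis using assms(14) by (intro borel_measurable_real_of_ereal) simp
  qed
  have close: "\<forall>\<^sub>F n in sequentially. likely M \<tau> (\<lambda>\<omega>.
      \<exists>r. ?rv n \<omega> = ereal r \<and> \<bar>r - (INF \<theta>\<in>\<Theta>. sample_risk n \<theta> \<omega> + c n * \<rho> \<theta>)\<bar> \<le> c n * e)"
    if "e > 0" "\<tau> > 0" for e \<tau>
    by (rule robust_value_close[where R = R, OF assms(27) less_imp_le[OF c] _ _ assms(31,32) that])
       (use assms(29,30) in \<open>auto simp: c_def\<close>)
  \<comment> \<open>\<open>real_of_ereal\<close> turns infinite values into 0, but these occur in
    the exceptional event only.\<close>
  have r: "\<forall>\<^sub>F n in sequentially. likely M \<tau>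
      (\<lambda>\<omega>. \<bar>?r n \<omega> - (INF \<theta>\<in>\<Theta>. sample_risk n \<theta> \<omega> + c n * \<rho> \<theta>)\<bar> \<le> c n * e)"
    if "e > 0" "\<tau> > 0" for e \<tau>
    using close[OF that] by eventually_elim (erule likely_mono, auto)
  have conv: "converges_in_distribution M (\<lambda>n \<omega>. a n * (?r n \<omega> - optimum))
      N (\<lambda>v. INF \<theta>\<in>optimal_set \<Theta> (risk l Pstar). \<alpha> * g \<theta> v + \<beta> * \<rho> \<theta>)"
    if "filterlim a at_top sequentially" "(\<lambda>n. a n / sqrt (real n)) \<longlonglongrightarrow> \<alpha>" "(\<lambda>n. a n * c n) \<longlonglongrightarrow> \<beta>"
    for a \<alpha> \<beta>
    by (rule scaled_value_weak_conv[OF assms(15,16) _ _ _ assms(27) that rm r])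
       (use assms(17,18,19) in auto)
  have sqrt_top: "filterlim (\<lambda>n. real n powr (1 / 2)) at_top sequentially"
    using filterlim_compose[OF sqrt_at_top filterlim_real_sequentially] by (simp add: powr_half_sqrt)
  \<comment> \<open>At \<open>n = 0\<close> the quotient is 0, so it equals 1 only
    eventually.\<close>
  have sqrt_ratio: "(\<lambda>n. real n powr (1 / 2) / sqrt (real n)) \<longlonglongrightarrow> 1"
    by (rule tendsto_eventually) (use eventually_gt_at_top[of 0] in \<open>eventually_elim, simp add: powr_half_sqrt\<close>)
  show ?thesis
  proof (intro conjI impI)
    assume "(\<lambda>n. \<delta> n powr \<gamma>) \<in> o(\<lambda>n. real n powr (- 1 / 2))"
    from smalloD_tendsto[OF this] have c0: "(\<lambda>n. real n powr (1 / 2) * c n) \<longlonglongrightarrow> 0"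
      by (simp add: c_def powr_minus_divide mult.commute)
    show "converges_in_distribution M (\<lambda>n \<omega>. real n powr (1 / 2) * (?r n \<omega> - optimum))
        N (\<lambda>v. INF \<theta>\<in>optimal_set \<Theta> (risk l Pstar). g \<theta> v)"
      using conv[OF sqrt_top sqrt_ratio c0] by simp
    show "small_o_p M (\<lambda>n \<omega>. ?rv n \<omega> - ereal (optimal_value \<Theta> (risk l (empirical_measure S X n \<omega>)))) (1 / 2)"
      unfolding small_o_p_def
    proof (rule likely_tends_to_zero_in_prob[OF assms(6)])
      show "\<forall>\<^sub>F n in sequentially. (\<lambda>\<omega>. ereal (real n powr (1 / 2)) *
          (?rv n \<omega> - ereal (optimal_value \<Theta> (risk l (empirical_measure S X n \<omega>))))) \<in> borel_measurable M"
        using eventually_ge_at_top[of 1]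
      proof eventually_elim
        case (elim n)
        have [measurable]: "?rv n \<in> borel_measurable M" using assms(14) elim by auto
        note [measurable] = measurable_optimal_value_empirical[OF elim]
        show ?case by measurable
      qed
      fix e \<tau> :: real assume e: "e > 0" and tau: "\<tau> > 0"
      \<comment> \<open>The robust value is within \<open>c n\<close> of the perturbed infimum, and
        dropping \<open>c n * \<rho>\<close> costs \<open>c n * B\<close>. In this regime any fixed
        multiple of \<open>c n\<close> vanishes after scaling, so \<open>close\<close> is taken with
        error 1.\<close>
      obtain B where B: "\<And>\<theta>. \<theta> \<in> \<Theta> \<Longrightarrow> \<bar>\<rho> \<theta>\<bar> \<le> B"
        using compact_imp_bounded[OF compact_continuous_image[OF assms(27,3)]] by (auto simp: bounded_iff)
      have "(\<lambda>n. real n powr (1 / 2) * c n * (1 + B)) \<longlonglongrightarrow> 0 * (1 + B)"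
        by (intro tendsto_intros c0)
      then have "\<forall>\<^sub>F n in sequentially. real n powr (1 / 2) * c n * (1 + B) < e"
        using e by (intro order_tendstoD(2)) auto
      then show "\<forall>\<^sub>F n in sequentially. likely M \<tau> (\<lambda>\<omega>. \<bar>ereal (real n powr (1 / 2)) *
          (?rv n \<omega> - ereal (optimal_value \<Theta> (risk l (empirical_measure S X n \<omega>))))\<bar> \<le> ereal e)"
        using close[OF zero_less_one tau] eventually_ge_at_top[of 1]
      proof eventually_elim
        case (elim n)
        from elim(2) show ?case
        proof (rule likely_mono)
          fix \<omega> assume \<omega>: "\<omega> \<in> space M" and
            "\<exists>r. ?rv n \<omega> = ereal r \<and> \<bar>r - (INF \<theta>\<in>\<Theta>. sample_risk n \<theta> \<omega> + c n * \<rho> \<theta>)\<bar> \<le> c n * 1"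
          then obtain r where r: "?rv n \<omega> = ereal r"
            "\<bar>r - (INF \<theta>\<in>\<Theta>. sample_risk n \<theta> \<omega> + c n * \<rho> \<theta>)\<bar> \<le> c n" by auto
          have "bdd_below ((\<lambda>\<theta>. sample_risk n \<theta> \<omega>) ` \<Theta>)"
            by (intro bdd_below_continuous_image[OF compact] continuous_sample_risk \<omega>)
          then have "\<bar>(INF \<theta>\<in>\<Theta>. sample_risk n \<theta> \<omega>) - (INF \<theta>\<in>\<Theta>. sample_risk n \<theta> \<omega> + c n * \<rho> \<theta>)\<bar> \<le> c n * B"
            by (rule INF_perturbation(2)[OF ne]) (use B c[of n] in \<open>auto simp: abs_mult\<close>)
          with r(2) have "\<bar>r - (INF \<theta>\<in>\<Theta>. sample_risk n \<theta> \<omega>)\<bar> \<le> c n * (1 + B)"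
            by (simp add: distrib_left)
          then have "real n powr (1 / 2) * \<bar>r - (INF \<theta>\<in>\<Theta>. sample_risk n \<theta> \<omega>)\<bar> \<le> real n powr (1 / 2) * (c n * (1 + B))"
            by (rule mult_left_mono) simp
          then have "\<bar>real n powr (1 / 2) * (r - (INF \<theta>\<in>\<Theta>. sample_risk n \<theta> \<omega>))\<bar> \<le> e"
            using elim(1) by (simp add: abs_mult mult.assoc)
          then show "\<bar>ereal (real n powr (1 / 2)) *
            (?rv n \<omega> - ereal (optimal_value \<Theta> (risk l (empirical_measure S X n \<omega>))))\<bar> \<le> ereal e"
            by (simp add: r(1) optimal_value_empirical[OF elim(3) \<omega>])
        qed simp
      qed
    qed
  next
    assume b: "\<forall>n\<ge>1. \<delta> n powr \<gamma> = real n powr (- 1 / 2)"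
    have c1: "(\<lambda>n. real n powr (1 / 2) * c n) \<longlonglongrightarrow> 1"
    proof (rule tendsto_eventually)
      show "\<forall>\<^sub>F n in sequentially. real n powr (1 / 2) * c n = 1"
        using eventually_ge_at_top[of 1]
        by eventually_elim (use b in \<open>simp add: c_def powr_add[symmetric]\<close>)
    qed
    show "converges_in_distribution M (\<lambda>n \<omega>. real n powr (1 / 2) * (?r n \<omega> - optimum))
        N (\<lambda>v. INF \<theta>\<in>optimal_set \<Theta> (risk l Pstar). g \<theta> v + \<rho> \<theta>)"
      using conv[OF sqrt_top sqrt_ratio c1] by simp
  next
    assume "(\<lambda>n. real n powr (- 1 / 2)) \<in> o(\<lambda>n. \<delta> n powr \<gamma>)"
    from smalloD_tendsto[OF this] have ratio: "(\<lambda>n. \<delta> n powr (- \<gamma>) / sqrt (real n)) \<longlonglongrightarrow> 0"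
      by (simp add: powr_minus_divide powr_half_sqrt mult.commute)
    \<comment> \<open>Positivity of \<open>\<gamma>\<close> and
      \<open>\<delta> \<longlonglongrightarrow> 0\<close> make the scale of this regime
      diverge.\<close>
    have "(\<lambda>n. \<delta> n powr \<gamma>) \<longlonglongrightarrow> 0 powr \<gamma>"
      by (rule tendsto_powr2[OF assms(13)]) (use assms(11,26) in \<open>auto intro!: always_eventually intro: less_imp_le\<close>)
    then have "filterlim (\<lambda>n. inverse (\<delta> n powr \<gamma>)) at_top sequentially"
      using c by (intro filterlim_inverse_at_top) (auto simp: c_def simp del: powr_gt_zero)
    then have top: "filterlim (\<lambda>n. \<delta> n powr (- \<gamma>)) at_top sequentially" by (simp add: powr_minus)
    have one: "(\<lambda>n. \<delta> n powr (- \<gamma>) * c n) \<longlonglongrightarrow> 1"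
    proof -
      have "\<delta> n \<noteq> 0" for n using assms(11) by (metis less_irrefl)
      then show ?thesis by (simp add: c_def powr_minus)
    qed
    define k where "k = (INF \<theta>\<in>optimal_set \<Theta> (risk l Pstar). \<rho> \<theta>)"
    have "converges_in_distribution M (\<lambda>n \<omega>. \<delta> n powr (- \<gamma>) * (?r n \<omega> - optimum)) N (\<lambda>_. k)"
      using conv[OF top ratio one] by (simp only: mult_zero_left add_0 mult_1 k_def)
    \<comment> \<open>The limit is constant, and its law is the same point mass on either
      probability space; this moves the claim from \<open>N\<close> to \<open>M\<close>.\<close>
    moreover have "distr N borel (\<lambda>_. k) = distr M borel (\<lambda>_. k)"
      using prob_space.distr_const[OF assms(15), of k borel] distr_const[of k borel] by simp
    ultimately show "converges_in_distribution M (\<lambda>n \<omega>. \<delta> n powr (- \<gamma>) * (?r n \<omega> - optimum))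
        M (\<lambda>_. INF \<theta>\<in>optimal_set \<Theta> (risk l Pstar). \<rho> \<theta>)"
      unfolding converges_in_distribution_def k_def[symmetric] by (metis borel_measurable_const)
  qed
qed

end
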